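(* For complex parameters $a,b,c$ for which all series and Gamma factors below are defined and the series converge, \begin{align*} &{}_3F_2\biggl[ \begin{matrix} a, \, b, \, c \\ -a+2 b+c, \, -a+b+2 c \end{matrix}\,; 1\biggr] =\frac {\Gamma(-\frac{a}{2}+b+c+\frac{1}{2})\, \Gamma(-\frac{3 a}{2}+2 b+c+\frac{1}{2})} {\Gamma(-a+b+c+\frac{1}{2})\, \Gamma(-a+2 b+c+\frac{1}{2})} \\ &\qquad\times \frac { \Gamma(-a+b+2 c)\, \Gamma(-3 a+2 b+2 c) \,\Gamma(-2 a+2 b+2 c) \,\Gamma(-2 a+4 b+2 c)} {\Gamma(-\frac{3 a}{2}+b+2 c)\, \Gamma(-\frac{5 a}{2}+2 b+2 c)\, \Gamma(-a+2 b+2 c)\, \Gamma(-3 a+4 b+2 c)} \\ &\qquad\times {}_5F_4 \biggl[ \begin{matrix} -2 a+2 b+2 c-1, \, c-\frac{a}{2}, \, -\frac{3 a}{2}+b+c, \, \frac{a}{2}, \, b-\frac{a}{2} \\[1.5pt] -\frac{3 a}{2}+2 b+c, \, -\frac{a}{2}+b+c, \, -\frac{5a}{2}+2 b+2 c, \, -\frac{3 a}{2}+b+2 c \end{matrix}\, ; 1\biggr]. \end{align*}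
   Context: The generalized hypergeometric series is ${}_pF_q\Bigl[\begin{matrix}a_1,\dots,a_p\\ b_1,\dots,b_q\end{matrix};z\Bigr]=\sum_{k\ge0}\frac{(a_1)_k\cdots(a_p)_k}{(b_1)_k\cdots(b_q)_k}\frac{z^k}{k!}$, where $(a)_k=a(a+1)\cdots(a+k-1)$ is the Pochhammer symbol; $\Gamma$ is Euler's Gamma function. *)

theory Defs
  imports "HOL-Analysis.Analysis"
begin

unbundle fps_syntax

(* The coefficients of fps_hypergeo as bs z already contain the factor z^k, so the value of
   the series at z is the plain sum of these coefficients; see hypergeo_nth. *)
definition hypergeo :: "complex list \<Rightarrow> complex list \<Rightarrow> complex \<Rightarrow> complex" where
  "hypergeo as bs z = (\<Sum>k. fps_hypergeo as bs z $ k)"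

(* A zero (b)_k in a denominator is excluded even if a numerator parameter would make
   the series terminate earlier. Convergence is ordinary convergence of the partial sums, so
   terminating series are included. *)
definition hypergeo_converges :: "complex list \<Rightarrow> complex list \<Rightarrow> complex \<Rightarrow> bool" where
  "hypergeo_converges as bs z \<longleftrightarrow>
     (\<forall>b\<in>set bs. b \<notin> \<int>\<^sub>\<le>\<^sub>0) \<and> summable (\<lambda>k. fps_hypergeo as bs z $ k)"

lemma foldl_mult_eq_prod_list:
  "foldl (\<lambda>r a. r * f a) (x :: 'a :: comm_monoid_mult) as = x * prod_list (map f as)"
  by (induction as arbitrary: x) (simp_all add: mult.assoc)

lemma hypergeo_nth:
  "fps_hypergeo as bs z $ k =
     prod_list (map (\<lambda>a. pochhammer a k) as) / prod_list (map (\<lambda>b. pochhammer b k) bs)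
       * z ^ k / fact k"
  by (simp add: foldl_mult_eq_prod_list)

end

theory Submission
  imports Defs "HOL-Complex_Analysis.Conformal_Mappings"
begin

text \<open>
  Put \<open>s = b + c - a\<close>, \<open>r = a/2\<close>, \<open>p = c - a/2\<close>. With the Gamma factors of the lower parameters absorbed
  into the terms and after the duplication formula, the claim is the entire identity
  \<open>L(s,r,p) = \<Gamma>(s) \<Gamma>(2s-2r) R(s,r,p)\<close>, where \<open>L\<close> has the upper parameters \<open>2r, r+p, r+s-p\<close> and \<open>R\<close> is
  well-poised with \<open>2s-1, p, s-p, r, s-r\<close>. For \<open>p = -n\<close> Gauss's theorem makes \<open>L\<close> a terminating sum, and the
  identity becomes one between polynomials, which follows by expanding both sides in
  \<open>(s-r)\<^sub>j (r)\<^sub>j\<close> with the sums of Saalschuetz, Dixon and Kummer. For real \<open>s > 1/2\<close> and \<open>0 < r < s\<close>, both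
  sides are Newton series \<open>\<Sum> e\<^sub>j (p)\<^sub>j (s-p)\<^sub>j\<close> with nonnegative coefficients, valid for \<open>0 < p < s\<close> and for
  \<open>p = -n\<close>; the values at \<open>p = -n\<close> determine the \<open>e\<^sub>j\<close>, so the identity holds for \<open>0 < p < s\<close>. Analytic
  continuation in \<open>p\<close>, \<open>r\<close>, \<open>s\<close> in turn covers all parameters for which both series converge
  without terminating, and continuation along lines covers the terminating cases.
\<close>

section \<open>Terminating summation formulas\<close>

text \<open>The values at p = -n do not determine an entire function of p: sin(pi p) vanishes at all
  these points. Positivity takes the place of a growth estimate. Read backwards, Gauss's theorem
  writes the part of each term that depends on p as a sum of products (c+p)_N (c+s-p)_N with weights
  free of p, and Saalschuetz's sum expands such a product with coefficients again free of p. For 0 <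
  p < s everything is nonnegative, so the triple sum may be rearranged; the summability of the
  weights gained there is then available at p = -n. The bound s > 1/2 makes the upper parameter 2s -
  1 positive. In the polynomial identity the left side reaches the common basis through the
  quadratic transformation of 2F1(2x, s; 2s; z), taken coefficient by coefficient with x = s - r.
  Convergence is that of partial sums, so it must also be shown that a nonterminating series of this
  shape converges at 1 only if its excess has positive real part; otherwise conditionally convergent
  boundary cases would remain.\<close>

lemma pochhammer_append:
  fixes z :: "'a::comm_ring_1"
  assumes "w = z + of_nat m"
  shows "pochhammer z m * pochhammer w n = pochhammer z (m + n)"
  using assms by (simp add: pochhammer_product')

lemma binomial_absorb_down:
  "of_nat k * of_nat (n choose k) = (of_nat n - of_nat k + 1 :: 'a::comm_ring_1) * of_nat (n choose (k - 1))" if k0: "k > 0"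
proof (cases "k \<le> Suc n")
  case True
  obtain j where j: "k = Suc j" using k0 by (cases k) auto
  have "Suc j * (n choose Suc j) = (n - j) * (n choose j)"
    by (metis binomial_absorb_comp binomial_absorption)
  then have "(of_nat (Suc j * (n choose Suc j)) :: 'a) = of_nat ((n - j) * (n choose j))"
    by simp
  moreover have "of_nat (n - j) = (of_nat n - of_nat j :: 'a)"
    using True j by (simp add: of_nat_diff)
  ultimately show ?thesis using j by (simp add: algebra_simps del: binomial_Suc_Suc)
qed (use k0 in \<open>simp add: binomial_eq_0\<close>)

text \<open>When multiplication by \<open>X\<close> sends each \<open>b i\<close> to
  \<open>b (Suc i)\<close> plus a multiple of itself, the coefficients obey a Pascal-type recurrence
  whose two ends have a single summand. Both Pochhammer expansions below are inductions with this
  step.\<close>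

lemma sum_Suc_two_term:
  fixes c c' b :: "nat \<Rightarrow> 'a::comm_ring_1"
  assumes "\<And>i. i \<le> n \<Longrightarrow> X * b i = b (Suc i) + e i * b i"
    and "c' 0 = e 0 * c 0" "c' (Suc n) = c n" "\<And>i. i < n \<Longrightarrow> c' (Suc i) = c i + e (Suc i) * c (Suc i)"
  shows "(\<Sum>i\<le>n. c i * b i) * X = (\<Sum>i\<le>Suc n. c' i * b i)"
proof -
  have "(\<Sum>i\<le>n. c i * b i) * X = (\<Sum>i\<le>n. c i * b (Suc i)) + (\<Sum>i\<le>n. e i * c i * b i)"
    unfolding sum_distrib_right sum.distrib [symmetric]
  proof (intro sum.cong refl)
    fix i assume "i \<in> {..n}"
    then have "c i * (X * b i) = c i * (b (Suc i) + e i * b i)" using assms(1) by simp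
    then show "c i * b i * X = c i * b (Suc i) + e i * c i * b i" by (simp only: algebra_simps)
  qed
  also have "(\<Sum>i\<le>n. c i * b (Suc i)) = (\<Sum>i<n. c i * b (Suc i)) + c n * b (Suc n)"
    by (simp add: lessThan_Suc_atMost [symmetric])
  also have "(\<Sum>i\<le>n. e i * c i * b i) = e 0 * c 0 * b 0 + (\<Sum>i<n. e (Suc i) * c (Suc i) * b (Suc i))"
    by (subst lessThan_Suc_atMost [symmetric], subst sum.lessThan_Suc_shift) simp
  also have "(\<Sum>i<n. c i * b (Suc i)) + c n * b (Suc n) + (e 0 * c 0 * b 0 + (\<Sum>i<n. e (Suc i) * c (Suc i) * b (Suc i)))
     = c' 0 * b 0 + (\<Sum>i<n. (c i + e (Suc i) * c (Suc i)) * b (Suc i)) + c' (Suc n) * b (Suc n)"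
    by (simp add: assms algebra_simps sum.distrib)
  also have "\<dots> = c' 0 * b 0 + (\<Sum>i<n. c' (Suc i) * b (Suc i)) + c' (Suc n) * b (Suc n)"
    by (intro arg_cong2[where f="(+)"] sum.cong) (auto simp: assms)
  also have "\<dots> = (\<Sum>i\<le>Suc n. c' i * b i)"
    by (subst lessThan_Suc_atMost [symmetric], subst sum.lessThan_Suc_shift) (simp add: lessThan_Suc_atMost [symmetric])
  finally show ?thesis .
qed

text \<open>After removal of the common factor \<open>P\<close> only binomial absorption is left.
  The recurrence serves the Chu-Vandermonde and the Saalschuetz coefficients alike.\<close>

lemma binomial_pochhammer_step:
  fixes w :: "'a::comm_ring_1"
  assumes "i < n"
  shows "of_nat (Suc n choose Suc i) * pochhammer (w + of_nat (Suc i)) (n - i)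
     = of_nat (n choose i) * pochhammer (w + of_nat i) (n - i)
       + (w + of_nat n + of_nat (Suc i)) * (of_nat (n choose Suc i) * pochhammer (w + of_nat (Suc i)) (n - Suc i))"
proof -
  obtain d where d: "n = Suc (i + d)" using assms less_iff_Suc_add by auto
  define P where "P = pochhammer (w + of_nat (Suc i)) d"
  have 1: "pochhammer (w + of_nat (Suc i)) (n - i) = P * (w + of_nat n)"
    by (simp add: d P_def pochhammer_Suc algebra_simps Suc_diff_le)
  have 2: "pochhammer (w + of_nat i) (n - i) = (w + of_nat i) * P"
    by (simp add: d P_def pochhammer_rec algebra_simps Suc_diff_le)
  have 3: "pochhammer (w + of_nat (Suc i)) (n - Suc i) = P"
    by (simp add: d P_def)
  have 4: "of_nat (Suc i) * of_nat (n choose Suc i) = (of_nat n - of_nat i :: 'a) * of_nat (n choose i)"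
    using binomial_absorb_down[of "Suc i" n, where 'a='a] by (simp del: binomial_Suc_Suc)
  have "of_nat (Suc n choose Suc i) * (w + of_nat n)
     = of_nat (n choose i) * (w + of_nat i)
       + (w + of_nat n + of_nat (Suc i)) * (of_nat (n choose Suc i) :: 'a)"
    using 4 by (simp add: algebra_simps)
  then have "P * (of_nat (Suc n choose Suc i) * (w + of_nat n))
     = P * (of_nat (n choose i) * (w + of_nat i)
       + (w + of_nat n + of_nat (Suc i)) * (of_nat (n choose Suc i) :: 'a))"
    by simp
  then show ?thesis unfolding 1 2 3 by (simp only: algebra_simps)
qed

text \<open>The Chu-Vandermonde sum with denominators cleared, hence valid in every commutative
  ring. The new factor splits as z - y + n = -(y+m) + (z+n+m), a shift plus a diagonal term on the
  basis (-1)^m (y)_m.\<close>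

lemma pochhammer_diff_expansion:
  fixes y z :: "'a::comm_ring_1"
  shows "(\<Sum>m\<le>n. of_nat (n choose m) * (-1) ^ m * pochhammer y m * pochhammer (z + of_nat m) (n - m))
           = pochhammer (z - y) n"
proof (induction n)
  case (Suc n)
  define c where "c = (\<lambda>n m. of_nat (n choose m) * pochhammer (z + of_nat m) (n - m))"
  define b where "b = (\<lambda>m. (-1) ^ m * pochhammer y m)"
  define e where "e = (\<lambda>m. z + of_nat n + of_nat m)"
  have IH: "(\<Sum>i\<le>n. c n i * b i) = pochhammer (z - y) n"
    using Suc by (simp add: c_def b_def algebra_simps)
  have "(\<Sum>i\<le>n. c n i * b i) * (z - y + of_nat n) = (\<Sum>i\<le>Suc n. c (Suc n) i * b i)"
  proof (rule sum_Suc_two_term[where e=e])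
    show "(z - y + of_nat n) * b i = b (Suc i) + e i * b i" for i
      by (simp add: b_def e_def pochhammer_Suc algebra_simps)
    show "c (Suc n) 0 = e 0 * c n 0"
      by (simp add: c_def e_def pochhammer_Suc algebra_simps)
    show "c (Suc n) (Suc n) = c n n" by (simp add: c_def)
    show "c (Suc n) (Suc i) = c n i + e (Suc i) * c n (Suc i)" if "i < n" for i
      using binomial_pochhammer_step[OF that, of z] unfolding c_def e_def diff_Suc_Suc .
  qed
  then show ?case unfolding IH
    by (simp add: pochhammer_Suc c_def b_def algebra_simps)
qed simp

text \<open>Saalschuetz's sum as a polynomial identity. It rests on (y+t+n)(y'+t+n) = (y+i)(y'+i) +
  (t+n-i)(t+y+y'+n+i): the diagonal term depends on \<open>y\<close> and \<open>y'\<close> only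
  through their sum. For pairs with a fixed sum, such as x, s-x or p, s-p, the coefficients are
  therefore constants.\<close>

lemma pochhammer_shift_product:
  fixes y y' t :: "'a::comm_ring_1"
  shows "pochhammer (y + t) n * pochhammer (y' + t) n =
    (\<Sum>i\<le>n. of_nat (n choose i) * pochhammer (t + y + y' + of_nat i) (n - i) * pochhammer t (n - i)
       * (pochhammer y i * pochhammer y' i))"
proof (induction n)
  case (Suc n)
  define c where "c = (\<lambda>n i. of_nat (n choose i) * pochhammer (t + y + y' + of_nat i) (n - i) * pochhammer t (n - i))"
  define b where "b = (\<lambda>i. pochhammer y i * pochhammer y' i)"
  define e where "e = (\<lambda>i. (t + of_nat n - of_nat i) * (t + y + y' + of_nat n + of_nat i))"
  have IH: "(\<Sum>i\<le>n. c n i * b i) = pochhammer (y + t) n * pochhammer (y' + t) n"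
    using Suc by (simp add: c_def b_def algebra_simps)
  have "(\<Sum>i\<le>n. c n i * b i) * ((y + t + of_nat n) * (y' + t + of_nat n)) = (\<Sum>i\<le>Suc n. c (Suc n) i * b i)"
  proof (rule sum_Suc_two_term[where e=e])
    show "(y + t + of_nat n) * (y' + t + of_nat n) * b i = b (Suc i) + e i * b i" for i
      by (simp add: b_def e_def pochhammer_Suc algebra_simps)
    show "c (Suc n) 0 = e 0 * c n 0"
      by (simp add: c_def e_def pochhammer_Suc algebra_simps)
    show "c (Suc n) (Suc n) = c n n" by (simp add: c_def)
    show "c (Suc n) (Suc i) = c n i + e (Suc i) * c n (Suc i)" if "i < n" for i
    proof -
      have "pochhammer t (n - i) = pochhammer t (n - Suc i) * (t + of_nat n - of_nat (Suc i))"
        using that by (metis Suc_diff_Suc Suc_leI add_diff_eq of_nat_diff pochhammer_Suc)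
      moreover have "A * P * T = B * Q * T + (w * f) * (C * R * T')"
        if "A * P = B * Q + f * (C * R)" "T = T' * w" for A P B Q C R T T' w f :: 'a
        using arg_cong[OF that(1), of "\<lambda>u. u * T"] unfolding that(2) by (simp only: algebra_simps)
      ultimately show ?thesis
        using binomial_pochhammer_step[OF that, of "t + y + y'"]
        unfolding c_def e_def diff_Suc_Suc by (simp only: add_diff_eq)
    qed
  qed
  then show ?case unfolding IH
    by (simp add: pochhammer_Suc c_def b_def algebra_simps)
qed simp

text \<open>Kummer's sum 2F1(a, -l; 1+a+l; -1), multiplied by (1+a+l)_l. The proof is creative
  telescoping in l: \<open>U\<close> is the certificate, and 2(1+a+2l) = 4((1+a)/2 + l) is the
  quotient of consecutive right sides.\<close>

lemma kummer_terminating: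
  fixes a :: "'a::field_char_0"
  shows "(\<Sum>k\<le>l. of_nat (l choose k) * pochhammer a k * pochhammer (1 + a + of_nat (k + l)) (l - k))
     = 4 ^ l * pochhammer ((1 + a) / 2) l"
proof (induction l)
  case (Suc l)
  define t where "t = (\<lambda>l k. of_nat (l choose k) * pochhammer a k * pochhammer (1 + a + of_nat (k + l)) (l - k))"
  define U where "U = (\<lambda>k. if k = 0 then 0 else of_nat (l choose (k - 1)) * pochhammer a k * pochhammer (1 + a + of_nat (k + l)) (Suc l - k))"
  have step: "t (Suc l) k = 2 * (1 + a + 2 * of_nat l) * t l k + (U k - U (Suc k))" if "k \<le> Suc l" for k
  proof -
    \<comment> \<open>For k = l and k = l+1 the lengths l-k and l+1-k degenerate; otherwise l =
      k+d+1 exposes the factor \<open>P\<close> shared by all four terms.\<close>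
    consider "k = Suc l" | "k = l" | d where "l = Suc (k + d)"
      using \<open>k \<le> Suc l\<close> by (metis le_SucE less_iff_Suc_add nat_less_le)
    then show ?thesis
    proof cases
      case 1
      then show ?thesis by (simp add: t_def U_def pochhammer_Suc)
    next
      case 2
      have "of_nat k * of_nat (l choose k) = (1 :: 'a) * of_nat (l choose (k - 1))" if "k > 0"
        using binomial_absorb_down[OF that, of l, where 'a='a] 2 by simp
      then have *: "of_nat (l choose (l - 1)) = (of_nat l :: 'a)" if "l > 0" using 2 that by simp
      show ?thesis
      proof (cases l)
        case 0
        then show ?thesis using 2 by (simp add: t_def U_def field_simps)
      next
        case (Suc l')
        then have "of_nat (l choose (l - 1)) = (of_nat l :: 'a)" using * by simp
        then show ?thesis using 2 Suc by (simp add: t_def U_def pochhammer_Suc field_simps)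
      qed
    next
      case 3
      define P where "P = pochhammer (2 + a + of_nat (k + l)) d"
      have 1: "pochhammer (1 + a + of_nat (k + l)) (l - k) = (1 + a + of_nat (k + l)) * P"
        using 3 by (simp add: P_def pochhammer_rec algebra_simps Suc_diff_le)
      have 2: "pochhammer (1 + a + of_nat (k + Suc l)) (Suc l - k) = P * (1 + a + 2 * of_nat l) * (2 + a + 2 * of_nat l)"
      proof -
        have "Suc l - k = Suc (Suc d)" "1 + a + of_nat (k + Suc l) = 2 + a + of_nat (k + l)"
          using 3 by simp_all
        moreover have "2 + a + of_nat (k + l) + of_nat d = 1 + a + 2 * of_nat l"
          "2 + a + of_nat (k + l) + of_nat (Suc d) = 2 + a + 2 * of_nat l"
          using 3 by simp_all
        ultimately show ?thesis unfolding P_def by (simp only: pochhammer_Suc)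
      qed
      have 4: "pochhammer (1 + a + of_nat (Suc k + l)) (Suc l - Suc k) = P * (1 + a + 2 * of_nat l)"
        using 3 by (simp add: P_def pochhammer_Suc algebra_simps Suc_diff_le)
      have 5: "pochhammer (1 + a + of_nat (k + l)) (Suc l - k) = (1 + a + of_nat (k + l)) * P * (1 + a + 2 * of_nat l)"
      proof -
        have "Suc l - k = Suc (Suc d)" using 3 by simp
        then have "pochhammer (1 + a + of_nat (k + l)) (Suc l - k) =
            (1 + a + of_nat (k + l)) * pochhammer (1 + a + of_nat (k + l) + 1) (Suc d)"
          by (simp only: pochhammer_rec)
        also have "1 + a + of_nat (k + l) + 1 = 2 + a + of_nat (k + l)" by simp
        also have "pochhammer (2 + a + of_nat (k + l)) (Suc d) = P * (1 + a + 2 * of_nat l)"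
          using 3 by (simp add: P_def pochhammer_Suc)
        finally show ?thesis by (simp only: mult.assoc)
      qed
      show ?thesis
      proof (cases "k = 0")
        case True
        then show ?thesis using 1 2 4 5 by (simp add: t_def U_def algebra_simps)
      next
        case False
        define C where "C = (of_nat (l choose (k - 1)) :: 'a)"
        define B where "B = (of_nat (l choose k) :: 'a)"
        have B: "of_nat k * B = (of_nat l - of_nat k + 1) * C"
          using binomial_absorb_down[of k l, where 'a='a] False by (simp add: B_def C_def)
        have S: "of_nat (Suc l choose k) = B + C"
          using False by (cases k) (auto simp: B_def C_def)
        define Q where "Q = pochhammer a k"
        have "t (Suc l) k = (B + C) * Q * (P * (1 + a + 2 * of_nat l) * (2 + a + 2 * of_nat l))"
          unfolding t_def 2 S Q_def ..
        moreover have "t l k = B * Q * ((1 + a + of_nat (k + l)) * P)"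
          unfolding t_def 1 B_def Q_def ..
        moreover have "U k = C * Q * ((1 + a + of_nat (k + l)) * P * (1 + a + 2 * of_nat l))"
          unfolding U_def 5 C_def Q_def using False by simp
        moreover have "U (Suc k) = B * (Q * (a + of_nat k)) * (P * (1 + a + 2 * of_nat l))"
          unfolding U_def 4 B_def Q_def by (simp add: pochhammer_Suc)
        moreover have "(B + C) * (2 + a + 2 * of_nat l) = 2 * B * (1 + a + of_nat (k + l))
            + C * (1 + a + of_nat (k + l)) - B * (a + of_nat k)"
          using B by (simp add: algebra_simps)
        then have "(Q * P * (1 + a + 2 * of_nat l)) * ((B + C) * (2 + a + 2 * of_nat l)) = (Q * P * (1 + a + 2 * of_nat l)) * (2 * B * (1 + a + of_nat (k + l))
            + C * (1 + a + of_nat (k + l)) - B * (a + of_nat k))" by simp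
        ultimately show ?thesis by (simp only: algebra_simps)
      qed
    qed
  qed
  have "(\<Sum>k\<le>Suc l. t (Suc l) k) = 2 * (1 + a + 2 * of_nat l) * (\<Sum>k\<le>Suc l. t l k) + (\<Sum>k\<le>Suc l. U k - U (Suc k))"
    unfolding sum_distrib_left sum.distrib [symmetric] using step by (intro sum.cong) auto
  also have "(\<Sum>k\<le>Suc l. U k - U (Suc k)) = 0"
    unfolding sum_telescope by (simp add: U_def)
  also have "(\<Sum>k\<le>Suc l. t l k) = 4 ^ l * pochhammer ((1 + a) / 2) l"
    using Suc by (simp add: t_def)
  finally show ?case by (simp add: t_def pochhammer_Suc field_simps)
qed simp

lemma sum_triangle_reindex:
  fixes g :: "nat \<Rightarrow> nat \<Rightarrow> 'a::comm_monoid_add"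
  shows "(\<Sum>k\<le>n. \<Sum>i\<le>n - k. g k (k + i)) = (\<Sum>l\<le>n. \<Sum>k\<le>l. g k l)"
proof -
  have "(\<Sum>k\<le>n. \<Sum>i\<le>n - k. g k (k + i)) = (\<Sum>(k, i)\<in>(SIGMA k:{..n}. {..n - k}). g k (k + i))"
    by (subst sum.Sigma) auto
  also have "\<dots> = (\<Sum>(l, k)\<in>(SIGMA l:{..n}. {..l}). g k l)"
    by (rule sum.reindex_bij_witness[of _ "\<lambda>(l, k). (k, l - k)" "\<lambda>(k, i). (k + i, k)"]) auto
  also have "\<dots> = (\<Sum>l\<le>n. \<Sum>k\<le>l. g k l)"
    by (subst sum.Sigma) auto
  finally show ?thesis .
qed

text \<open>Dixon's well-poised 3F2(a, b, -j; 1+a-b, 1+a+j; 1) with denominators cleared. Expanding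
  (b)_k (1+a-b+k)_{j-k} by Chu-Vandermonde collects (b)_l; the inner sum over k is then free of b
  and is Kummer's, and the outer sum is Chu-Vandermonde again.\<close>

lemma dixon_terminating:
  fixes a b :: "'a::field_char_0"
  shows "(\<Sum>k\<le>j. (-1) ^ k * of_nat (j choose k) * pochhammer a k * pochhammer b k
        * pochhammer (1 + a - b + of_nat k) (j - k) * pochhammer (1 + a + of_nat (j + k)) (j - k))
     = 4 ^ j * pochhammer ((1 + a) / 2) j * pochhammer (1 + a / 2 - b) j"
    (is "?L = _")
proof -
  define g where "g = (\<lambda>k l. (-1) ^ k * of_nat (j choose k) * pochhammer a k * pochhammer (1 + a + of_nat (j + k)) (j - k)
     * (of_nat ((j - k) choose (l - k)) * (-1) ^ (l - k) * pochhammer b l * pochhammer (1 + a + of_nat (k + l)) (j - l)))"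
  have "?L = (\<Sum>k\<le>j. \<Sum>i\<le>j - k. g k (k + i))"
  proof (intro sum.cong refl)
    fix k assume k: "k \<in> {..j}"
    have "pochhammer b k * pochhammer (1 + a - b + of_nat k) (j - k) =
      pochhammer b k * pochhammer (1 + a + 2 * of_nat k - (b + of_nat k)) (j - k)"
      by (simp add: algebra_simps)
    also have "\<dots> = (\<Sum>i\<le>j - k. of_nat ((j - k) choose i) * (-1) ^ i * pochhammer b (k + i) *
        pochhammer (1 + a + of_nat (k + (k + i))) (j - (k + i)))"
      unfolding pochhammer_diff_expansion [symmetric] sum_distrib_left
    proof (intro sum.cong refl)
      fix i
      have 1: "pochhammer b k * pochhammer (b + of_nat k) i = pochhammer b (k + i)"
        by (rule pochhammer_append [OF refl])
      have 2: "1 + a + 2 * of_nat k + of_nat i = 1 + a + of_nat (k + (k + i))" "j - k - i = j - (k + i)"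
        by simp_all
      show "pochhammer b k * (of_nat ((j - k) choose i) * (- 1) ^ i * pochhammer (b + of_nat k) i *
          pochhammer (1 + a + 2 * of_nat k + of_nat i) (j - k - i))
        = of_nat ((j - k) choose i) * (- 1) ^ i * pochhammer b (k + i) *
          pochhammer (1 + a + of_nat (k + (k + i))) (j - (k + i))"
        unfolding 2 1 [symmetric] by (simp only: ac_simps)
    qed
    finally have *: "pochhammer b k * pochhammer (1 + a - b + of_nat k) (j - k) = \<dots>" .
    have "(-1) ^ k * of_nat (j choose k) * pochhammer a k * pochhammer b k
        * pochhammer (1 + a - b + of_nat k) (j - k) * pochhammer (1 + a + of_nat (j + k)) (j - k)
       = (-1) ^ k * of_nat (j choose k) * pochhammer a k * pochhammer (1 + a + of_nat (j + k)) (j - k)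
         * (pochhammer b k * pochhammer (1 + a - b + of_nat k) (j - k))"
      by (simp only: ac_simps)
    also have "\<dots> = (\<Sum>i\<le>j - k. g k (k + i))"
      unfolding * sum_distrib_left g_def by simp
    finally show "(-1) ^ k * of_nat (j choose k) * pochhammer a k * pochhammer b k
        * pochhammer (1 + a - b + of_nat k) (j - k) * pochhammer (1 + a + of_nat (j + k)) (j - k) = \<dots>" .
  qed
  also have "\<dots> = (\<Sum>l\<le>j. \<Sum>k\<le>l. g k l)" by (rule sum_triangle_reindex)
  also have "\<dots> = (\<Sum>l\<le>j. 4 ^ j * pochhammer ((1 + a) / 2) j *
       (of_nat (j choose l) * (-1) ^ l * pochhammer b l * pochhammer (1 + a / 2 + of_nat l) (j - l)))"
  proof (intro sum.cong refl)
    fix l assume "l \<in> {..j}"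
    then have l: "l \<le> j" by simp
    have "(\<Sum>k\<le>l. g k l) = (\<Sum>k\<le>l. (-1) ^ l * pochhammer b l * of_nat (j choose l) * pochhammer (1 + a + of_nat (2 * l)) (2 * (j - l))
        * (of_nat (l choose k) * pochhammer a k * pochhammer (1 + a + of_nat (k + l)) (l - k)))"
    proof (intro sum.cong refl)
      fix k assume "k \<in> {..l}"
      then have k: "k \<le> l" by simp
      have 1: "of_nat (j choose k) * of_nat ((j - k) choose (l - k)) = (of_nat (j choose l) * of_nat (l choose k) :: 'a)"
        using choose_mult[OF k l] by (metis of_nat_mult)
      have 2: "(-1) ^ k * (-1) ^ (l - k) = ((-1) ^ l :: 'a)"
        using k by (simp flip: power_add)
      have "pochhammer (1 + a + of_nat (k + l)) (j - l) * pochhammer (1 + a + of_nat (j + k)) (j - k)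
         = pochhammer (1 + a + of_nat (k + l)) (j - l + (j - k))"
        using l by (intro pochhammer_append) (simp add: of_nat_diff)
      also have "j - l + (j - k) = l - k + 2 * (j - l)" using k l by simp
      also have "pochhammer (1 + a + of_nat (k + l)) (l - k + 2 * (j - l)) =
          pochhammer (1 + a + of_nat (k + l)) (l - k) * pochhammer (1 + a + of_nat (2 * l)) (2 * (j - l))"
        using k by (intro pochhammer_append [symmetric]) (simp add: of_nat_diff)
      finally have 3: "pochhammer (1 + a + of_nat (k + l)) (j - l) * pochhammer (1 + a + of_nat (j + k)) (j - k) = \<dots>" .
      have "g k l = ((-1) ^ k * (-1) ^ (l - k)) * (of_nat (j choose k) * of_nat ((j - k) choose (l - k))) * pochhammer a k * pochhammer b l
         * (pochhammer (1 + a + of_nat (k + l)) (j - l) * pochhammer (1 + a + of_nat (j + k)) (j - k))"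
        unfolding g_def by (simp only: ac_simps)
      then show "g k l = (-1) ^ l * pochhammer b l * of_nat (j choose l) * pochhammer (1 + a + of_nat (2 * l)) (2 * (j - l))
        * (of_nat (l choose k) * pochhammer a k * pochhammer (1 + a + of_nat (k + l)) (l - k))"
        unfolding 1 2 3 by (simp only: ac_simps)
    qed
    also have "\<dots> = (-1) ^ l * pochhammer b l * of_nat (j choose l) * pochhammer (1 + a + of_nat (2 * l)) (2 * (j - l))
        * (4 ^ l * pochhammer ((1 + a) / 2) l)"
      unfolding sum_distrib_left [symmetric] kummer_terminating ..
    \<comment> \<open>Duplication splits this symbol: one half completes ((1+a)/2)_l to ((1+a)/2)_j,
      the other is the weight required by the last Chu-Vandermonde sum.\<close>
    also have "pochhammer (1 + a + of_nat (2 * l)) (2 * (j - l)) =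
        4 ^ (j - l) * pochhammer ((1 + a) / 2 + of_nat l) (j - l) * pochhammer (1 + a / 2 + of_nat l) (j - l)"
    proof -
      have "1 + a + of_nat (2 * l) = 2 * ((1 + a) / 2 + of_nat l)" "(1 + a) / 2 + of_nat l + 1 / 2 = 1 + a / 2 + of_nat l"
        by (simp_all add: field_simps)
      then show ?thesis by (simp only: pochhammer_double) (simp add: power_mult)
    qed
    also have "(-1) ^ l * pochhammer b l * of_nat (j choose l) * (4 ^ (j - l) * pochhammer ((1 + a) / 2 + of_nat l) (j - l)
          * pochhammer (1 + a / 2 + of_nat l) (j - l)) * (4 ^ l * pochhammer ((1 + a) / 2) l)
       = (4 ^ l * 4 ^ (j - l)) * (pochhammer ((1 + a) / 2) l * pochhammer ((1 + a) / 2 + of_nat l) (j - l)) *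
       (of_nat (j choose l) * (-1) ^ l * pochhammer b l * pochhammer (1 + a / 2 + of_nat l) (j - l))"
      by (simp only: ac_simps)
    also have "(4 ^ l * 4 ^ (j - l) :: 'a) = 4 ^ j" using l by (simp flip: power_add)
    also have "pochhammer ((1 + a) / 2) l * pochhammer ((1 + a) / 2 + of_nat l) (j - l) = pochhammer ((1 + a) / 2) j"
      using l by (subst pochhammer_append) auto
    finally show "(\<Sum>k\<le>l. g k l) = 4 ^ j * pochhammer ((1 + a) / 2) j *
       (of_nat (j choose l) * (-1) ^ l * pochhammer b l * pochhammer (1 + a / 2 + of_nat l) (j - l))" .
  qed
  also have "\<dots> = 4 ^ j * pochhammer ((1 + a) / 2) j * pochhammer (1 + a / 2 - b) j"
    unfolding sum_distrib_left [symmetric] pochhammer_diff_expansion ..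
  finally show ?thesis .
qed

section \<open>Expansion of both sides of the terminating identity in a common polynomial
  basis\<close>

text \<open>Coefficient of z^m/m! in the quadratic transformation 2F1(2x, s; 2s; z) = (1-z)^(-x)
  2F1(x, s-x; s+1/2; z^2/(4z-4)). The proof is creative telescoping in m with certificate
  \<open>H\<close>; \<open>G\<close> is \<open>H\<close> moved by one index.\<close>

lemma quadratic_expansion:
  fixes x s :: "'a::field_char_0"
  assumes "\<And>n. pochhammer (2 * s) n \<noteq> 0"
  shows "pochhammer (2 * x) m * pochhammer s m / pochhammer (2 * s) m =
     (\<Sum>j\<le>m. of_nat (m choose (2 * j)) * (fact (2 * j) / fact j) * (-1/4) ^ j * pochhammer (s - x) j
        * pochhammer x (m - j) / pochhammer (s + 1/2) j)"
proof (induction m)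
  case (Suc m)
  have nz: "2 * s + of_nat n \<noteq> 0" for n
    using assms[of "Suc n"] by (simp add: pochhammer_Suc)
  have nz1: "s + 1/2 + of_nat n \<noteq> 0" for n
  proof -
    have "2 * s + of_nat (2 * n + 1) = 2 * (s + 1/2 + of_nat n)" by (simp add: field_simps)
    then show ?thesis using nz[of "2 * n + 1"] by (metis mult_zero_right)
  qed
  define t where "t = (\<lambda>m j. of_nat (m choose (2 * j)) * (fact (2 * j) / fact j) * (-1/4) ^ j * pochhammer (s - x) j
        * pochhammer x (m - j) / pochhammer (s + 1/2) j)"
  define H where "H = (\<lambda>j. (of_nat m - 2 * of_nat j) * (s - x + of_nat j) * t m j)"
  define G where "G = (\<lambda>j. case j of 0 \<Rightarrow> 0 | Suc i \<Rightarrow> H i)"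
  have t0: "t n j = 0" if "2 * j > n" for n j using that by (simp add: t_def binomial_eq_0)
  have tf: "t n j = fact n / (fact d * fact j) * (-1/4) ^ j * pochhammer (s - x) j
        * pochhammer x (n - j) / pochhammer (s + 1/2) j" if "n = 2 * j + d" for n j d
    using that by (simp add: t_def binomial_fact)
  have step: "(2 * s + of_nat m) * t (Suc m) j = (2 * x + of_nat m) * (s + of_nat m) * t m j + (G (Suc j) - G j)"
    if "j \<le> Suc m" for j
  proof (cases j)
    case 0
    then show ?thesis by (simp add: t_def G_def H_def pochhammer_Suc algebra_simps)
  next
    case (Suc i)
    \<comment> \<open>The generic range; the edge m+1 = 2j, where \<open>t m j\<close> vanishes but
      \<open>t (Suc m) j\<close> does not; and the range beyond, where everything vanishes, at m =
      2i through the factor m - 2i of \<open>H\<close>.\<close>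
    consider d where "m = 2 * j + d" | "Suc m = 2 * j" | "2 * j > Suc m"
      by (metis le_Suc_ex not_less_eq_eq le_antisym linorder_not_le)
    then show ?thesis
    proof cases
      case 1
      define E where "E = fact m / (fact d * fact i) * (-1/4) ^ i * pochhammer (s - x) i
        * pochhammer x (m - j) / pochhammer (s + 1/2) i"
      define T where "T = E * (s - x + of_nat i) / (of_nat j * (s + 1/2 + of_nat i))"
      have j0: "of_nat j \<noteq> (0::'a)" using Suc by (simp del: of_nat_Suc)
      have d1: "of_nat d + 1 \<noteq> (0::'a)" "of_nat d + 2 \<noteq> (0::'a)"
        by (metis of_nat_Suc of_nat_neq_0 add.commute)
           (metis of_nat_add of_nat_numeral of_nat_eq_0_iff add_is_0 zero_neq_numeral)
      have 1: "t m j = -(1/4) * T"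
      proof -
        have *: "A / (D * (u * v)) * (w * e) * (p * q) * P / (r * y) = e * (A / (D * v) * w * p * P / r * q / (u * y))"
          for A D u v w e p q P r y :: 'a
          by (simp add: divide_inverse mult_ac)
        have "t m j = (-1/4) * T"
          unfolding tf[OF 1] T_def E_def unfolding Suc pochhammer_Suc fact_Suc power_Suc2 by (rule *)
        then show ?thesis by simp
      qed
      have Sm: "Suc m = 2 * j + Suc d" "Suc m - j = Suc (m - j)" using \<open>m = 2 * j + d\<close> by simp_all
      have 2: "t (Suc m) j = t m j * (of_nat (Suc m) * (x + of_nat (m - j))) / of_nat (Suc d)"
      proof -
        have *: "(u * A) / ((v * D) * F) * w * p * (P * y) / q = (A / (D * F) * w * p * P / q) * (u * y) / v"
          for A D F u v w p q P y :: 'a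
          by (simp add: divide_inverse mult_ac)
        show ?thesis
          unfolding tf[OF Sm(1)] tf[OF \<open>m = 2 * j + d\<close>] Sm(2) fact_Suc pochhammer_Suc by (rule *)
      qed
      have m: "m = 2 * i + Suc (Suc d)" "m - i = Suc (m - j)" using \<open>m = 2 * j + d\<close> Suc by simp_all
      have 3: "t m i = E * (x + of_nat (m - j)) / ((of_nat d + 1) * (of_nat d + 2))"
        unfolding tf[OF m(1)] E_def m(2) by (simp add: pochhammer_Suc algebra_simps)
      have 4: "E * (s - x + of_nat i) = T * (of_nat j * (s + 1/2 + of_nat i))"
        using j0 nz1 by (simp add: T_def)
      have G: "G (Suc j) = (of_nat m - 2 * of_nat j) * (s - x + of_nat j) * t m j"
        "G j = (of_nat d + 2) * (s - x + of_nat i) * t m i"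
        unfolding G_def H_def using \<open>m = 2 * j + d\<close> Suc by (simp_all add: algebra_simps)
      have GJ: "G j = T * (of_nat j * (s + 1/2 + of_nat i)) * (x + of_nat (m - j)) / (of_nat d + 1)"
      proof -
        have *: "D2 * u * (F * X / (D1 * D2)) = F * u * X / D1" if "D2 \<noteq> 0" for D1 D2 u F X :: 'a
          using that by (simp add: divide_inverse mult_ac)
        show ?thesis unfolding G 3 4 [symmetric] by (rule *[OF d1(2)])
      qed
      have mm: "x + of_nat (m - j) = x + (of_nat j + of_nat d)" "(of_nat m :: 'a) = 2 * of_nat j + of_nat d"
          "(of_nat i :: 'a) = of_nat j - 1"
        using \<open>m = 2 * j + d\<close> Suc by simp_all
      \<comment> \<open>All terms of the recurrence are rational multiples of \<open>T\<close>; what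
        remains has D + 1 as its only parameter-dependent denominator.\<close>
      have poly: "(2 * s + M) * (- (1/4) * T * ((M + 1) * X) / (D + 1)) = (2 * x + M) * (s + M) * (- (1/4) * T)
          + ((M - 2 * J) * (s - x + J) * (- (1/4) * T) - T * (J * (s + 1/2 + I)) * X / (D + 1))"
        if "X = x + (J + D)" "M = 2 * J + D" "I = J - 1" "D + 1 \<noteq> 0" for X M J I D
      proof -
        have "(2 * s + M) * (- T * ((M + 1) * X)) = (2 * x + M) * (s + M) * (- T) * (D + 1)
          + ((M - 2 * J) * (s - x + J) * (- T) * (D + 1) - T * (J * (4 * s + 2 + 4 * I)) * X)"
          unfolding that(1-3) by (simp add: algebra_simps)
        moreover have "a * (- (1/4) * T * b / e) = c * (- (1/4) * T) + (g * (- (1/4) * T) - T * (q / 4) * X / e)"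
          if "a * (- T * b) = c * (- T) * e + (g * (- T) * e - T * q * X)" "e \<noteq> 0" for a b c e g q
          using arg_cong[OF that(1), of "\<lambda>u. 4 * u"] that(2) by (simp add: field_simps)
        moreover have "J * (s + 1/2 + I) = J * (4 * s + 2 + 4 * I) / 4" by (simp add: field_simps)
        ultimately show ?thesis using that(4) by presburger
      qed
      show ?thesis using poly[OF mm d1(1)] unfolding G(1) 2 GJ unfolding 1 of_nat_Suc
        by (simp only: add.commute[of 1])
    next
      case 2
      have m: "Suc m = 2 * j + 0" "m = 2 * i + 1" "Suc m - j = Suc i" "m - i = Suc i"
        using 2 Suc by simp_all
      define E where "E = fact m / fact i * (-1/4) ^ i * pochhammer (s - x) i
        * pochhammer x (Suc i) / pochhammer (s + 1/2) i"
      have J: "of_nat (Suc m) = 2 * (of_nat (Suc i) :: 'a)" "of_nat (Suc i) \<noteq> (0 :: 'a)"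
        using m(2) by (simp_all del: of_nat_Suc) simp
      have "t (Suc m) j = E * (-1/4) * 2 * (s - x + of_nat i) / (s + 1/2 + of_nat i)"
      proof -
        have *: "(2 * u * A) / (1 * (u * v)) * (w * e) * (p * q) * P / (r * y) = A / v * w * p * P / r * e * 2 * q / y"
          if "u \<noteq> 0" for A u v w e p q P r y :: 'a
          using that by (simp add: divide_inverse mult_ac)
        show ?thesis unfolding tf[OF m(1)] m(3) E_def fact_0
          unfolding Suc pochhammer_Suc[of _ i] fact_Suc power_Suc2 J(1) mult.assoc[symmetric, of 2]
          by (rule *[OF J(2)])
      qed
      moreover have "G j = (s - x + of_nat i) * E"
        unfolding G_def H_def Suc nat.case tf[OF m(2)] E_def m(4) using m(2) by (simp add: algebra_simps)
      moreover have "2 * s + of_nat m = 2 * (s + 1/2 + of_nat i)" using m(2) by (simp add: algebra_simps)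
      moreover have "E * (-1/4) * 2 * u / v * (2 * v) = - (u * E)" if "v \<noteq> 0" for u v
        using that by simp
      ultimately have "t (Suc m) j * (2 * s + of_nat m) = - G j"
        using nz1[of i] by presburger
      moreover have "t m j = 0" "G (Suc j) = 0"
        using 2 by (simp_all add: t0 G_def H_def)
      ultimately show ?thesis by (simp add: mult.commute)
    next
      case 3
      then have "t m j = 0" "t (Suc m) j = 0" "t m i = 0 \<or> m = 2 * i" using t0[of m j] t0[of "Suc m" j] t0[of m i] Suc by auto
      then show ?thesis using Suc by (auto simp: G_def H_def)
    qed
  qed
  have "(2 * s + of_nat m) * (\<Sum>j\<le>Suc m. t (Suc m) j)
     = (2 * x + of_nat m) * (s + of_nat m) * (\<Sum>j\<le>Suc m. t m j) + (\<Sum>j\<le>Suc m. G (Suc j) - G j)"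
    unfolding sum_distrib_left sum.distrib [symmetric] using step by (intro sum.cong) auto
  also have "(\<Sum>j\<le>Suc m. G (Suc j) - G j) = G (Suc (Suc m)) - G 0"
    unfolding lessThan_Suc_atMost [symmetric] by (rule sum_lessThan_telescope)
  also have "\<dots> = 0" using t0[of m "Suc m"] by (simp add: G_def H_def)
  also have "(\<Sum>j\<le>Suc m. t m j) = pochhammer (2 * x) m * pochhammer s m / pochhammer (2 * s) m"
    using Suc t0[of m "Suc m"] by (simp add: t_def)
  finally have "(2 * s + of_nat m) * (\<Sum>j\<le>Suc m. t (Suc m) j) =
     (2 * x + of_nat m) * (s + of_nat m) * (pochhammer (2 * x) m * pochhammer s m / pochhammer (2 * s) m)" by simp
  then have "(\<Sum>j\<le>Suc m. t (Suc m) j) = pochhammer (2 * x) (Suc m) * pochhammer s (Suc m) / pochhammer (2 * s) (Suc m)"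
    using nz[of m] assms[of m] by (simp add: pochhammer_Suc divide_simps) (simp add: algebra_simps)
  then show ?case unfolding t_def by (rule sym)
qed simp

text \<open>Duplication of (-2n)_{2j}, the numerator of C(2n,2j). It converts the coefficients of
  the left expansion into the factor (1/2-n)_j that Dixon's sum produces on the right.\<close>

lemma binomial_double_pochhammer:
  "fact (2 * j) / fact j * of_nat ((2 * n) choose (2 * j)) * (-1) ^ j =
     4 ^ j * of_nat (n choose j) * pochhammer (1/2 - of_nat n :: 'a::field_char_0) j"
proof -
  have "(of_nat ((2 * n) choose (2 * j)) :: 'a) = pochhammer (2 * - of_nat n) (2 * j) / fact (2 * j)"
    by (simp add: binomial_gbinomial gbinomial_pochhammer)
  also have "\<dots> = 4 ^ j * pochhammer (- of_nat n) j * pochhammer (1/2 - of_nat n) j / fact (2 * j)"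
    unfolding pochhammer_double by (simp add: power_mult)
  finally have 1: "of_nat ((2 * n) choose (2 * j)) = (4 ^ j * pochhammer (- of_nat n) j * pochhammer (1/2 - of_nat n) j / fact (2 * j) :: 'a)" .
  have 2: "(of_nat (n choose j) :: 'a) = (-1) ^ j * pochhammer (- of_nat n) j / fact j"
    by (simp add: binomial_gbinomial gbinomial_pochhammer)
  show ?thesis unfolding 1 2 by simp
qed

text \<open>After the quadratic transformation, C(2n,m) C(m,2j) = C(2n,2j) C(2n-2j, m-2j) makes the
  sum over m, for fixed j, a Chu-Vandermonde sum.\<close>

lemma well_poised_expansion_left:
  fixes x s :: "'a::field_char_0"
  assumes nz: "\<And>n. pochhammer (2 * s) n \<noteq> 0"
  shows "(\<Sum>m\<le>2*n. (-1) ^ m * of_nat ((2 * n) choose m) * (pochhammer (2 * x) m * pochhammer s m / pochhammer (2 * s) m)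
            * pochhammer (s + x - of_nat n + of_nat m) (2 * n - m))
     = (\<Sum>j\<le>n. fact (2 * j) / fact j * of_nat ((2 * n) choose (2 * j)) * (-1/4) ^ j * pochhammer (s - x) j * pochhammer x j
          / pochhammer (s + 1/2) j * pochhammer (s - of_nat n + of_nat j) (2 * (n - j)))"
proof -
  define Q where "Q = (\<lambda>j. fact (2 * j) / fact j * (-1/4) ^ j * pochhammer (s - x) j / pochhammer (s + 1/2) j)"
  define P where "P = (\<lambda>m. pochhammer (s + x - of_nat n + of_nat m) (2 * n - m))"
  have "(\<Sum>m\<le>2*n. (-1) ^ m * of_nat ((2 * n) choose m) * (pochhammer (2 * x) m * pochhammer s m / pochhammer (2 * s) m) * P m)
     = (\<Sum>m\<le>2*n. \<Sum>j\<le>n. Q j * ((-1) ^ m * of_nat ((2 * n) choose m) * of_nat (m choose (2 * j)) * pochhammer x (m - j) * P m))"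
  proof (intro sum.cong refl)
    fix m assume m: "m \<in> {..2*n}"
    have "pochhammer (2 * x) m * pochhammer s m / pochhammer (2 * s) m =
        (\<Sum>j\<le>m. Q j * (of_nat (m choose (2 * j)) * pochhammer x (m - j)))"
      unfolding quadratic_expansion[OF nz] Q_def by (simp add: mult_ac)
    also have "\<dots> = (\<Sum>j\<in>{..m} \<inter> {..n}. Q j * (of_nat (m choose (2 * j)) * pochhammer x (m - j)))"
      using m by (intro sum.mono_neutral_right) (auto simp: binomial_eq_0)
    also have "\<dots> = (\<Sum>j\<le>n. Q j * (of_nat (m choose (2 * j)) * pochhammer x (m - j)))"
      using m by (intro sum.mono_neutral_left) (auto simp: binomial_eq_0)
    finally show "(-1) ^ m * of_nat ((2 * n) choose m) * (pochhammer (2 * x) m * pochhammer s m / pochhammer (2 * s) m) * P m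
      = (\<Sum>j\<le>n. Q j * ((-1) ^ m * of_nat ((2 * n) choose m) * of_nat (m choose (2 * j)) * pochhammer x (m - j) * P m))"
      by (simp add: sum_distrib_left sum_distrib_right mult_ac)
  qed
  also have "\<dots> = (\<Sum>j\<le>n. Q j * (\<Sum>m\<le>2*n. (-1) ^ m * of_nat ((2 * n) choose m) * of_nat (m choose (2 * j)) * pochhammer x (m - j) * P m))"
    unfolding sum_distrib_left by (rule sum.swap)
  also have "\<dots> = (\<Sum>j\<le>n. Q j * (of_nat ((2 * n) choose (2 * j)) * pochhammer x j * pochhammer (s - of_nat n + of_nat j) (2 * (n - j))))"
  proof (intro sum.cong refl arg_cong2[where f = "(*)"])
    fix j assume "j \<in> {..n}"
    then have j: "j \<le> n" by simp
    have "(\<Sum>m\<le>2*n. (-1) ^ m * of_nat ((2 * n) choose m) * of_nat (m choose (2 * j)) * pochhammer x (m - j) * P m)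
       = (\<Sum>m\<in>{2*j..2*n}. (-1) ^ m * of_nat ((2 * n) choose m) * of_nat (m choose (2 * j)) * pochhammer x (m - j) * P m)"
      by (intro sum.mono_neutral_right) (auto simp: binomial_eq_0)
    also have "\<dots> = (\<Sum>i\<le>2*(n-j). (-1) ^ (2*j+i) * of_nat ((2 * n) choose (2*j+i)) * of_nat ((2*j+i) choose (2 * j)) * pochhammer x (2*j+i - j) * P (2*j+i))"
      using j by (intro sum.reindex_bij_witness[of _ "\<lambda>i. 2*j+i" "\<lambda>m. m - 2*j"]) auto
    also have "\<dots> = of_nat ((2 * n) choose (2 * j)) * pochhammer x j *
       (\<Sum>i\<le>2*(n-j). of_nat (2*(n-j) choose i) * (-1) ^ i * pochhammer (x + of_nat j) i
          * pochhammer (s + x - of_nat n + of_nat (2 * j) + of_nat i) (2*(n-j) - i))"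
      unfolding sum_distrib_left
    proof (intro sum.cong refl)
      fix i assume i: "i \<in> {..2*(n-j)}"
      have 1: "(of_nat ((2 * n) choose (2*j+i)) * of_nat ((2*j+i) choose (2 * j)) :: 'a)
          = of_nat ((2 * n) choose (2 * j)) * of_nat (2*(n-j) choose i)"
        using choose_mult[of "2*j" "2*j+i" "2*n"] i j by (metis (no_types, lifting) add_diff_cancel_left' atMost_iff diff_mult_distrib2 le_add1
            le_diff_conv2 mult_le_mono2 of_nat_mult add.commute)
      have 2: "pochhammer x (2*j+i - j) = pochhammer x j * pochhammer (x + of_nat j) i"
        by (subst pochhammer_append) (auto simp: mult_2)
      have 3: "P (2*j+i) = pochhammer (s + x - of_nat n + of_nat (2 * j) + of_nat i) (2*(n-j) - i)"
        unfolding P_def by (simp add: algebra_simps diff_mult_distrib2)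
      have "(-1) ^ (2*j+i) * of_nat ((2 * n) choose (2*j+i)) * of_nat ((2*j+i) choose (2 * j)) * pochhammer x (2*j+i - j) * P (2*j+i)
        = (-1) ^ i * (of_nat ((2 * n) choose (2*j+i)) * of_nat ((2*j+i) choose (2 * j))) * pochhammer x (2*j+i - j) * P (2*j+i)"
        by (simp add: power_add mult_ac)
      then show "(-1) ^ (2*j+i) * of_nat ((2 * n) choose (2*j+i)) * of_nat ((2*j+i) choose (2 * j)) * pochhammer x (2*j+i - j) * P (2*j+i)
         = of_nat ((2 * n) choose (2 * j)) * pochhammer x j * (of_nat (2*(n-j) choose i) * (-1) ^ i * pochhammer (x + of_nat j) i
          * pochhammer (s + x - of_nat n + of_nat (2 * j) + of_nat i) (2*(n-j) - i))"
        unfolding 1 2 3 by (simp only: mult_ac)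
    qed
    also have "\<dots> = of_nat ((2 * n) choose (2 * j)) * pochhammer x j * pochhammer (s - of_nat n + of_nat j) (2 * (n - j))"
      unfolding pochhammer_diff_expansion by (simp add: algebra_simps)
    finally show "(\<Sum>m\<le>2*n. (-1) ^ m * of_nat ((2 * n) choose m) * of_nat (m choose (2 * j)) * pochhammer x (m - j) * P m) = \<dots>" .
  qed
  finally show ?thesis unfolding P_def Q_def by (simp add: mult_ac)
qed

text \<open>Saalschuetz's sum with shift \<open>s\<close> rewrites each product in terms of (x)_l
  (x')_l; by x + x' = s its coefficients no longer contain x. For fixed l the sum over k is Dixon's
  with a = 2s-1 and b = s+n.\<close>

lemma well_poised_expansion_right:
  fixes x x' s :: "'a::field_char_0"
  assumes xx: "x + x' = s"
  shows "(\<Sum>k\<le>n. pochhammer (2 * s - 1) k * ((-1) ^ k * of_nat (n choose k)) * pochhammer (s + of_nat n) k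
        * pochhammer x k * pochhammer x' k
        * pochhammer (s - of_nat n + of_nat k) (n - k) * pochhammer (2 * s + of_nat (n + k)) (n - k)
        * (pochhammer (s + x + of_nat k) (n - k) * pochhammer (s + x' + of_nat k) (n - k)))
     = (\<Sum>j\<le>n. of_nat (n choose j) * pochhammer s (n - j) * pochhammer (2 * s + of_nat (2 * j)) (2 * (n - j))
          * pochhammer (s - of_nat n + of_nat j) (n - j) * (4 ^ j * pochhammer s j * pochhammer (1/2 - of_nat n) j)
          * (pochhammer x j * pochhammer x' j))"
    (is "?L = _")
proof -
  define g where "g = (\<lambda>k l. pochhammer (2 * s - 1) k * ((-1) ^ k * of_nat (n choose k)) * pochhammer (s + of_nat n) k
        * pochhammer (s - of_nat n + of_nat k) (n - k) * pochhammer (2 * s + of_nat (n + k)) (n - k)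
        * (of_nat ((n - k) choose (l - k)) * pochhammer (2 * s + of_nat (k + l)) (n - l) * pochhammer s (n - l))
        * (pochhammer x l * pochhammer x' l))"
  have "?L = (\<Sum>k\<le>n. \<Sum>i\<le>n - k. g k (k + i))"
  proof (intro sum.cong refl)
    fix k assume k: "k \<in> {..n}"
    have "pochhammer x k * pochhammer x' k * (pochhammer (s + x + of_nat k) (n - k) * pochhammer (s + x' + of_nat k) (n - k))
      = pochhammer x k * pochhammer x' k * (pochhammer (x + of_nat k + s) (n - k) * pochhammer (x' + of_nat k + s) (n - k))"
      by (simp add: algebra_simps)
    also have "\<dots> = (\<Sum>i\<le>n-k. of_nat ((n - k) choose i) * pochhammer (2 * s + of_nat (k + (k + i))) (n - (k + i)) * pochhammer s (n - (k + i))
       * (pochhammer x (k + i) * pochhammer x' (k + i)))"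
      unfolding pochhammer_shift_product[of "x + of_nat k" s "n - k" "x' + of_nat k"] sum_distrib_left
    proof (intro sum.cong refl)
      fix i
      have 1: "pochhammer x (k + i) = pochhammer x k * pochhammer (x + of_nat k) i"
        "pochhammer x' (k + i) = pochhammer x' k * pochhammer (x' + of_nat k) i"
        by (simp_all add: pochhammer_product')
      have 2: "s + (x + of_nat k) + (x' + of_nat k) + of_nat i = 2 * s + of_nat (k + (k + i))" "n - k - i = n - (k + i)"
        by (simp_all add: xx [symmetric])
      show "pochhammer x k * pochhammer x' k * (of_nat ((n - k) choose i) * pochhammer (s + (x + of_nat k) + (x' + of_nat k) + of_nat i) (n - k - i)
          * pochhammer s (n - k - i) * (pochhammer (x + of_nat k) i * pochhammer (x' + of_nat k) i))
        = of_nat ((n - k) choose i) * pochhammer (2 * s + of_nat (k + (k + i))) (n - (k + i)) * pochhammer s (n - (k + i))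
       * (pochhammer x (k + i) * pochhammer x' (k + i))"
        unfolding 1 2 by (simp only: mult_ac)
    qed
    finally have *: "pochhammer x k * pochhammer x' k * (pochhammer (s + x + of_nat k) (n - k) * pochhammer (s + x' + of_nat k) (n - k)) = \<dots>" .
    have "pochhammer (2 * s - 1) k * ((-1) ^ k * of_nat (n choose k)) * pochhammer (s + of_nat n) k
        * pochhammer x k * pochhammer x' k
        * pochhammer (s - of_nat n + of_nat k) (n - k) * pochhammer (2 * s + of_nat (n + k)) (n - k)
        * (pochhammer (s + x + of_nat k) (n - k) * pochhammer (s + x' + of_nat k) (n - k))
      = pochhammer (2 * s - 1) k * ((-1) ^ k * of_nat (n choose k)) * pochhammer (s + of_nat n) k
        * pochhammer (s - of_nat n + of_nat k) (n - k) * pochhammer (2 * s + of_nat (n + k)) (n - k)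
        * (pochhammer x k * pochhammer x' k * (pochhammer (s + x + of_nat k) (n - k) * pochhammer (s + x' + of_nat k) (n - k)))"
      by (simp only: mult_ac)
    also have "\<dots> = (\<Sum>i\<le>n - k. g k (k + i))"
      unfolding * sum_distrib_left g_def by (intro sum.cong refl) (simp only: mult_ac diff_add_inverse)
    finally show "pochhammer (2 * s - 1) k * ((-1) ^ k * of_nat (n choose k)) * pochhammer (s + of_nat n) k
        * pochhammer x k * pochhammer x' k
        * pochhammer (s - of_nat n + of_nat k) (n - k) * pochhammer (2 * s + of_nat (n + k)) (n - k)
        * (pochhammer (s + x + of_nat k) (n - k) * pochhammer (s + x' + of_nat k) (n - k)) = \<dots>" .
  qed
  also have "\<dots> = (\<Sum>l\<le>n. \<Sum>k\<le>l. g k l)" by (rule sum_triangle_reindex)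
  also have "\<dots> = (\<Sum>j\<le>n. of_nat (n choose j) * pochhammer s (n - j) * pochhammer (2 * s + of_nat (2 * j)) (2 * (n - j))
          * pochhammer (s - of_nat n + of_nat j) (n - j) * (4 ^ j * pochhammer s j * pochhammer (1/2 - of_nat n) j)
          * (pochhammer x j * pochhammer x' j))"
  proof (intro sum.cong refl)
    fix l assume "l \<in> {..n}"
    then have l: "l \<le> n" by simp
    define a where "a = 2 * s - 1"
    define b where "b = s + of_nat n"
    have ab: "1 + a - b = s - of_nat n" "1 + a = 2 * s" "(1 + a) / 2 = s" "1 + a / 2 - b = 1 / 2 - of_nat n"
      by (simp_all add: a_def b_def field_simps)
    have "(\<Sum>k\<le>l. g k l) = (\<Sum>k\<le>l. of_nat (n choose l) * pochhammer s (n - l) * pochhammer (2 * s + of_nat (2 * l)) (2 * (n - l))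
          * pochhammer (s - of_nat n + of_nat l) (n - l) * (pochhammer x l * pochhammer x' l) *
         ((-1) ^ k * of_nat (l choose k) * pochhammer a k * pochhammer b k
        * pochhammer (1 + a - b + of_nat k) (l - k) * pochhammer (1 + a + of_nat (l + k)) (l - k)))"
    proof (intro sum.cong refl)
      fix k assume "k \<in> {..l}"
      then have k: "k \<le> l" by simp
      have 1: "(of_nat (n choose k) * of_nat ((n - k) choose (l - k)) :: 'a) = of_nat (n choose l) * of_nat (l choose k)"
        using choose_mult[OF k l] by (metis of_nat_mult)
      have 2: "pochhammer (s - of_nat n + of_nat k) (n - k) = pochhammer (s - of_nat n + of_nat k) (l - k) * pochhammer (s - of_nat n + of_nat l) (n - l)"
        using k l by (subst pochhammer_append) (auto simp: of_nat_diff)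
      have "pochhammer (2 * s + of_nat (k + l)) (n - l) * pochhammer (2 * s + of_nat (n + k)) (n - k)
         = pochhammer (2 * s + of_nat (k + l)) (n - l + (n - k))"
        using l by (intro pochhammer_append) (simp add: of_nat_diff)
      also have "n - l + (n - k) = l - k + 2 * (n - l)" using k l by simp
      also have "pochhammer (2 * s + of_nat (k + l)) (l - k + 2 * (n - l)) =
          pochhammer (2 * s + of_nat (l + k)) (l - k) * pochhammer (2 * s + of_nat (2 * l)) (2 * (n - l))"
        using k by (subst pochhammer_append) (auto simp add: of_nat_diff add.commute)
      finally have 3: "pochhammer (2 * s + of_nat (k + l)) (n - l) * pochhammer (2 * s + of_nat (n + k)) (n - k) = \<dots>" .
      have "g k l = pochhammer (2 * s - 1) k * (-1) ^ k * (of_nat (n choose k) * of_nat ((n - k) choose (l - k))) * pochhammer (s + of_nat n) k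
        * pochhammer (s - of_nat n + of_nat k) (n - k) * (pochhammer (2 * s + of_nat (k + l)) (n - l) * pochhammer (2 * s + of_nat (n + k)) (n - k))
        * pochhammer s (n - l) * (pochhammer x l * pochhammer x' l)"
        unfolding g_def by (simp only: mult_ac)
      then show "g k l = of_nat (n choose l) * pochhammer s (n - l) * pochhammer (2 * s + of_nat (2 * l)) (2 * (n - l))
          * pochhammer (s - of_nat n + of_nat l) (n - l) * (pochhammer x l * pochhammer x' l) *
         ((-1) ^ k * of_nat (l choose k) * pochhammer a k * pochhammer b k
        * pochhammer (1 + a - b + of_nat k) (l - k) * pochhammer (1 + a + of_nat (l + k)) (l - k))"
        unfolding 1 2 3 ab(1) unfolding ab(2) unfolding a_def b_def by (simp only: mult_ac)
    qed
    also have "\<dots> = of_nat (n choose l) * pochhammer s (n - l) * pochhammer (2 * s + of_nat (2 * l)) (2 * (n - l))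
          * pochhammer (s - of_nat n + of_nat l) (n - l) * (pochhammer x l * pochhammer x' l) *
          (4 ^ l * pochhammer s l * pochhammer (1/2 - of_nat n) l)"
      unfolding sum_distrib_left [symmetric] dixon_terminating ab(3,4) ..
    finally show "(\<Sum>k\<le>l. g k l) = of_nat (n choose l) * pochhammer s (n - l) * pochhammer (2 * s + of_nat (2 * l)) (2 * (n - l))
          * pochhammer (s - of_nat n + of_nat l) (n - l) * (4 ^ l * pochhammer s l * pochhammer (1/2 - of_nat n) l)
          * (pochhammer x l * pochhammer x' l)"
      by (simp only: mult_ac)
  qed
  finally show ?thesis .
qed

text \<open>The two expansions share the basis (x)_j (x')_j and agree coefficient by coefficient.
  With x = s-r and x' = r the left side is what Gauss's theorem makes of the three-parameter series
  at p = -n, the right side the well-poised series there, up to Gamma factors.\<close>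

lemma well_poised_terminating:
  fixes x x' s :: "'a::field_char_0"
  assumes xx: "x + x' = s" and nz: "\<And>n. pochhammer (2 * s) n \<noteq> 0"
  shows "pochhammer (2 * s) (2 * n) * (\<Sum>m\<le>2*n. (-1) ^ m * of_nat ((2 * n) choose m) * (pochhammer (2 * x) m * pochhammer s m / pochhammer (2 * s) m)
            * pochhammer (s + x - of_nat n + of_nat m) (2 * n - m))
    = (\<Sum>k\<le>n. pochhammer (2 * s - 1) k * ((-1) ^ k * of_nat (n choose k)) * pochhammer (s + of_nat n) k
        * pochhammer x k * pochhammer x' k
        * pochhammer (s - of_nat n + of_nat k) (n - k) * pochhammer (2 * s + of_nat (n + k)) (n - k)
        * (pochhammer (s + x + of_nat k) (n - k) * pochhammer (s + x' + of_nat k) (n - k)))"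
  unfolding well_poised_expansion_left[OF nz] well_poised_expansion_right[OF xx] sum_distrib_left
proof (intro sum.cong refl)
  fix j assume "j \<in> {..n}"
  then have j: "j \<le> n" by simp
  have x': "s - x = x'" using xx by auto
  have 1: "pochhammer (2 * s) (2 * n) = 4 ^ j * pochhammer s j * pochhammer (s + 1/2) j * pochhammer (2 * s + of_nat (2 * j)) (2 * (n - j))"
  proof -
    have "pochhammer (2 * s) (2 * n) = pochhammer (2 * s) (2 * j) * pochhammer (2 * s + of_nat (2 * j)) (2 * (n - j))"
      using j by (subst pochhammer_append) (auto simp: algebra_simps)
    then show ?thesis by (simp add: pochhammer_double power_mult)
  qed
  have nz': "pochhammer (s + 1/2) j \<noteq> 0" using nz[of "2 * j"] by (auto simp: pochhammer_double)
  have 2: "pochhammer (s - of_nat n + of_nat j) (2 * (n - j)) = pochhammer (s - of_nat n + of_nat j) (n - j) * pochhammer s (n - j)"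
    using j by (subst pochhammer_append) (auto simp: of_nat_diff mult_2)
  have 3: "(-1/4 :: 'a) ^ j * 4 ^ j = (-1) ^ j" by (simp flip: power_mult_distrib)
  have *: "4 ^ j * S * R * W * (F * C * Q * X' * X / R * (Y * Z)) = S * W * (F * C * (Q * 4 ^ j)) * X' * X * Y * Z"
    if "R \<noteq> 0" for S R W F C Q X' X Y Z :: 'a
    using that by (simp add: divide_inverse mult_ac)
  show "pochhammer (2 * s) (2 * n) * (fact (2 * j) / fact j * of_nat ((2 * n) choose (2 * j)) * (-1/4) ^ j * pochhammer (s - x) j * pochhammer x j
          / pochhammer (s + 1/2) j * pochhammer (s - of_nat n + of_nat j) (2 * (n - j)))
     = of_nat (n choose j) * pochhammer s (n - j) * pochhammer (2 * s + of_nat (2 * j)) (2 * (n - j))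
          * pochhammer (s - of_nat n + of_nat j) (n - j) * (4 ^ j * pochhammer s j * pochhammer (1/2 - of_nat n) j)
          * (pochhammer x j * pochhammer x' j)"
    unfolding 1 2 x' *[OF nz'] 3 binomial_double_pochhammer by (simp only: mult_ac)
qed

section \<open>Regularised hypergeometric series\<close>

text \<open>\<open>rGamma (b + of_nat k)\<close> is 1/(Gamma(b) (b)_k) and stays finite at the poles
  of Gamma, so each term is entire in all parameters and continuation meets no exceptional set. The
  class \<open>Gamma\<close> covers real and complex parameters at once.\<close>

definition reg_term :: "'a::Gamma list \<Rightarrow> 'a list \<Rightarrow> nat \<Rightarrow> 'a" where
  "reg_term as bs k = prod_list (map (\<lambda>a. pochhammer a k) as)
     * prod_list (map (\<lambda>b. rGamma (b + of_nat k)) bs) / fact k"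

definition reg_hyp :: "'a::Gamma list \<Rightarrow> 'a list \<Rightarrow> 'a" where
  "reg_hyp as bs = (\<Sum>k. reg_term as bs k)"

lemma sum_inverse_squares_le: "(\<Sum>j=1..k. 1 / real j ^ 2) \<le> 2"
proof -
  have "(\<Sum>j=1..k. 1 / real j ^ 2) \<le> 2 - 1 / real k"
  proof (induction k)
    case (Suc k)
    have "1 / real (Suc k) ^ 2 \<le> 1 / real k - 1 / real (Suc k)" if "k > 0"
    proof -
      have "1 / real k - 1 / real (Suc k) = 1 / (real k * real (Suc k))" using that by (simp add: field_simps)
      moreover have "1 / real (Suc k) ^ 2 \<le> 1 / (real k * real (Suc k))"
        using that by (intro divide_left_mono) (auto simp: power2_eq_square)
      ultimately show ?thesis by simp
    qed
    then show ?case using Suc by (cases "k = 0") (simp, simp del: of_nat_Suc)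
  qed simp
  also have "\<dots> \<le> 2" by simp
  finally show ?thesis .
qed

text \<open>Each factor satisfies |a+j|^2 <= j^2 (1 + 2 Re a/j + M^2/j^2), and 1+y <= exp y. Keeping
  \<open>exp (Re a * harm k)\<close> instead of a power of k makes such bounds multiplicative
  whatever the sign of Re a; the harmonic number is compared with a logarithm only when the total
  exponent is known not to be positive.\<close>

lemma norm_pochhammer_le:
  fixes a :: complex
  assumes "norm a \<le> M"
  shows "norm (pochhammer a (Suc k)) \<le> (M + 1) * exp (M ^ 2) * fact k * exp (Re a * harm k)"
proof -
  have M: "M \<ge> 0" using assms norm_ge_zero order_trans by blast
  have "norm (pochhammer a (Suc k)) \<le> (M + 1) * fact k * exp (Re a * harm k + M ^ 2 / 2 * (\<Sum>j=1..k. 1 / real j ^ 2))"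
  proof (induction k)
    case (Suc k)
    let ?j = "real (Suc k)"
    have "(norm (a + of_nat (Suc k))) ^ 2 = (Re a + ?j) ^ 2 + Im a ^ 2"
      by (simp add: cmod_power2)
    also have "\<dots> = ?j ^ 2 + 2 * Re a * ?j + norm a ^ 2"
      unfolding cmod_power2 by (simp add: power2_eq_square algebra_simps)
    also have "\<dots> \<le> ?j ^ 2 + 2 * Re a * ?j + M ^ 2"
      using assms by (simp add: power_mono)
    also have "\<dots> = ?j ^ 2 * (1 + (2 * Re a / ?j + M ^ 2 / ?j ^ 2))"
    proof -
      have "j ^ 2 + 2 * r * j + m = j ^ 2 * (1 + (2 * r / j + m / j ^ 2))" if "j \<noteq> 0" for j r m :: real
        using that by (simp add: field_simps power2_eq_square)
      then show ?thesis by simp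
    qed
    also have "\<dots> \<le> ?j ^ 2 * exp (2 * Re a / ?j + M ^ 2 / ?j ^ 2)"
      by (intro mult_left_mono exp_ge_add_one_self) auto
    also have "\<dots> = (?j * exp (Re a / ?j + M ^ 2 / 2 * (1 / ?j ^ 2))) ^ 2"
    proof -
      have "2 * Re a / ?j + M ^ 2 / ?j ^ 2 = 2 * (Re a / ?j + M ^ 2 / 2 * (1 / ?j ^ 2))" by simp
      then show ?thesis by (simp only: power_mult_distrib exp_double)
    qed
    finally have *: "norm (a + of_nat (Suc k)) \<le> ?j * exp (Re a / ?j + M ^ 2 / 2 * (1 / ?j ^ 2))"
      by (rule power2_le_imp_le) auto
    have "norm (pochhammer a (Suc (Suc k))) = norm (pochhammer a (Suc k)) * norm (a + of_nat (Suc k))"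
      by (subst pochhammer_Suc) (rule norm_mult)
    also have "\<dots> \<le> ((M + 1) * fact k * exp (Re a * harm k + M ^ 2 / 2 * (\<Sum>j=1..k. 1 / real j ^ 2)))
        * (?j * exp (Re a / ?j + M ^ 2 / 2 * (1 / ?j ^ 2)))"
      using Suc * M by (intro mult_mono) auto
    also have "\<dots> = (M + 1) * fact (Suc k) * (exp (Re a * harm k + M ^ 2 / 2 * (\<Sum>j=1..k. 1 / real j ^ 2)) * exp (Re a / ?j + M ^ 2 / 2 * (1 / ?j ^ 2)))"
      by (simp add: mult_ac)
    also have "exp (Re a * harm k + M ^ 2 / 2 * (\<Sum>j=1..k. 1 / real j ^ 2)) * exp (Re a / ?j + M ^ 2 / 2 * (1 / ?j ^ 2))
       = exp (Re a * harm (Suc k) + M ^ 2 / 2 * (\<Sum>j=1..Suc k. 1 / real j ^ 2))"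
      unfolding exp_add [symmetric] by (simp add: harm_Suc algebra_simps inverse_eq_divide add_divide_distrib)
    finally show ?case .
  qed (use assms in \<open>simp add: harm_def\<close>)
  also have "\<dots> \<le> (M + 1) * fact k * exp (Re a * harm k + M ^ 2)"
  proof -
    have "M ^ 2 / 2 * (\<Sum>j=1..k. 1 / real j ^ 2) \<le> M ^ 2 / 2 * 2"
      by (intro mult_left_mono sum_inverse_squares_le) auto
    then show ?thesis using M by (intro mult_left_mono) auto
  qed
  finally show ?thesis by (simp add: exp_add mult_ac)
qed

text \<open>The lower counterpart of 1+x <= exp x, needed because the recursion for 1/Gamma divides
  by b + j.\<close>

lemma exp_le_one_plus:
  fixes x :: real
  assumes "\<bar>x\<bar> \<le> 1/2"
  shows "exp (x - 2 * x ^ 2) \<le> 1 + x"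
proof -
  have "\<bar>ln (1 + x) - x\<bar> \<le> 2 * x\<^sup>2"
    by (rule abs_ln_one_plus_x_minus_x_bound[OF assms])
  then have "x - 2 * x ^ 2 \<le> ln (1 + x)" by simp
  then have "exp (x - 2 * x ^ 2) \<le> exp (ln (1 + x))" by simp
  also have "\<dots> = 1 + x" using assms by (subst exp_ln) auto
  finally show ?thesis .
qed

text \<open>Compactness bounds the values up to index N; beyond it rGamma(b+j+1) =
  rGamma(b+j)/(b+j), where |b+j| >= j exp(Re b/j - 2M^2/j^2) because |Re b|/j <= 1/2. One constant
  serves the whole ball, as the Weierstrass test for holomorphy will require.\<close>

lemma norm_rGamma_le:
  assumes M: "M \<ge> 0"
  shows "\<exists>C>0. \<forall>b::complex. norm b \<le> M \<longrightarrow> (\<forall>k. norm (rGamma (b + of_nat (Suc k))) \<le> C / fact k * exp (- Re b * harm k))"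
proof -
  obtain N :: nat where N: "real N \<ge> 4 * M" by (meson real_arch_simple)
  have "compact (cball (0::complex) (M + real N + 1))" by simp
  then have "compact (rGamma ` cball (0::complex) (M + real N + 1))"
    by (intro compact_continuous_image continuous_on_rGamma)
  then obtain A where "\<forall>y\<in>rGamma ` cball (0::complex) (M + real N + 1). norm y \<le> A"
    by (meson bounded_iff compact_imp_bounded)
  then have A: "norm (rGamma (z::complex)) \<le> A" if "norm z \<le> M + real N + 1" for z
    using that by simp
  have A0: "A \<ge> 1" using A[of 1] M by simp
  have small: "norm (rGamma (b + of_nat (Suc k))) \<le> A" if "norm b \<le> M" "k \<le> N" for b :: complex and k
  proof (rule A)
    have "norm (b + of_nat (Suc k)) \<le> norm b + real (Suc k)"
      by (metis norm_of_nat norm_triangle_ineq)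
    then show "norm (b + of_nat (Suc k)) \<le> M + real N + 1" using that by simp
  qed
  define C where "C = A * fact N * exp (M * harm N + 2 * M ^ 2 * 2)"
  have large: "norm (rGamma (b + of_nat (Suc (N + d)))) \<le>
      A * fact N * exp (M * harm N) / fact (N + d) * exp (- Re b * harm (N + d) + 2 * M ^ 2 * (\<Sum>j=1..N+d. 1 / real j ^ 2))"
    if b: "norm b \<le> M" for b d
  proof (induction d)
    case 0
    have "norm (rGamma (b + of_nat (Suc N))) \<le> A * 1" using small[OF b] by simp
    also have "\<dots> \<le> A * exp (M * harm N - Re b * harm N + 2 * M ^ 2 * (\<Sum>j=1..N. 1 / real j ^ 2))"
    proof -
      have "Re b * harm N \<le> M * harm N"
        using b abs_Re_le_cmod[of b] by (intro mult_right_mono harm_nonneg) auto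
      then show ?thesis using A0 by (intro mult_left_mono one_le_exp_iff[THEN iffD2]) (use A0 in \<open>simp_all add: sum_nonneg\<close>)
    qed
    finally show ?case by (simp add: exp_add exp_diff exp_minus field_simps)
  next
    case (Suc d)
    let ?j = "real (Suc (N + d))"
    define x where "x = Re b / ?j"
    have absb: "\<bar>Re b\<bar> \<le> M" using b abs_Re_le_cmod[of b] by simp
    have "4 * M \<le> ?j" using N by simp
    then have "\<bar>Re b\<bar> * 2 \<le> ?j" using absb M by simp
    then have x: "\<bar>x\<bar> \<le> 1/2" by (simp add: x_def field_simps)
    have "x ^ 2 \<le> M ^ 2 / ?j ^ 2"
    proof -
      have "(Re b)\<^sup>2 \<le> M ^ 2" using absb by (metis abs_ge_zero power2_abs power_mono)
      then show ?thesis by (simp add: x_def power_divide divide_right_mono)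
    qed
    then have "?j * exp (Re b / ?j - 2 * (M ^ 2 / ?j ^ 2)) \<le> ?j * exp (x - 2 * x ^ 2)"
      by (simp add: x_def)
    also have "\<dots> \<le> ?j * (1 + x)" by (intro mult_left_mono exp_le_one_plus x) auto
    also have "\<dots> = Re (b + of_nat (Suc (N + d)))" by (simp add: x_def field_simps)
    also have "\<dots> \<le> norm (b + of_nat (Suc (N + d)))" by (rule complex_Re_le_cmod)
    finally have nb: "norm (b + of_nat (Suc (N + d))) \<ge> ?j * exp (Re b / ?j - 2 * (M ^ 2 / ?j ^ 2))" .
    define E where "E = ?j * exp (Re b / ?j - 2 * (M ^ 2 / ?j ^ 2))"
    have E: "E > 0" by (simp add: E_def)
    have "norm (rGamma (b + of_nat (Suc (N + Suc d)))) * E \<le> norm (rGamma (b + of_nat (Suc (N + Suc d)))) * norm (b + of_nat (Suc (N + d)))"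
      using nb unfolding E_def by (intro mult_left_mono) auto
    also have "\<dots> = norm (rGamma (b + of_nat (Suc (N + d))))"
      using rGamma_plus1[of "b + of_nat (Suc (N + d))"] by (simp add: norm_mult [symmetric] algebra_simps)
    also have "\<dots> \<le> A * fact N * exp (M * harm N) / fact (N + d) * exp (- Re b * harm (N + d) + 2 * M ^ 2 * (\<Sum>j=1..N+d. 1 / real j ^ 2))"
      by (rule Suc)
    also have "\<dots> = (A * fact N * exp (M * harm N) / fact (N + Suc d) * exp (- Re b * harm (N + Suc d) + 2 * M ^ 2 * (\<Sum>j=1..N+Suc d. 1 / real j ^ 2))) * E"
    proof -
      have "exp (- Re b * harm (N + d) + 2 * M ^ 2 * (\<Sum>j=1..N+d. 1 / real j ^ 2)) =
         exp (- Re b * harm (N + Suc d) + 2 * M ^ 2 * (\<Sum>j=1..N+Suc d. 1 / real j ^ 2)) * exp (Re b / ?j - 2 * (M ^ 2 / ?j ^ 2))"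
        unfolding exp_add [symmetric] by (simp add: harm_Suc algebra_simps inverse_eq_divide add_divide_distrib)
      moreover have "fact (N + Suc d) = ?j * fact (N + d)" by simp
      moreover have "?j \<noteq> 0" by simp
      ultimately show ?thesis unfolding E_def by (simp del: of_nat_Suc fact_Suc)
    qed
    finally show ?case using E by (simp only: mult_le_cancel_right_pos)
  qed
  have "norm (rGamma (b + of_nat (Suc k))) \<le> C / fact k * exp (- Re b * harm k)" if b: "norm b \<le> M" for b k
  proof (cases "k \<ge> N")
    case True
    then obtain d where k: "k = N + d" using le_Suc_ex by blast
    have "norm (rGamma (b + of_nat (Suc k))) \<le> A * fact N * exp (M * harm N) / fact k * exp (- Re b * harm k + 2 * M ^ 2 * (\<Sum>j=1..k. 1 / real j ^ 2))"
      using large[OF b, of d] k by simp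
    also have "\<dots> \<le> A * fact N * exp (M * harm N) / fact k * exp (- Re b * harm k + 2 * M ^ 2 * 2)"
    proof -
      have "2 * M ^ 2 * (\<Sum>j=1..k. 1 / real j ^ 2) \<le> 2 * M ^ 2 * 2"
        by (intro mult_left_mono sum_inverse_squares_le) auto
      then show ?thesis using A0 by (intro mult_left_mono) auto
    qed
    also have "\<dots> = C / fact k * exp (- Re b * harm k)" unfolding C_def exp_add by (simp add: mult_ac)
    finally show ?thesis .
  next
    case False
    have "norm (rGamma (b + of_nat (Suc k))) \<le> A * 1 * 1" using small[OF b] False by simp
    also have "\<dots> \<le> A * (fact N / fact k) * exp (M * harm N + 2 * M ^ 2 * 2 + (- Re b * harm k))"
    proof (intro mult_mono)
      have "Re b * harm k \<le> M * harm k"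
        using b abs_Re_le_cmod[of b] by (intro mult_right_mono harm_nonneg) auto
      also have "\<dots> \<le> M * harm N" using M False by (intro mult_left_mono harm_mono) auto
      finally show "1 \<le> exp (M * harm N + 2 * M ^ 2 * 2 + (- Re b * harm k))"
        by (simp add: add_increasing2)
      show "1 \<le> fact N / (fact k :: real)" using False by (simp add: fact_mono)
    qed (use A0 in auto)
    also have "\<dots> = C / fact k * exp (- Re b * harm k)"
      by (simp add: C_def exp_diff exp_minus field_simps)
    finally show ?thesis .
  qed
  moreover have "C > 0" using A0 by (simp add: C_def)
  ultimately show ?thesis by blast
qed

lemma norm_prod_list_pochhammer_le:
  assumes "\<forall>a\<in>set as. norm (a::complex) \<le> M"
  shows "norm (prod_list (map (\<lambda>a. pochhammer a (Suc k)) as))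
     \<le> ((M + 1) * exp (M ^ 2)) ^ length as * fact k ^ length as * exp ((\<Sum>a\<leftarrow>as. Re a) * harm k)"
  using assms
proof (induction as)
  case (Cons a as)
  have M: "M \<ge> 0" using Cons.prems by (auto intro: order_trans[OF norm_ge_zero])
  have "norm (prod_list (map (\<lambda>a. pochhammer a (Suc k)) (a # as))) =
     norm (pochhammer a (Suc k)) * norm (prod_list (map (\<lambda>a. pochhammer a (Suc k)) as))"
    unfolding list.map prod_list.Cons norm_mult ..
  also have "\<dots> \<le> ((M + 1) * exp (M ^ 2) * fact k * exp (Re a * harm k)) *
     (((M + 1) * exp (M ^ 2)) ^ length as * fact k ^ length as * exp ((\<Sum>a\<leftarrow>as. Re a) * harm k))"
    using Cons M by (intro mult_mono norm_pochhammer_le) auto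
  also have "\<dots> = ((M + 1) * exp (M ^ 2)) ^ length (a # as) * fact k ^ length (a # as) * exp ((\<Sum>a\<leftarrow>a # as. Re a) * harm k)"
    by (simp add: exp_add algebra_simps)
  finally show ?case .
qed simp

lemma norm_prod_list_rGamma_le:
  assumes C: "C > 0" "\<forall>b::complex. norm b \<le> M \<longrightarrow> (\<forall>k. norm (rGamma (b + of_nat (Suc k))) \<le> C / fact k * exp (- Re b * harm k))"
    and "\<forall>b\<in>set bs. norm (b::complex) \<le> M"
  shows "norm (prod_list (map (\<lambda>b. rGamma (b + of_nat (Suc k))) bs))
     \<le> C ^ length bs / fact k ^ length bs * exp (- (\<Sum>b\<leftarrow>bs. Re b) * harm k)"
  using assms(3)
proof (induction bs)
  case (Cons a as)
  have "norm (prod_list (map (\<lambda>a. rGamma (a + of_nat (Suc k))) (a # as))) =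
     norm (rGamma (a + of_nat (Suc k))) * norm (prod_list (map (\<lambda>b. rGamma (b + of_nat (Suc k))) as))"
    unfolding list.map prod_list.Cons norm_mult ..
  also have "\<dots> \<le> (C / fact k * exp (- Re a * harm k)) * (C ^ length as / fact k ^ length as * exp (- (\<Sum>b\<leftarrow>as. Re b) * harm k))"
    using Cons C by (intro mult_mono) auto
  also have "\<dots> = C ^ length (a # as) / fact k ^ length (a # as) * exp (- (\<Sum>b\<leftarrow>a # as. Re b) * harm k)"
    by (simp add: exp_add exp_minus exp_diff field_simps)
  finally show ?case .
qed simp

text \<open>Real part of the parametric excess. With one more upper than lower parameter, the terms
  at 1 are of order at most k^(-1-excess).\<close>

definition excess :: "complex list \<Rightarrow> complex list \<Rightarrow> real" where
  "excess as bs = (\<Sum>b\<leftarrow>bs. Re b) - (\<Sum>a\<leftarrow>as. Re a)"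

text \<open>The factorials leave k!^(q+1) / (k!^q (k+1)!) = 1/(k+1), so the excess alone governs the
  decay. The exponent \<delta> is decoupled from it so that a single majorant can serve a compact
  set of parameters.\<close>

lemma norm_reg_term_le:
  assumes "M \<ge> 0"
  shows "\<exists>C>0. \<forall>as bs \<delta> k. length as = Suc (length bs) \<and> length bs = q \<and> (\<forall>a\<in>set as \<union> set bs. norm a \<le> M)
      \<and> 0 \<le> \<delta> \<and> \<delta> \<le> excess as bs \<longrightarrow>
     norm (reg_term as bs (Suc k)) \<le> C * (real (Suc k) powr (- 1 - \<delta>))"
proof -
  from norm_rGamma_le[OF assms] obtain C where C: "C > 0" "\<forall>b::complex. norm b \<le> M \<longrightarrow> (\<forall>k. norm (rGamma (b + of_nat (Suc k))) \<le> C / fact k * exp (- Re b * harm k))"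
    by blast
  define D where "D = ((M + 1) * exp (M ^ 2)) ^ Suc q * C ^ q"
  have "norm (reg_term as bs (Suc k)) \<le> D * (real (Suc k) powr (- 1 - \<delta>))"
    if as: "length as = Suc (length bs)" and bs: "length bs = q" and norm: "\<forall>a\<in>set as \<union> set bs. norm a \<le> M"
      and \<delta>: "0 \<le> \<delta>" "\<delta> \<le> excess as bs" for as bs \<delta> k
  proof -
    have "norm (reg_term as bs (Suc k)) =
       norm (prod_list (map (\<lambda>a. pochhammer a (Suc k)) as)) * norm (prod_list (map (\<lambda>b. rGamma (b + of_nat (Suc k))) bs)) / fact (Suc k)"
      unfolding reg_term_def norm_divide norm_mult norm_fact ..
    also have "\<dots> \<le> (((M + 1) * exp (M ^ 2)) ^ Suc q * fact k ^ Suc q * exp ((\<Sum>a\<leftarrow>as. Re a) * harm k)) *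
       (C ^ q / fact k ^ q * exp (- (\<Sum>b\<leftarrow>bs. Re b) * harm k)) / fact (Suc k)"
      using norm_prod_list_pochhammer_le[of as M k] norm_prod_list_rGamma_le[OF C, of bs k] norm as bs assms
      by (intro divide_right_mono mult_mono) auto
    also have "\<dots> = D * (1 / real (Suc k) * exp (- excess as bs * harm k))"
      unfolding fact_Suc D_def excess_def by (simp add: exp_add exp_minus exp_diff field_simps del: of_nat_Suc)
    also have "\<dots> \<le> D * (1 / real (Suc k) * real (Suc k) powr (- \<delta>))"
    proof -
      have "excess as bs * harm k \<ge> \<delta> * ln (real k + 1)"
        using \<delta> ln_le_harm[of k] by (intro mult_mono) auto
      then have "exp (- excess as bs * harm k) \<le> real (Suc k) powr (- \<delta>)"
        by (simp add: powr_def add.commute)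
      then show ?thesis using assms C(1) by (intro mult_left_mono) (auto simp: D_def)
    qed
    also have "1 / real (Suc k) * real (Suc k) powr (- \<delta>) = real (Suc k) powr (- 1 - \<delta>)"
      by (simp add: powr_diff powr_minus field_simps)
    finally show ?thesis .
  qed
  moreover have "D > 0" using assms C(1) by (simp add: D_def)
  ultimately show ?thesis by blast
qed

lemma summable_Suc_powr: "\<delta> > 0 \<Longrightarrow> summable (\<lambda>k. real (Suc k) powr (- 1 - \<delta>))"
  by (subst summable_Suc_iff[where f = "\<lambda>k. real k powr (- 1 - \<delta>)"]) (simp add: summable_real_powr_iff)

lemma reg_term_abs_summable:
  assumes "length as = Suc (length bs)" "excess as bs > 0"
  shows "summable (\<lambda>k. norm (reg_term as bs k))"
proof -
  define M where "M = Max (insert 0 (norm ` (set as \<union> set bs)))"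
  have M: "M \<ge> 0" "\<forall>a\<in>set as \<union> set bs. norm a \<le> M" by (auto simp: M_def)
  obtain C where "\<And>k. norm (reg_term as bs (Suc k)) \<le> C * (real (Suc k) powr (- 1 - excess as bs))"
    using norm_reg_term_le[OF M(1), of "length bs"] assms M(2) by (metis less_imp_le order_refl)
  then have "summable (\<lambda>k. norm (reg_term as bs (Suc k)))"
    by (intro summable_comparison_test'[OF summable_mult[OF summable_Suc_powr[OF assms(2)]]]) auto
  then show ?thesis by (subst (asm) summable_Suc_iff)
qed

lemma holomorphic_on_prod_list [holomorphic_intros]:
  "(\<And>f. f \<in> set fs \<Longrightarrow> g f holomorphic_on S) \<Longrightarrow> (\<lambda>w. prod_list (map (\<lambda>f. g f w) fs)) holomorphic_on S"
  by (induction fs) (auto intro!: holomorphic_intros)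

lemma holomorphic_on_pochhammer [holomorphic_intros]:
  "f holomorphic_on S \<Longrightarrow> (\<lambda>w. pochhammer (f w) k) holomorphic_on S"
  unfolding pochhammer_prod by (intro holomorphic_intros)

lemma holomorphic_on_reg_term:
  assumes "\<And>f. f \<in> set as \<union> set bs \<Longrightarrow> f holomorphic_on S"
  shows "(\<lambda>w. reg_term (map (\<lambda>f. f w) as) (map (\<lambda>f. f w) bs) k) holomorphic_on S"
  unfolding reg_term_def map_map o_def using assms by (intro holomorphic_intros) auto

text \<open>Parameters are functions of w, so that continuation along any line in parameter space is
  covered. On a closed disc the Weierstrass test applies with \<delta> the minimum of the excess,
  attained by compactness.\<close>

lemma holomorphic_on_reg_hyp:
  assumes S: "open S" and len: "length as = Suc (length bs)"
    and hol: "\<And>f. f \<in> set as \<union> set bs \<Longrightarrow> f holomorphic_on S"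
    and ex: "\<And>w. w \<in> S \<Longrightarrow> excess (map (\<lambda>f. f w) as) (map (\<lambda>f. f w) bs) > 0"
  shows "(\<lambda>w. reg_hyp (map (\<lambda>f. f w) as) (map (\<lambda>f. f w) bs)) holomorphic_on S"
proof (rule holomorphic_uniform_sequence[OF S])
  show "(\<lambda>w. \<Sum>k<n. reg_term (map (\<lambda>f. f w) as) (map (\<lambda>f. f w) bs) k) holomorphic_on S" for n
    by (intro holomorphic_intros holomorphic_on_reg_term hol)
  fix x assume "x \<in> S"
  then obtain d where d: "d > 0" "cball x d \<subseteq> S" using S open_contains_cball_eq by blast
  let ?K = "cball x d"
  have cont: "continuous_on ?K f" if "f \<in> set as \<union> set bs" for f
    using hol[OF that] d(2) holomorphic_on_imp_continuous_on holomorphic_on_subset by blast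
  have "\<exists>B. \<forall>w\<in>?K. norm (f w) \<le> B" if "f \<in> set as \<union> set bs" for f
    using compact_imp_bounded[OF compact_continuous_image[OF cont[OF that] compact_cball]]
    by (auto simp: bounded_iff)
  then obtain B where B: "\<And>f w. f \<in> set as \<union> set bs \<Longrightarrow> w \<in> ?K \<Longrightarrow> norm (f w) \<le> B f" by metis
  define M where "M = Max (insert 0 (B ` (set as \<union> set bs)))"
  have M0: "M \<ge> 0" by (simp add: M_def)
  have M: "norm (f w) \<le> M" if "f \<in> set as \<union> set bs" "w \<in> ?K" for f w
  proof -
    have "norm (f w) \<le> B f" using B that by blast
    also have "\<dots> \<le> M" unfolding M_def using that(1) by (intro Max_ge) auto
    finally show ?thesis .
  qed
  define s where "s = (\<lambda>w. excess (map (\<lambda>f. f w) as) (map (\<lambda>f. f w) bs))"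
  have sl: "continuous_on ?K (\<lambda>w. \<Sum>f\<leftarrow>fs. Re (f w))" if "set fs \<subseteq> set as \<union> set bs" for fs
    using that by (induction fs) (auto intro!: continuous_intros cont)
  have s: "continuous_on ?K s"
    unfolding s_def excess_def map_map o_def by (intro continuous_intros sl) auto
  have "\<exists>w0\<in>?K. \<forall>w\<in>?K. s w0 \<le> s w"
    by (rule continuous_attains_inf[OF compact_cball _ s]) (use d in auto)
  then obtain w0 where w0: "w0 \<in> ?K" "\<And>w. w \<in> ?K \<Longrightarrow> s w0 \<le> s w" by blast
  have pos: "s w0 > 0" unfolding s_def using w0(1) d(2) by (intro ex) auto
  obtain C where C: "\<And>as' bs' \<delta> k. length as' = Suc (length bs') \<Longrightarrow> length bs' = length bs \<Longrightarrow> (\<forall>a\<in>set as' \<union> set bs'. norm a \<le> M)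
      \<Longrightarrow> 0 \<le> \<delta> \<Longrightarrow> \<delta> \<le> excess as' bs' \<Longrightarrow>
     norm (reg_term as' bs' (Suc k)) \<le> C * (real (Suc k) powr (- 1 - \<delta>))"
    using norm_reg_term_le[OF M0, of "length bs"] by metis
  have "uniform_limit ?K (\<lambda>n w. \<Sum>k<n. reg_term (map (\<lambda>f. f w) as) (map (\<lambda>f. f w) bs) k)
       (\<lambda>w. \<Sum>k. reg_term (map (\<lambda>f. f w) as) (map (\<lambda>f. f w) bs) k) sequentially"
  proof (rule Weierstrass_m_test_ev)
    have *: "norm (reg_term (map (\<lambda>f. f w) as) (map (\<lambda>f. f w) bs) k) \<le> C * (real k powr (- 1 - s w0))"
      if k: "k \<ge> 1" and w: "w \<in> ?K" for k w
    proof -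
      obtain k' where k': "k = Suc k'" using k by (cases k) auto
      show ?thesis unfolding k' using len M[OF _ w] pos w0(2)[OF w]
        by (intro C) (auto simp: s_def)
    qed
    then show "\<forall>\<^sub>F k in sequentially. \<forall>w\<in>?K. norm (reg_term (map (\<lambda>f. f w) as) (map (\<lambda>f. f w) bs) k) \<le> C * (real k powr (- 1 - s w0))"
      by (intro eventually_mono[OF eventually_ge_at_top[of 1]] ballI *)
    show "summable (\<lambda>k. C * (real k powr (- 1 - s w0)))"
      using pos by (intro summable_mult) (simp add: summable_real_powr_iff)
  qed
  then show "\<exists>d>0. cball x d \<subseteq> S \<and> uniform_limit (cball x d) (\<lambda>n w. \<Sum>k<n. reg_term (map (\<lambda>f. f w) as) (map (\<lambda>f. f w) bs) k)
       (\<lambda>w. reg_hyp (map (\<lambda>f. f w) as) (map (\<lambda>f. f w) bs)) sequentially"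
    using d unfolding reg_hyp_def by blast
qed

lemma reg_term_terminating:
  "- of_nat n \<in> set as \<Longrightarrow> k > n \<Longrightarrow> reg_term as bs k = 0"
  by (auto simp: reg_term_def prod_list_zero_iff pochhammer_of_nat_eq_0_iff image_iff intro!: bexI[of _ "- of_nat n"])

lemma reg_hyp_terminating:
  assumes "- of_nat n \<in> set as"
  shows "reg_hyp as bs = (\<Sum>k\<le>n. reg_term as bs k)"
  unfolding reg_hyp_def using reg_term_terminating[OF assms] by (intro suminf_finite) auto

text \<open>A parameter frozen at \<open>- of_nat n\<close> leaves a finite sum of the same length
  for all w. This is what permits continuation outside the half-plane of convergence.\<close>

lemma holomorphic_on_reg_hyp_terminating:
  assumes hol: "\<And>f. f \<in> set as \<union> set bs \<Longrightarrow> f holomorphic_on S"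
    and ter: "f0 \<in> set as" "\<And>w. w \<in> S \<Longrightarrow> f0 w = - of_nat n"
  shows "(\<lambda>w. reg_hyp (map (\<lambda>f. f w) as) (map (\<lambda>f. f w) bs)) holomorphic_on S"
proof -
  have "(\<lambda>w. \<Sum>k\<le>n. reg_term (map (\<lambda>f. f w) as) (map (\<lambda>f. f w) bs) k) holomorphic_on S"
    by (intro holomorphic_intros holomorphic_on_reg_term hol)
  moreover have "reg_hyp (map (\<lambda>f. f w) as) (map (\<lambda>f. f w) bs) = (\<Sum>k\<le>n. reg_term (map (\<lambda>f. f w) as) (map (\<lambda>f. f w) bs) k)"
    if "w \<in> S" for w
    using ter(1) ter(2)[OF that] by (intro reg_hyp_terminating) (auto simp: image_iff intro!: bexI[of _ f0])
  ultimately show ?thesis by (simp cong: holomorphic_cong)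
qed

section \<open>Gauss's summation theorem\<close>

lemma reg_term_times_nat_tendsto_0:
  assumes "length as = Suc (length bs)" "excess as bs > 0"
  shows "(\<lambda>k. of_nat k * reg_term as bs k) \<longlonglongrightarrow> 0"
proof -
  define M where "M = Max (insert 0 (norm ` (set as \<union> set bs)))"
  have M: "M \<ge> 0" "\<forall>a\<in>set as \<union> set bs. norm a \<le> M" by (auto simp: M_def)
  obtain C where C: "\<And>k. norm (reg_term as bs (Suc k)) \<le> C * (real (Suc k) powr (- 1 - excess as bs))"
    using norm_reg_term_le[OF M(1), of "length bs"] assms M(2) by (metis less_imp_le order_refl)
  have "(\<lambda>k. of_nat (Suc k) * reg_term as bs (Suc k)) \<longlonglongrightarrow> 0"
  proof (rule Lim_null_comparison)
    have "(\<lambda>k. real (Suc k) powr (- excess as bs)) \<longlonglongrightarrow> 0"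
      using assms(2) by (intro tendsto_neg_powr filterlim_compose[OF filterlim_real_sequentially filterlim_Suc]) auto
    then show "(\<lambda>k. C * real (Suc k) powr (- excess as bs)) \<longlonglongrightarrow> 0"
      by (rule tendsto_mult_right_zero)
    have "norm (of_nat (Suc k) * reg_term as bs (Suc k)) \<le> C * real (Suc k) powr (- excess as bs)" for k
    proof -
      have "norm (of_nat (Suc k) * reg_term as bs (Suc k)) = real (Suc k) * norm (reg_term as bs (Suc k))"
        by (simp only: norm_mult norm_of_nat)
      also have "\<dots> \<le> real (Suc k) * (C * (real (Suc k) powr (- 1 - excess as bs)))"
        by (intro mult_left_mono C) auto
      also have "\<dots> = C * (real (Suc k) powr 1 * real (Suc k) powr (- 1 - excess as bs))" by simp
      also have "\<dots> = C * real (Suc k) powr (- excess as bs)"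
        unfolding powr_add [symmetric] by simp
      finally show ?thesis .
    qed
    then show "\<forall>\<^sub>F k in sequentially. norm (of_nat (Suc k) * reg_term as bs (Suc k)) \<le> C * real (Suc k) powr (- excess as bs)"
      by (intro always_eventually allI)
  qed
  then show ?thesis by (rule LIMSEQ_imp_Suc)
qed

lemma excess_simps [simp]:
  "excess [] [] = 0" "excess (a # as) bs = excess as bs - Re a" "excess [] (b # bs) = excess [] bs + Re b"
  by (simp_all add: excess_def)

lemma not_nonpos_Int_complex: "Re z > 0 \<Longrightarrow> z \<notin> \<int>\<^sub>\<le>\<^sub>0"
  by (auto elim!: nonpos_Ints_cases)

text \<open>Termwise the difference of the two sides is k t_k - (k+1) t_{k+1}; it telescopes, and k
  t_k -> 0 removes the boundary term.\<close>

lemma gauss_shift: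
  fixes x y z :: complex
  assumes "Re (z - x - y) > 0"
  shows "(z - x - y) * reg_hyp [x, y] [z] = (z - x) * (z - y) * reg_hyp [x, y] [z + 1]"
proof -
  let ?t = "\<lambda>z. reg_term [x, y] [z]"
  have "summable (?t z)" "summable (?t (z + 1))"
    using assms by (auto intro!: summable_norm_cancel[OF reg_term_abs_summable])
  then have "(\<lambda>k. (z - x - y) * ?t z k - (z - x) * (z - y) * ?t (z + 1) k) sums
      ((z - x - y) * reg_hyp [x, y] [z] - (z - x) * (z - y) * reg_hyp [x, y] [z + 1])"
    unfolding reg_hyp_def by (intro sums_diff sums_mult summable_sums)
  moreover have "(\<lambda>k. (z - x - y) * ?t z k - (z - x) * (z - y) * ?t (z + 1) k) sums (0 - 0)"
  proof -
    have "(z - x - y) * ?t z k - (z - x) * (z - y) * ?t (z + 1) k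
       = of_nat k * ?t z k - of_nat (Suc k) * ?t z (Suc k)" for k
    proof -
      define T where "T = ?t (z + 1) k"
      have 1: "?t z k = (z + of_nat k) * T"
        using rGamma_plus1[of "z + of_nat k"] by (simp add: T_def reg_term_def add_ac)
      have 2: "of_nat (Suc k) * ?t z (Suc k) = (x + of_nat k) * (y + of_nat k) * T"
      proof -
        have 3: "z + of_nat (Suc k) = z + 1 + of_nat k" by simp
        have 4: "S * (A * u * (B * v) * R / (S * F)) = u * v * (A * B * R / F)" if "S \<noteq> 0" for A B R S F u v :: complex
          using that by simp
        have "of_nat (Suc k) \<noteq> (0 :: complex)" by (rule of_nat_neq_0)
        from 4[OF this] show ?thesis
          unfolding T_def reg_term_def list.map prod_list.Cons prod_list.Nil mult_1_right 3 pochhammer_Suc fact_Suc .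
      qed
      show ?thesis unfolding 1 2 T_def [symmetric] by (simp add: algebra_simps)
    qed
    moreover have "(\<lambda>k. of_nat k * ?t z k - of_nat (Suc k) * ?t z (Suc k)) sums (of_nat 0 * ?t z 0 - 0)"
      by (rule telescope_sums') (use assms in \<open>auto intro!: reg_term_times_nat_tendsto_0\<close>)
    ultimately show ?thesis by simp
  qed
  ultimately have "(z - x - y) * reg_hyp [x, y] [z] - (z - x) * (z - y) * reg_hyp [x, y] [z + 1] = 0 - 0"
    by (rule sums_unique2)
  then show ?thesis by simp
qed

text \<open>The k-th term equals rGamma(z) (x)_k (y)_k / (k! (z+N)_k), which tends to 0 for k > 0.
  Since Re z > 0 gives |(z)_k| <= |(z+N)_k|, the terms at N = 0 dominate, and Tannery's theorem
  exchanges limit and sum.\<close>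

lemma gauss_asymptotic:
  fixes x y z :: complex
  assumes "Re z > 0" "Re (z - x - y) > 0"
  shows "(\<lambda>N. pochhammer z N * reg_hyp [x, y] [z + of_nat N]) \<longlonglongrightarrow> rGamma z"
proof -
  let ?t = "\<lambda>z. reg_term [x, y] [z]"
  have zz: "z + of_nat n \<notin> \<int>\<^sub>\<le>\<^sub>0" for n
    using assms(1) by (auto elim!: nonpos_Ints_cases simp: complex_eq_iff)
  have eq: "pochhammer z N * ?t (z + of_nat N) k = rGamma z * (pochhammer x k * pochhammer y k / fact k / pochhammer (z + of_nat N) k)" for N k
  proof -
    have "pochhammer (z + of_nat N) k \<noteq> 0" using zz by (metis pochhammer_eq_0_imp_nonpos_Int)
    then have "rGamma (z + of_nat N + of_nat k) = rGamma (z + of_nat N) / pochhammer (z + of_nat N) k"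
      using pochhammer_rGamma[of "z + of_nat N" k] by simp
    then show ?thesis using pochhammer_rGamma[of z N] by (simp add: reg_term_def mult_ac)
  qed
  have mono: "norm (pochhammer z k) \<le> norm (pochhammer w k)" if "Re z \<le> Re w" "Im w = Im z" for w k
  proof (induction k)
    case (Suc k)
    have "(Re z + real k)\<^sup>2 \<le> (Re w + real k)\<^sup>2"
      using that(1) assms(1) by (intro power_mono) auto
    then have "norm (z + of_nat k) \<le> norm (w + of_nat k)"
      unfolding cmod_def using that(2) by simp
    then show ?case using Suc by (simp add: pochhammer_Suc norm_mult mult_mono)
  qed simp
  have pz: "pochhammer z k \<noteq> 0" for k using zz[of 0] by (metis add.right_neutral of_nat_0 pochhammer_eq_0_imp_nonpos_Int)
  have "(\<lambda>N. \<Sum>k. pochhammer z N * ?t (z + of_nat N) k) \<longlonglongrightarrow> (\<Sum>k. if k = 0 then rGamma z else 0)"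
  proof (rule tannerys_theorem[THEN conjunct2, THEN conjunct2])
    fix k
    show "(\<lambda>N. pochhammer z N * ?t (z + of_nat N) k) \<longlonglongrightarrow> (if k = 0 then rGamma z else 0)"
    proof (cases k)
      case 0
      then show ?thesis by (simp add: eq)
    next
      case (Suc k')
      define D where "D = norm (rGamma z * (pochhammer x k * pochhammer y k / fact k))"
      have "norm (pochhammer z N * ?t (z + of_nat N) k) \<le> D / norm (pochhammer z k') / real N" if N: "N > 0" for N
      proof -
        have "real N * norm (pochhammer z k') \<le> norm (z + of_nat N) * norm (pochhammer (z + of_nat N + 1) k')"
        proof (intro mult_mono mono)
          show "real N \<le> norm (z + of_nat N)"
            using complex_Re_le_cmod[of "z + of_nat N"] assms(1) by simp
        qed auto
        also have "\<dots> = norm (pochhammer (z + of_nat N) k)"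
          unfolding Suc pochhammer_rec by (simp add: norm_mult)
        finally have "D / norm (pochhammer (z + of_nat N) k) \<le> D / (real N * norm (pochhammer z k'))"
          using N pz[of k'] zz pochhammer_eq_0_imp_nonpos_Int[of "z + of_nat N" k]
          by (intro divide_left_mono mult_pos_pos) (auto simp: D_def)
        then show ?thesis unfolding eq D_def by (simp add: norm_mult norm_divide mult_ac)
      qed
      then have "\<forall>\<^sub>F N in sequentially. norm (pochhammer z N * ?t (z + of_nat N) k) \<le> D / norm (pochhammer z k') / real N"
        using eventually_gt_at_top[of 0] by (rule eventually_mono[rotated])
      moreover have "(\<lambda>N. D / norm (pochhammer z k') / real N) \<longlonglongrightarrow> 0"
        by (rule lim_const_over_n)
      ultimately have "(\<lambda>N. pochhammer z N * ?t (z + of_nat N) k) \<longlonglongrightarrow> 0" by (rule Lim_null_comparison)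
      then show ?thesis using Suc by simp
    qed
  next
    have "norm (pochhammer z N * ?t (z + of_nat N) k) \<le> norm (?t z k)" for N k
    proof -
      have "norm (pochhammer z N * ?t (z + of_nat N) k) =
          norm (rGamma z * (pochhammer x k * pochhammer y k / fact k)) / norm (pochhammer (z + of_nat N) k)"
        unfolding eq by (simp add: norm_mult norm_divide)
      also have "\<dots> \<le> norm (rGamma z * (pochhammer x k * pochhammer y k / fact k)) / norm (pochhammer z k)"
        using pz[of k] mono[of "z + of_nat N" k] by (intro divide_left_mono mult_pos_pos) (auto intro: less_le_trans[rotated])
      also have "\<dots> = norm (?t z k)" using eq[of 0 k] by (simp add: norm_mult norm_divide)
      finally show ?thesis .
    qed
    then show "\<forall>\<^sub>F (k, N) in at_top \<times>\<^sub>F sequentially. norm (pochhammer z N * ?t (z + of_nat N) k) \<le> norm (?t z k)"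
      by (intro always_eventually) auto
    show "summable (\<lambda>k. norm (?t z k))" using assms by (intro reg_term_abs_summable) auto
  qed simp
  also have "(\<Sum>k. if k = 0 then rGamma z else 0) = rGamma z" by (subst suminf_finite[of "{0}"]) auto
  also have "(\<lambda>N. \<Sum>k. pochhammer z N * ?t (z + of_nat N) k) = (\<lambda>N. pochhammer z N * reg_hyp [x, y] [z + of_nat N])"
  proof
    fix N
    have "summable (?t (z + of_nat N))"
      using assms by (auto intro!: summable_norm_cancel[OF reg_term_abs_summable])
    then show "(\<Sum>k. pochhammer z N * ?t (z + of_nat N) k) = pochhammer z N * reg_hyp [x, y] [z + of_nat N]"
      unfolding reg_hyp_def by (rule suminf_mult)
  qed
  finally show ?thesis .
qed

text \<open>N contiguous steps leave a quotient of Pochhammer symbols; Euler's limit evaluates it,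
  the powers of n cancelling because (z-x) + (z-y) = (z-x-y) + z. This settles Re z > 0, and the
  contiguous relation, now used to lower z by one, extends the result to all z.\<close>

lemma gauss_complex:
  fixes x y z :: complex
  assumes "Re (z - x - y) > 0"
  shows "reg_hyp [x, y] [z] = Gamma (z - x - y) * rGamma (z - x) * rGamma (z - y)"
proof -
  have base: "reg_hyp [x, y] [z] = Gamma (z - x - y) * rGamma (z - x) * rGamma (z - y)"
    if z: "Re z > 0" and e: "Re (z - x - y) > 0" for z
  proof -
    have nz: "rGamma (z - x - y) \<noteq> 0" "rGamma z \<noteq> 0"
      using not_nonpos_Int_complex[OF z] not_nonpos_Int_complex[OF e] by (simp_all add: rGamma_eq_zero_iff)
    have pz: "pochhammer z N \<noteq> 0" "pochhammer (z - x - y) N \<noteq> 0" for N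
      using not_nonpos_Int_complex[OF z] not_nonpos_Int_complex[OF e] by (metis pochhammer_eq_0_imp_nonpos_Int)+
    have shift: "pochhammer (z - x - y) N * reg_hyp [x, y] [z] = pochhammer (z - x) N * pochhammer (z - y) N * reg_hyp [x, y] [z + of_nat N]" for N
    proof (induction N)
      case (Suc N)
      have *: "(z + of_nat N - x - y) * reg_hyp [x, y] [z + of_nat N] = (z + of_nat N - x) * (z + of_nat N - y) * reg_hyp [x, y] [z + of_nat N + 1]"
        using e by (intro gauss_shift) simp
      have "pochhammer (z - x - y) (Suc N) * reg_hyp [x, y] [z] =
         (z + of_nat N - x - y) * (pochhammer (z - x - y) N * reg_hyp [x, y] [z])"
        by (simp add: pochhammer_Suc algebra_simps)
      also have "\<dots> = pochhammer (z - x) N * pochhammer (z - y) N * ((z + of_nat N - x - y) * reg_hyp [x, y] [z + of_nat N])"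
        unfolding Suc by (simp only: mult_ac)
      also have "\<dots> = pochhammer (z - x) (Suc N) * pochhammer (z - y) (Suc N) * reg_hyp [x, y] [z + of_nat (Suc N)]"
        unfolding * by (simp add: pochhammer_Suc algebra_simps)
      finally show ?case .
    qed simp
    define q where "q = (\<lambda>N. pochhammer (z - x) N * pochhammer (z - y) N / (pochhammer (z - x - y) N * pochhammer z N))"
    have "(\<lambda>n. rGamma_series (z - x) n * rGamma_series (z - y) n / (rGamma_series (z - x - y) n * rGamma_series z n))
        \<longlonglongrightarrow> rGamma (z - x) * rGamma (z - y) / (rGamma (z - x - y) * rGamma z)"
      using nz by (intro tendsto_intros) auto
    also have "(\<lambda>n. rGamma_series (z - x) n * rGamma_series (z - y) n / (rGamma_series (z - x - y) n * rGamma_series z n)) = (\<lambda>n. q (Suc n))"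
    proof
      fix n
      define E where "E = (\<lambda>w. fact n * exp (w * of_real (ln (of_nat n))) :: complex)"
      have E: "E (z - x) * E (z - y) = E (z - x - y) * E z" "\<And>w. E w \<noteq> 0"
        by (simp_all add: E_def exp_add [symmetric] algebra_simps)
      have *: "P / e1 * (Q / e2) / (R / e3 * (S / e4)) = P * Q / (R * S)"
        if "e1 * e2 = e3 * e4" "e1 \<noteq> 0" "e2 \<noteq> 0" "e3 \<noteq> 0" "e4 \<noteq> 0" for P Q R S e1 e2 e3 e4 :: complex
      proof -
        have "P / e1 * (Q / e2) / (R / e3 * (S / e4)) = P * Q / (R * S) * ((e3 * e4) / (e1 * e2))" by simp
        then show ?thesis using that by simp
      qed
      show "rGamma_series (z - x) n * rGamma_series (z - y) n / (rGamma_series (z - x - y) n * rGamma_series z n) = q (Suc n)"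
        using *[OF E(1) E(2) E(2) E(2) E(2)] unfolding rGamma_series_def q_def E_def Suc_eq_plus1 .
    qed
    finally have "q \<longlonglongrightarrow> rGamma (z - x) * rGamma (z - y) / (rGamma (z - x - y) * rGamma z)"
      by (rule LIMSEQ_imp_Suc)
    from tendsto_mult[OF this gauss_asymptotic[OF z e]]
    have "(\<lambda>N. q N * (pochhammer z N * reg_hyp [x, y] [z + of_nat N])) \<longlonglongrightarrow>
       rGamma (z - x) * rGamma (z - y) / (rGamma (z - x - y) * rGamma z) * rGamma z" .
    also have "(\<lambda>N. q N * (pochhammer z N * reg_hyp [x, y] [z + of_nat N])) = (\<lambda>N. reg_hyp [x, y] [z])"
    proof
      fix N
      have "q N * (pochhammer z N * reg_hyp [x, y] [z + of_nat N]) =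
        (pochhammer (z - x) N * pochhammer (z - y) N * reg_hyp [x, y] [z + of_nat N]) / pochhammer (z - x - y) N"
        using pz[of N] by (simp add: q_def)
      also have "\<dots> = reg_hyp [x, y] [z]" unfolding shift [symmetric] using pz[of N] by simp
      finally show "q N * (pochhammer z N * reg_hyp [x, y] [z + of_nat N]) = reg_hyp [x, y] [z]" .
    qed
    finally have "reg_hyp [x, y] [z] = rGamma (z - x) * rGamma (z - y) / (rGamma (z - x - y) * rGamma z) * rGamma z"
      by (simp add: LIMSEQ_const_iff)
    then show ?thesis using nz by (simp add: Gamma_def field_simps)
  qed
  have "\<forall>z. Re z + real n > 0 \<longrightarrow> Re (z - x - y) > 0 \<longrightarrow> reg_hyp [x, y] [z] = Gamma (z - x - y) * rGamma (z - x) * rGamma (z - y)" for n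
  proof (induction n)
    case 0
    then show ?case using base by simp
  next
    case (Suc n)
    show ?case
    proof (intro allI impI)
      fix z assume z: "Re z + real (Suc n) > 0" and e: "Re (z - x - y) > 0"
      have IH: "reg_hyp [x, y] [z + 1] = Gamma (z - x - y + 1) * rGamma (z - x + 1) * rGamma (z - y + 1)"
        using Suc[rule_format, of "z + 1"] z e by (simp add: algebra_simps)
      have ne: "z - x - y \<notin> \<int>\<^sub>\<le>\<^sub>0" by (rule not_nonpos_Int_complex[OF e])
      then have ne0: "z - x - y \<noteq> 0" by auto
      have "(z - x - y) * reg_hyp [x, y] [z] = (z - x) * (z - y) * reg_hyp [x, y] [z + 1]"
        by (rule gauss_shift[OF e])
      also have "\<dots> = ((z - x) * rGamma (z - x + 1)) * ((z - y) * rGamma (z - y + 1)) * Gamma (z - x - y + 1)"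
        unfolding IH by (simp only: mult_ac)
      also have "\<dots> = (z - x - y) * (Gamma (z - x - y) * rGamma (z - x) * rGamma (z - y))"
        unfolding rGamma_plus1 Gamma_plus1[OF ne] by (simp only: mult_ac)
      finally show "reg_hyp [x, y] [z] = Gamma (z - x - y) * rGamma (z - x) * rGamma (z - y)"
        using ne0 by simp
    qed
  qed
  note gen = this
  obtain n where "- Re z < real n" using reals_Archimedean2 by blast
  then have "Re z + real n > 0" by simp
  then show ?thesis using gen assms by blast
qed

lemma reg_term_of_real:
  "reg_term (map complex_of_real as) (map complex_of_real bs) k = complex_of_real (reg_term as bs k)"
proof -
  have r: "rGamma (complex_of_real b + of_nat k) = complex_of_real (rGamma (b + real k))" for b
    using rGamma_complex_of_real[of "b + real k"] by simp
  have 1: "prod_list (map (\<lambda>a. pochhammer a k) (map complex_of_real as)) = complex_of_real (prod_list (map (\<lambda>a. pochhammer a k) as))"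
    by (induction as) (simp_all add: pochhammer_of_real)
  have 2: "prod_list (map (\<lambda>b. rGamma (b + of_nat k)) (map complex_of_real bs)) = complex_of_real (prod_list (map (\<lambda>b. rGamma (b + of_nat k)) bs))"
    by (induction bs) (simp_all add: r)
  show ?thesis unfolding reg_term_def 1 2 by simp
qed

text \<open>Real series inherit convergence from the complex estimates; the real form is wanted
  because the positivity argument lives over the reals.\<close>

lemma reg_hyp_of_real_sums:
  fixes as bs :: "real list"
  assumes "length as = Suc (length bs)" "sum_list as < sum_list bs"
  shows "reg_term as bs sums reg_hyp as bs"
    and "reg_hyp (map complex_of_real as) (map complex_of_real bs) = complex_of_real (reg_hyp as bs)"
proof -
  have "sum_list (map (\<lambda>x. Re (complex_of_real x)) xs) = sum_list xs" for xs by (induction xs) auto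
  then have "excess (map complex_of_real as) (map complex_of_real bs) > 0"
    using assms(2) by (simp add: excess_def o_def)
  then have "summable (reg_term (map complex_of_real as) (map complex_of_real bs))"
    using assms(1) by (intro summable_norm_cancel[OF reg_term_abs_summable]) auto
  then have *: "summable (\<lambda>k. complex_of_real (reg_term as bs k))"
    by (simp add: reg_term_of_real[abs_def])
  then have s: "summable (reg_term as bs)" by (simp add: summable_complex_of_real)
  then show "reg_term as bs sums reg_hyp as bs" by (simp add: reg_hyp_def summable_sums)
  show "reg_hyp (map complex_of_real as) (map complex_of_real bs) = complex_of_real (reg_hyp as bs)"
    unfolding reg_hyp_def reg_term_of_real by (rule suminf_of_real[OF s, symmetric])
qed

lemma gauss_real:
  fixes x y z :: real
  assumes "x + y < z"
  shows "(\<lambda>k. pochhammer x k * pochhammer y k * rGamma (z + of_nat k) / fact k) sums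
     (Gamma (z - x - y) * rGamma (z - x) * rGamma (z - y))"
proof -
  have "complex_of_real (reg_hyp [x, y] [z]) = reg_hyp [of_real x, of_real y] [of_real z]"
    using reg_hyp_of_real_sums(2)[of "[x, y]" "[z]"] assms by simp
  also have "\<dots> = complex_of_real (Gamma (z - x - y) * rGamma (z - x) * rGamma (z - y))"
    using assms by (subst gauss_complex)
      (simp_all add: rGamma_complex_of_real [symmetric] Gamma_complex_of_real [symmetric])
  finally have "reg_hyp [x, y] [z] = Gamma (z - x - y) * rGamma (z - x) * rGamma (z - y)"
    by (simp only: of_real_eq_iff)
  then show ?thesis using reg_hyp_of_real_sums(1)[of "[x, y]" "[z]"] assms
    by (simp add: reg_term_def[abs_def] mult.assoc)
qed

section \<open>Newton series with nonnegative coefficients\<close>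

lemma sums_of_double_summable:
  fixes G :: "nat \<times> nat \<Rightarrow> real"
  assumes "G summable_on UNIV" "\<And>k. (\<lambda>m. G (k, m)) sums v k"
  shows "v sums infsum G UNIV"
proof -
  have G: "G summable_on Sigma UNIV (\<lambda>_. UNIV)" using assms(1) by simp
  have "((\<lambda>m. G (k, m)) has_sum v k) UNIV" for k
  proof -
    have "(\<lambda>m. G (k, m)) summable_on UNIV"
      using summable_on_SigmaD1[of "\<lambda>x y. G (x, y)" UNIV "\<lambda>_. UNIV" k] assms(1) by simp
    then have *: "((\<lambda>m. G (k, m)) has_sum infsum (\<lambda>m. G (k, m)) UNIV) UNIV" by (rule has_sum_infsum)
    then have "infsum (\<lambda>m. G (k, m)) UNIV = v k" using has_sum_imp_sums assms(2) sums_unique2 by blast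
    then show ?thesis using * by simp
  qed
  then have "(v has_sum infsum G UNIV) UNIV"
    using has_sum_infsum[OF G] has_sum_SigmaD[where f = G and A = UNIV and B = "\<lambda>_. UNIV" and g = v] by simp
  then show ?thesis by (rule has_sum_imp_sums)
qed

lemma has_sum_finite_sum:
  fixes f :: "'b \<Rightarrow> 'a \<Rightarrow> real"
  assumes "finite J" "\<And>j. j \<in> J \<Longrightarrow> (f j has_sum S j) A"
  shows "((\<lambda>i. \<Sum>j\<in>J. f j i) has_sum (\<Sum>j\<in>J. S j)) A"
  using assms by (induction J rule: finite_induct) (auto intro: has_sum_add)

text \<open>Newton basis for the nodes p = -n: for s > 0 element j vanishes at -n exactly when j >
  n.\<close>

abbreviation newton :: "real \<Rightarrow> nat \<Rightarrow> real \<Rightarrow> real" where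
  "newton s j p \<equiv> pochhammer p j * pochhammer (s - p) j"

text \<open>The part of the k-th term that depends on p: c = r gives the three-parameter series, c =
  0 the well-poised one.\<close>

abbreviation kern :: "real \<Rightarrow> real \<Rightarrow> real \<Rightarrow> nat \<Rightarrow> real" where
  "kern s c p k \<equiv> pochhammer (c + p) k * pochhammer (c + s - p) k
     * rGamma (s + c + p + real k) * rGamma (2 * s + c - p + real k)"

text \<open>Gauss's theorem from right to left, with z = 2s+2c+2k, x = c+p+k, y = c+s-p+k and z-x-y
  = s. The Gamma factors containing p are gone; p survives only in products that are positive for c
  >= 0 and 0 < p < s.\<close>

lemma kern_sums:
  assumes "s > 0"
  shows "(\<lambda>m. pochhammer (c + p) (k + m) * pochhammer (c + s - p) (k + m)
     * rGamma (2 * s + 2 * c + 2 * real k + real m) / fact m) sums (Gamma s * kern s c p k)"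
proof -
  have "(\<lambda>m. pochhammer (c + p) k * pochhammer (c + s - p) k *
      (pochhammer (c + p + real k) m * pochhammer (c + s - p + real k) m * rGamma (2 * s + 2 * c + 2 * real k + real m) / fact m)) sums
     (pochhammer (c + p) k * pochhammer (c + s - p) k *
       (Gamma (2 * s + 2 * c + 2 * real k - (c + p + real k) - (c + s - p + real k))
         * rGamma (2 * s + 2 * c + 2 * real k - (c + p + real k)) * rGamma (2 * s + 2 * c + 2 * real k - (c + s - p + real k))))"
    using assms by (intro sums_mult gauss_real) simp
  moreover have "2 * s + 2 * c + 2 * real k - (c + p + real k) - (c + s - p + real k) = s"
    "2 * s + 2 * c + 2 * real k - (c + p + real k) = 2 * s + c - p + real k"
    "2 * s + 2 * c + 2 * real k - (c + s - p + real k) = s + c + p + real k" by simp_all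
  ultimately show ?thesis by (simp only: pochhammer_product' mult_ac times_divide_eq_right)
qed

text \<open>As p + (s-p) = s, the coefficients of Saalschuetz's expansion are free of p; for c >= 0
  and s > 0 they are nonnegative.\<close>

lemma newton_expansion:
  "pochhammer (c + p) n * pochhammer (c + s - p) n =
     (\<Sum>j\<le>n. real (n choose j) * pochhammer (c + s + real j) (n - j) * pochhammer c (n - j) * newton s j p)"
  using pochhammer_shift_product[of p c n "s - p"] by (simp add: algebra_simps)

lemma newton_pos: "0 < p \<Longrightarrow> p < s \<Longrightarrow> newton s j p > 0"
  by (simp add: pochhammer_pos)

text \<open>All terms are nonnegative for \<open>0 < p < s\<close>, which justifies the rearrangement into a
  Newton series; at \<open>p = - n\<close> that series terminates.\<close>

lemma newton_series:
  fixes \<alpha> :: "nat \<Rightarrow> real"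
  assumes s: "s > 0" and c: "c \<ge> 0" and \<alpha>: "\<And>k. \<alpha> k \<ge> 0" and p: "0 < p" "p < s"
    and summ: "summable (\<lambda>k. \<alpha> k * kern s c p k)"
  shows "\<exists>e. (\<lambda>j. e j * newton s j p) sums (\<Sum>k. \<alpha> k * kern s c p k)
     \<and> (\<forall>n. (\<lambda>k. \<alpha> k * kern s c (- real n) k) sums (\<Sum>j\<le>n. e j * newton s j (- real n)))"
proof -
  \<comment> \<open>The weight with which summand m of the Gauss expansion of term k contributes to
    \<open>newton s j p\<close>; it is free of p.\<close>
  define w where "w = (\<lambda>j (k, m). \<alpha> k * rGamma (2 * s + 2 * c + 2 * real k + real m) / fact m *
     (real ((k + m) choose j) * pochhammer (c + s + real j) (k + m - j) * pochhammer c (k + m - j)))"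
  have rG: "rGamma x \<ge> 0" if "x > 0" for x :: real
    using Gamma_real_pos[OF that] by (simp add: rGamma_inverse_Gamma)
  have pc: "pochhammer c n \<ge> 0" for n
    using c by (cases "c = 0") (auto simp: pochhammer_0_left intro!: pochhammer_nonneg)
  have w0: "w j i \<ge> 0" for j i
  proof (cases i)
    case (Pair k m)
    have "2 * s + 2 * c + 2 * real k + real m > 0" "c + s + real j > 0" using s c by auto
    then show ?thesis unfolding Pair w_def prod.case
      by (intro mult_nonneg_nonneg divide_nonneg_nonneg rG pochhammer_nonneg \<alpha> pc) auto
  qed
  have wz: "w j (k, m) = 0" if "j > k + m" for j k m using that by (simp add: w_def binomial_eq_0)
  define G where "G = (\<lambda>p (k, m). \<alpha> k * (pochhammer (c + p) (k + m) * pochhammer (c + s - p) (k + m)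
     * rGamma (2 * s + 2 * c + 2 * real k + real m) / fact m))"
  have Gw: "G p (k, m) = (\<Sum>j\<le>k+m. w j (k, m) * newton s j p)" for p k m
    unfolding G_def w_def newton_expansion prod.case sum_distrib_left sum_distrib_right sum_divide_distrib
    by (intro sum.cong refl) (simp add: mult_ac)
  have Gsum: "(\<lambda>m. G p (k, m)) sums (Gamma s * (\<alpha> k * kern s c p k))" for p k
    using sums_mult[OF kern_sums[OF s, of c p k], of "\<alpha> k"] by (simp add: G_def mult_ac)
  have np: "newton s j p > 0" for j by (rule newton_pos[OF p])
  have G0: "G p i \<ge> 0" for i
    by (cases i) (auto simp: Gw intro!: sum_nonneg mult_nonneg_nonneg w0 less_imp_le[OF newton_pos[OF p]])
  have Gs: "G p summable_on UNIV"
  proof -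
    have "G p summable_on Sigma UNIV (\<lambda>_. UNIV)"
    proof (rule summable_on_SigmaI)
      show "((\<lambda>m. G p (k, m)) has_sum (Gamma s * (\<alpha> k * kern s c p k))) UNIV" for k
        using Gsum G0 by (intro sums_nonneg_imp_has_sum)
      have "Gamma s * (\<alpha> k * kern s c p k) \<ge> 0" for k
        using Gsum G0 sums_le[of "\<lambda>_. 0" "\<lambda>m. G p (k, m)" 0] by auto
      then show "(\<lambda>k. Gamma s * (\<alpha> k * kern s c p k)) summable_on UNIV"
        using summ by (intro summable_nonneg_imp_summable_on summable_mult)
    qed (use G0 in auto)
    then show ?thesis by simp
  qed
  have wle: "w j i * newton s j p \<le> G p i" for i j
  proof (cases i)
    case (Pair k m)
    show ?thesis
    proof (cases "j \<le> k + m")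
      case True
      then show ?thesis unfolding Pair Gw
        by (intro member_le_sum) (auto intro!: mult_nonneg_nonneg w0 less_imp_le[OF np])
    next
      case False
      then show ?thesis using wz[of k m j] G0[of i] Pair by simp
    qed
  qed
  \<comment> \<open>Division by the positive number \<open>newton s j p\<close> transfers
    summability to the weights themselves, which makes them usable at \<open>- real n\<close>, where
    the signs alternate.\<close>
  have ws: "w j summable_on UNIV" for j
  proof -
    have "(\<lambda>i. w j i * newton s j p) summable_on UNIV"
      by (rule summable_on_comparison_test[OF Gs]) (use wle w0 np in \<open>auto intro!: mult_nonneg_nonneg less_imp_le[OF np]\<close>)
    then have "(\<lambda>i. inverse (newton s j p) * (w j i * newton s j p)) summable_on UNIV"
      by (rule summable_on_cmult_right)
    moreover have "inverse N * (x * N) = x" if "N > 0" for x N :: real using that by simp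
    ultimately show ?thesis using np[of j] by (simp only:)
  qed
  \<comment> \<open>Dividing by \<open>Gamma s\<close> undoes the factor that Gauss's theorem
    introduced.\<close>
  define e where "e = (\<lambda>j. infsum (w j) UNIV / Gamma s)"
  have Gp: "Gamma s > 0" using s by (rule Gamma_real_pos)
  have "(\<lambda>j. e j * newton s j p) sums (\<Sum>k. \<alpha> k * kern s c p k)"
  proof -
    define H where "H = (\<lambda>(i, j). w j i * newton s j p)"
    have Hrow: "((\<lambda>j. H (i, j)) has_sum G p i) UNIV" for i
    proof (cases i)
      case (Pair k m)
      show ?thesis
        by (rule has_sum_finite_neutralI[of "{..k+m}"]) (auto simp: H_def Pair Gw wz)
    qed
    have Hs: "H summable_on Sigma UNIV (\<lambda>_. UNIV)"
      using Hrow Gs by (rule summable_on_SigmaI) (auto simp: H_def intro!: mult_nonneg_nonneg w0 less_imp_le[OF np])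
    have "(H has_sum infsum (G p) UNIV) (UNIV \<times> UNIV)"
      using Hrow has_sum_infsum[OF Gs] Hs by (rule has_sum_SigmaI)
    then have "((\<lambda>(j, i). H (i, j)) has_sum infsum (G p) UNIV) (UNIV \<times> UNIV)"
      by (subst (asm) has_sum_swap)
    then have "((\<lambda>j. Gamma s * (e j * newton s j p)) has_sum infsum (G p) UNIV) UNIV"
    proof (rule has_sum_SigmaD)
      fix j
      have "((\<lambda>i. w j i * newton s j p) has_sum infsum (w j) UNIV * newton s j p) UNIV"
        by (intro has_sum_cmult_left has_sum_infsum ws)
      then show "((\<lambda>i. case (j, i) of (j, i) \<Rightarrow> H (i, j)) has_sum Gamma s * (e j * newton s j p)) UNIV"
        using Gp by (simp add: H_def e_def)
    qed
    then have "(\<lambda>j. Gamma s * (e j * newton s j p)) sums infsum (G p) UNIV" by (rule has_sum_imp_sums)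
    moreover have "(\<lambda>k. Gamma s * (\<alpha> k * kern s c p k)) sums infsum (G p) UNIV"
      by (rule sums_of_double_summable[OF Gs Gsum])
    then have "infsum (G p) UNIV = Gamma s * (\<Sum>k. \<alpha> k * kern s c p k)"
      by (rule sums_unique2) (intro sums_mult summable_sums summ)
    ultimately show ?thesis using Gp by (simp add: sums_mult_iff)
  qed
  \<comment> \<open>At a node only j <= n survive, whatever k and m, so the interchange concerns
    finitely many summable families.\<close>
  moreover have "(\<lambda>k. \<alpha> k * kern s c (- real n) k) sums (\<Sum>j\<le>n. e j * newton s j (- real n))" for n
  proof -
    have Gn: "G (- real n) i = (\<Sum>j\<le>n. w j i * newton s j (- real n))" for i
    proof (cases i)
      case (Pair k m)
      have "(\<Sum>j\<le>k+m. w j (k, m) * newton s j (- real n)) = (\<Sum>j\<le>max n (k+m). w j (k, m) * newton s j (- real n))"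
        by (intro sum.mono_neutral_left) (auto simp: wz)
      also have "\<dots> = (\<Sum>j\<le>n. w j (k, m) * newton s j (- real n))"
        by (intro sum.mono_neutral_right) (auto simp: pochhammer_of_nat_eq_0_iff)
      finally show ?thesis unfolding Pair Gw .
    qed
    have "((\<lambda>i. \<Sum>j\<le>n. w j i * newton s j (- real n)) has_sum (\<Sum>j\<le>n. infsum (w j) UNIV * newton s j (- real n))) UNIV"
      by (intro has_sum_finite_sum has_sum_cmult_left has_sum_infsum ws) auto
    then have hs: "(G (- real n) has_sum (\<Sum>j\<le>n. infsum (w j) UNIV * newton s j (- real n))) UNIV"
      by (simp add: Gn[abs_def])
    have "(\<lambda>k. Gamma s * (\<alpha> k * kern s c (- real n) k)) sums infsum (G (- real n)) UNIV"
      using hs by (intro sums_of_double_summable Gsum) (auto simp: summable_on_def)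
    also have "infsum (G (- real n)) UNIV = (\<Sum>j\<le>n. infsum (w j) UNIV * newton s j (- real n))"
      using hs by (rule infsumI)
    also have "\<dots> = Gamma s * (\<Sum>j\<le>n. e j * newton s j (- real n))"
      using Gp by (simp add: e_def sum_distrib_left)
    finally show ?thesis using Gp by (simp add: sums_mult_iff)
  qed
  ultimately show ?thesis by blast
qed

text \<open>The node values form a triangular system with diagonal entries
  \<open>newton s n (- real n)\<close>, nonzero for s > 0, so equality at all nodes forces
  \<open>K * e n = f n\<close>. In the application \<open>K\<close> is the Gamma factor in front of
  the three-parameter series.\<close>

lemma newton_series_unique:
  assumes s: "s > 0" and p: "0 < p" "p < s"
    and "c \<ge> 0" "\<And>k. \<alpha> k \<ge> 0" "summable (\<lambda>k. \<alpha> k * kern s c p k)"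
    and "d \<ge> 0" "\<And>k. \<beta> k \<ge> 0" "summable (\<lambda>k. \<beta> k * kern s d p k)"
    and eq: "\<And>n. K * (\<Sum>k. \<alpha> k * kern s c (- real n) k) = (\<Sum>k. \<beta> k * kern s d (- real n) k)"
  shows "K * (\<Sum>k. \<alpha> k * kern s c p k) = (\<Sum>k. \<beta> k * kern s d p k)"
proof -
  obtain e where e: "(\<lambda>j. e j * newton s j p) sums (\<Sum>k. \<alpha> k * kern s c p k)"
      "\<And>n. (\<lambda>k. \<alpha> k * kern s c (- real n) k) sums (\<Sum>j\<le>n. e j * newton s j (- real n))"
    using newton_series[OF s assms(4,5) p assms(6)] by blast
  obtain f where f: "(\<lambda>j. f j * newton s j p) sums (\<Sum>k. \<beta> k * kern s d p k)"
      "\<And>n. (\<lambda>k. \<beta> k * kern s d (- real n) k) sums (\<Sum>j\<le>n. f j * newton s j (- real n))"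
    using newton_series[OF s assms(7,8) p assms(9)] by blast
  have "K * e n = f n" for n
  proof (induction n rule: less_induct)
    case (less n)
    have "K * (\<Sum>j\<le>n. e j * newton s j (- real n)) = (\<Sum>j\<le>n. f j * newton s j (- real n))"
      using eq[of n] sums_unique[OF e(2)] sums_unique[OF f(2)] by simp
    moreover have "(\<Sum>j\<le>n. g j * newton s j (- real n)) = (\<Sum>j<n. g j * newton s j (- real n)) + g n * newton s n (- real n)" for g
      by (simp add: lessThan_Suc_atMost [symmetric])
    moreover have "(\<Sum>j<n. f j * newton s j (- real n)) = K * (\<Sum>j<n. e j * newton s j (- real n))"
      unfolding sum_distrib_left using less by (intro sum.cong) auto
    ultimately have "K * (e n * newton s n (- real n)) = f n * newton s n (- real n)"
      by (simp add: algebra_simps)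
    moreover have "newton s n (- real n) \<noteq> 0"
      using s pochhammer_pos[of "s + real n" n] by (simp add: pochhammer_of_nat_eq_0_iff)
    ultimately show ?case by simp
  qed
  then have "(\<lambda>j. K * (e j * newton s j p)) = (\<lambda>j. f j * newton s j p)" by (simp add: fun_eq_iff)
  then have "(\<lambda>j. f j * newton s j p) sums (K * (\<Sum>k. \<alpha> k * kern s c p k))"
    using sums_mult[OF e(1), of K] by simp
  then show ?thesis using f(1) sums_unique2 by blast
qed

section \<open>The identity for real parameters and its continuation\<close>

abbreviation lhs_series :: "'a::Gamma \<Rightarrow> 'a \<Rightarrow> 'a \<Rightarrow> 'a" where
  "lhs_series s r p \<equiv> reg_hyp [2 * r, r + p, r + s - p] [s + r + p, 2 * s + r - p]"

abbreviation rhs_series :: "'a::Gamma \<Rightarrow> 'a \<Rightarrow> 'a \<Rightarrow> 'a" where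
  "rhs_series s r p \<equiv> reg_hyp [2 * s - 1, p, s - p, r, s - r] [s + p, 2 * s - p, s + r, 2 * s - r]"

lemma rGamma_shift_pochhammer:
  fixes w :: "'a::Gamma"
  assumes "w + of_nat n = v"
  shows "rGamma w = pochhammer w n * rGamma v"
  using pochhammer_rGamma[of w n] assms by simp

lemma pochhammer_minus_of_nat_div_fact:
  "pochhammer (- of_nat n :: 'a::field_char_0) k / fact k = (-1) ^ k * of_nat (n choose k)"
  by (simp add: binomial_gbinomial gbinomial_pochhammer)

text \<open>At p = -n the upper parameter r+s+n exceeds the lower one r+s-n by 2n, so their quotient
  is a polynomial in k of degree 2n. Chu-Vandermonde expands it so that each piece merely changes
  the other lower parameter to 2s+r-n+m, and Gauss's theorem sums each piece over k.\<close>

lemma lhs_series_terminating: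
  fixes s r :: real
  assumes "r < s"
  shows "lhs_series s r (- real n) = rGamma (r + s + n) * (\<Sum>m\<le>2*n. real ((2 * n) choose m) * (-1) ^ m * pochhammer s m *
      (Gamma (2 * (s - r) + real m) * rGamma (s + (s - r) - real n + real m) * rGamma (2 * s + real m)))"
proof -
  define b where "b = r + s + n"
  define c where "c = (\<lambda>m. real ((2 * n) choose m) * (-1) ^ m * pochhammer s m)"
  define z where "z = (\<lambda>m. 2 * s + r - real n + real m)"
  have term_eq: "reg_term [2 * r, r + (- real n), r + s - (- real n)] [s + r + (- real n), 2 * s + r - (- real n)] k
     = rGamma b * (\<Sum>m\<le>2*n. c m * (pochhammer (2 * r) k * pochhammer (r - real n) k * rGamma (z m + real k) / fact k))" for k
  proof -
    have A: "rGamma b = pochhammer b k * rGamma (b + real k)"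
      by (rule rGamma_shift_pochhammer) simp
    have B: "rGamma (s + r + (- real n) + real k) = pochhammer (s + r - real n + real k) (2 * n) * rGamma (b + real k)"
      using rGamma_shift_pochhammer[of "s + r - real n + real k" "2 * n" "b + real k"] by (simp add: b_def)
    have C: "pochhammer (s + r - real n + real k) (2 * n) =
       (\<Sum>m\<le>2*n. c m * pochhammer (2 * s + r - real n + real k + real m) (2 * n - m))"
      using pochhammer_diff_expansion[of "2 * n" s "2 * s + r - real n + real k"]
      by (simp add: c_def algebra_simps)
    have D: "rGamma (z m + real k) = pochhammer (2 * s + r - real n + real k + real m) (2 * n - m) * rGamma (2 * s + r - (- real n) + real k)"
      if "m \<le> 2 * n" for m
      using rGamma_shift_pochhammer[of "2 * s + r - real n + real k + real m" "2 * n - m" "2 * s + r - (- real n) + real k"] that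
      by (simp add: z_def of_nat_diff add_ac)
    have "reg_term [2 * r, r + (- real n), r + s - (- real n)] [s + r + (- real n), 2 * s + r - (- real n)] k
      = (pochhammer b k * rGamma (b + real k)) * (pochhammer (2 * r) k * pochhammer (r - real n) k / fact k) *
         (pochhammer (s + r - real n + real k) (2 * n) * rGamma (2 * s + r - (- real n) + real k))"
      unfolding reg_term_def list.map prod_list.Cons prod_list.Nil B
      by (simp add: b_def add_ac)
    also have "\<dots> = rGamma b * (\<Sum>m\<le>2*n. c m * (pochhammer (2 * r) k * pochhammer (r - real n) k *
         (pochhammer (2 * s + r - real n + real k + real m) (2 * n - m) * rGamma (2 * s + r - (- real n) + real k)) / fact k))"
      unfolding A [symmetric] C sum_distrib_left sum_distrib_right by (intro sum.cong refl) (simp add: mult_ac)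
    also have "\<dots> = rGamma b * (\<Sum>m\<le>2*n. c m * (pochhammer (2 * r) k * pochhammer (r - real n) k * rGamma (z m + real k) / fact k))"
      by (intro arg_cong2[where f = "(*)"] sum.cong refl) (simp only: D atMost_iff)
    finally show ?thesis .
  qed
  have "(\<lambda>k. rGamma b * (\<Sum>m\<le>2*n. c m * (pochhammer (2 * r) k * pochhammer (r - real n) k * rGamma (z m + real k) / fact k)))
    sums (rGamma b * (\<Sum>m\<le>2*n. c m * (Gamma (z m - 2 * r - (r - real n)) * rGamma (z m - 2 * r) * rGamma (z m - (r - real n)))))"
    using assms by (intro sums_mult sums_sum gauss_real) (simp add: z_def)
  then have "lhs_series s r (- real n) = rGamma b * (\<Sum>m\<le>2*n. c m * (Gamma (z m - 2 * r - (r - real n)) * rGamma (z m - 2 * r) * rGamma (z m - (r - real n))))"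
    unfolding reg_hyp_def term_eq by (rule sums_unique [symmetric])
  also have "\<dots> = rGamma b * (\<Sum>m\<le>2*n. c m * (Gamma (2 * (s - r) + real m) * rGamma (s + (s - r) - real n + real m) * rGamma (2 * s + real m)))"
    by (simp add: z_def algebra_simps)
  finally show ?thesis unfolding b_def c_def .
qed

lemma series_identity_terminating:
  fixes s r :: real
  assumes s: "s > 1/2" and r: "0 < r" "r < s"
  shows "rGamma s * rGamma (2 * (s - r)) * lhs_series s r (- real n) = rhs_series s r (- real n)"
proof -
  define x where "x = s - r"
  have xr: "x + r = s" by (simp add: x_def)
  have nz: "pochhammer (2 * s) k \<noteq> 0" for k using pochhammer_pos[of "2 * s" k] s by simp
  \<comment> \<open>Every reciprocal Gamma factor is pushed to its largest shift. The two sides then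
    become \<open>Q\<close> times the two sides of the terminating identity for x = s-r and x' =
    r.\<close>
  define Q where "Q = rGamma s * rGamma (2 * s + 2 * real n) * rGamma (s + r + real n) * rGamma (s + x + real n)"
  have "rGamma s * rGamma (2 * x) * lhs_series s r (- real n) =
     (\<Sum>m\<le>2*n. Q * (pochhammer (2 * s) (2 * n) * ((-1) ^ m * real ((2 * n) choose m) * (pochhammer (2 * x) m * pochhammer s m / pochhammer (2 * s) m)
            * pochhammer (s + x - real n + real m) (2 * n - m))))"
    unfolding lhs_series_terminating[OF r(2)] x_def [symmetric] sum_distrib_left
  proof (intro sum.cong refl)
    fix m assume "m \<in> {..2*n}"
    then have m: "m \<le> 2 * n" by simp
    have 1: "rGamma (2 * x) * Gamma (2 * x + real m) = pochhammer (2 * x) m"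
    proof -
      have "2 * x \<notin> \<int>\<^sub>\<le>\<^sub>0" "2 * x + real m \<notin> \<int>\<^sub>\<le>\<^sub>0" using r(2) by (auto simp: x_def elim!: nonpos_Ints_cases)
      then have "rGamma (2 * x + real m) \<noteq> 0" by (simp add: rGamma_eq_zero_iff)
      then show ?thesis using pochhammer_rGamma[of "2 * x" m] by (simp add: Gamma_def)
    qed
    have 2: "rGamma (s + x - real n + real m) = pochhammer (s + x - real n + real m) (2 * n - m) * rGamma (s + x + real n)"
      using m by (intro rGamma_shift_pochhammer) (simp add: of_nat_diff)
    have 3: "rGamma (2 * s + real m) = pochhammer (2 * s) (2 * n) * rGamma (2 * s + 2 * real n) / pochhammer (2 * s) m"
    proof -
      have "rGamma (2 * s) = pochhammer (2 * s) (2 * n) * rGamma (2 * s + 2 * real n)"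
        by (rule rGamma_shift_pochhammer) simp
      moreover have "rGamma (2 * s) = pochhammer (2 * s) m * rGamma (2 * s + real m)"
        by (rule rGamma_shift_pochhammer) simp
      ultimately show ?thesis using nz[of m] by (simp add: field_simps)
    qed
    have "rGamma s * rGamma (2 * x) * (rGamma (r + s + real n) * (real ((2 * n) choose m) * (-1) ^ m * pochhammer s m *
        (Gamma (2 * x + real m) * rGamma (s + x - real n + real m) * rGamma (2 * s + real m))))
      = rGamma s * rGamma (r + s + real n) * real ((2 * n) choose m) * (-1) ^ m * pochhammer s m *
        (rGamma (2 * x) * Gamma (2 * x + real m)) * rGamma (s + x - real n + real m) * rGamma (2 * s + real m)"
      by (simp only: mult_ac)
    also have "\<dots> = Q * (pochhammer (2 * s) (2 * n) * ((-1) ^ m * real ((2 * n) choose m) * (pochhammer (2 * x) m * pochhammer s m / pochhammer (2 * s) m)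
            * pochhammer (s + x - real n + real m) (2 * n - m)))"
      unfolding 1 2 3 Q_def by (simp add: add.commute mult_ac)
    finally show "rGamma s * rGamma (2 * x) * (rGamma (r + s + real n) * (real ((2 * n) choose m) * (-1) ^ m * pochhammer s m *
        (Gamma (2 * x + real m) * rGamma (s + x - real n + real m) * rGamma (2 * s + real m)))) = \<dots>" .
  qed
  also have "\<dots> = Q * (pochhammer (2 * s) (2 * n) * (\<Sum>m\<le>2*n. (-1) ^ m * real ((2 * n) choose m) * (pochhammer (2 * x) m * pochhammer s m / pochhammer (2 * s) m)
            * pochhammer (s + x - real n + real m) (2 * n - m)))"
    by (simp only: sum_distrib_left)
  also have "\<dots> = Q * (\<Sum>k\<le>n. pochhammer (2 * s - 1) k * ((-1) ^ k * real (n choose k)) * pochhammer (s + real n) k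
        * pochhammer x k * pochhammer r k
        * pochhammer (s - real n + real k) (n - k) * pochhammer (2 * s + real (n + k)) (n - k)
        * (pochhammer (s + x + real k) (n - k) * pochhammer (s + r + real k) (n - k)))"
    unfolding well_poised_terminating[OF xr nz] ..
  also have "\<dots> = (\<Sum>k\<le>n. reg_term [2 * s - 1, - real n, s - (- real n), r, x] [s + (- real n), 2 * s - (- real n), s + r, s + x] k)"
    unfolding sum_distrib_left
  proof (intro sum.cong refl)
    fix k assume "k \<in> {..n}"
    then have k: "k \<le> n" by simp
    have 1: "pochhammer (- real n) k / fact k = (-1) ^ k * real (n choose k)"
      by (rule pochhammer_minus_of_nat_div_fact)
    have 2: "rGamma (s + - real n + real k) = pochhammer (s - real n + real k) (n - k) * rGamma s"
      "rGamma (2 * s - - real n + real k) = pochhammer (2 * s + real (n + k)) (n - k) * rGamma (2 * s + 2 * real n)"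
      "rGamma (s + r + real k) = pochhammer (s + r + real k) (n - k) * rGamma (s + r + real n)"
      "rGamma (s + x + real k) = pochhammer (s + x + real k) (n - k) * rGamma (s + x + real n)"
      using k rGamma_shift_pochhammer[of "s - real n + real k" "n - k" s]
        rGamma_shift_pochhammer[of "2 * s + real (n + k)" "n - k" "2 * s + 2 * real n"]
        rGamma_shift_pochhammer[of "s + r + real k" "n - k" "s + r + real n"]
        rGamma_shift_pochhammer[of "s + x + real k" "n - k" "s + x + real n"]
      by (simp_all add: of_nat_diff add_ac)
    have "reg_term [2 * s - 1, - real n, s - (- real n), r, x] [s + (- real n), 2 * s - (- real n), s + r, s + x] k
       = pochhammer (2 * s - 1) k * (pochhammer (- real n) k / fact k) * pochhammer (s + real n) k * pochhammer r k * pochhammer x k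
         * (rGamma (s + - real n + real k) * rGamma (2 * s - - real n + real k) * rGamma (s + r + real k) * rGamma (s + x + real k))"
      by (simp add: reg_term_def mult_ac)
    then show "Q * (pochhammer (2 * s - 1) k * ((-1) ^ k * real (n choose k)) * pochhammer (s + real n) k
        * pochhammer x k * pochhammer r k
        * pochhammer (s - real n + real k) (n - k) * pochhammer (2 * s + real (n + k)) (n - k)
        * (pochhammer (s + x + real k) (n - k) * pochhammer (s + r + real k) (n - k))) =
      reg_term [2 * s - 1, - real n, s - (- real n), r, x] [s + (- real n), 2 * s - (- real n), s + r, s + x] k"
      unfolding 1 2 Q_def by (simp only: mult_ac)
  qed
  also have "\<dots> = rhs_series s r (- real n)"
  proof -
    have "s + x = 2 * s - r" by (simp add: x_def)
    then show ?thesis by (subst reg_hyp_terminating[of n]) (simp_all add: x_def)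
  qed
  finally show ?thesis unfolding x_def .
qed

lemma series_identity_real:
  fixes s r p :: real
  assumes s: "s > 1/2" and r: "0 < r" "r < s" and p: "0 < p" "p < s"
  shows "rGamma s * rGamma (2 * (s - r)) * lhs_series s r p = rhs_series s r p"
proof -
  \<comment> \<open>The factors free of p; positivity of 2r, r, s-r and 2s-1 makes both sequences
    nonnegative.\<close>
  define \<alpha> where "\<alpha> = (\<lambda>k. pochhammer (2 * r) k / fact k)"
  define \<beta> where "\<beta> = (\<lambda>k. pochhammer (2 * s - 1) k * pochhammer r k * pochhammer (s - r) k
      * rGamma (s + r + real k) * rGamma (2 * s - r + real k) / fact k)"
  have L: "reg_term [2 * r, r + p, r + s - p] [s + r + p, 2 * s + r - p] = (\<lambda>k. \<alpha> k * kern s r p k)" for p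
    by (auto simp: fun_eq_iff reg_term_def \<alpha>_def)
  have R: "reg_term [2 * s - 1, p, s - p, r, s - r] [s + p, 2 * s - p, s + r, 2 * s - r] = (\<lambda>k. \<beta> k * kern s 0 p k)" for p
    by (auto simp: fun_eq_iff reg_term_def \<beta>_def)
  have rG: "rGamma x \<ge> 0" if "x > 0" for x :: real
    using Gamma_real_pos[OF that] by (simp add: rGamma_inverse_Gamma)
  have "rGamma s * rGamma (2 * (s - r)) * (\<Sum>k. \<alpha> k * kern s r p k) = (\<Sum>k. \<beta> k * kern s 0 p k)"
  proof (rule newton_series_unique)
    show "\<alpha> k \<ge> 0" for k using r by (simp add: \<alpha>_def pochhammer_nonneg)
    show "\<beta> k \<ge> 0" for k
    proof -
      have "s + r + real k > 0" "2 * s - r + real k > 0" using s r by auto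
      then show ?thesis unfolding \<beta>_def using s r
        by (intro mult_nonneg_nonneg divide_nonneg_nonneg rG pochhammer_nonneg) auto
    qed
    show "summable (\<lambda>k. \<alpha> k * kern s r p k)" unfolding L [symmetric]
      using r by (intro sums_summable[OF reg_hyp_of_real_sums(1)]) auto
    show "summable (\<lambda>k. \<beta> k * kern s 0 p k)" unfolding R [symmetric]
      using s by (intro sums_summable[OF reg_hyp_of_real_sums(1)]) auto
    show "rGamma s * rGamma (2 * (s - r)) * (\<Sum>k. \<alpha> k * kern s r (- real n) k) = (\<Sum>k. \<beta> k * kern s 0 (- real n) k)" for n
      using series_identity_terminating[OF s r, of n] unfolding reg_hyp_def L R .
  qed (use s r p in auto)
  then show ?thesis unfolding reg_hyp_def L R .
qed

section \<open>Analytic continuation to complex parameters\<close>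

definition defect :: "complex \<Rightarrow> complex \<Rightarrow> complex \<Rightarrow> complex" where
  "defect s r p = rGamma s * rGamma (2 * (s - r)) * lhs_series s r p - rhs_series s r p"

lemma defect_real:
  fixes s r p :: real
  assumes "s > 1/2" "0 < r" "r < s" "0 < p" "p < s"
  shows "defect (of_real s) (of_real r) (of_real p) = 0"
proof -
  have L: "lhs_series (complex_of_real s) (of_real r) (of_real p) = of_real (lhs_series s r p)"
    using assms reg_hyp_of_real_sums(2)[of "[2 * r, r + p, r + s - p]" "[s + r + p, 2 * s + r - p]"] by simp
  have R: "rhs_series (complex_of_real s) (of_real r) (of_real p) = of_real (rhs_series s r p)"
    using assms reg_hyp_of_real_sums(2)[of "[2 * s - 1, p, s - p, r, s - r]" "[s + p, 2 * s - p, s + r, 2 * s - r]"] by simp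
  have "2 * (complex_of_real s - of_real r) = of_real (2 * (s - r))" by simp
  then show ?thesis unfolding defect_def L R series_identity_real[OF assms, symmetric]
    by (simp only: rGamma_complex_of_real) simp
qed

text \<open>The reflection p -> s-p permutes the parameters within each series. It reduces
  termination through s-p or r+s-p to termination through p or r+p.\<close>

lemma defect_symmetric: "defect s r (s - p) = defect s r p"
proof -
  have 1: "s + r + (s - p) = 2 * s + r - p" "2 * s + r - (s - p) = s + r + p" "s + (s - p) = 2 * s - p" "2 * s - (s - p) = s + p"
    "r + (s - p) = r + s - p" "r + s - (s - p) = r + p" "s - (s - p) = p"
    by (simp_all add: algebra_simps)
  show ?thesis unfolding defect_def reg_hyp_def reg_term_def[abs_def] 1 by (simp add: mult_ac)
qed

text \<open>The excess of this series is 2(Re s - Re r), whence the first alternative; the others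
  hold one upper parameter at the same -n throughout \<open>S\<close>.\<close>

lemma holomorphic_on_lhs_series:
  assumes S: "open S" and hol: "s holomorphic_on S" "r holomorphic_on S" "p holomorphic_on S"
    and cond: "(\<forall>w\<in>S. Re (r w) < Re (s w)) \<or>
      (\<exists>n. (\<forall>w\<in>S. 2 * r w = - of_nat n) \<or> (\<forall>w\<in>S. r w + p w = - of_nat n) \<or> (\<forall>w\<in>S. r w + s w - p w = - of_nat n))"
  shows "(\<lambda>w. lhs_series (s w) (r w) (p w)) holomorphic_on S"
proof -
  define as where "as = [\<lambda>w. 2 * r w, \<lambda>w. r w + p w, \<lambda>w. r w + s w - p w]"
  define bs where "bs = [\<lambda>w. s w + r w + p w, \<lambda>w. 2 * s w + r w - p w]"
  have h: "f holomorphic_on S" if "f \<in> set as \<union> set bs" for f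
    using that hol by (auto simp: as_def bs_def intro!: holomorphic_intros)
  have "(\<lambda>w. reg_hyp (map (\<lambda>f. f w) as) (map (\<lambda>f. f w) bs)) holomorphic_on S"
  proof (cases "\<forall>w\<in>S. Re (r w) < Re (s w)")
    case True
    then show ?thesis using h by (intro holomorphic_on_reg_hyp[OF S]) (auto simp: as_def bs_def)
  next
    case False
    then obtain n f where f: "f \<in> set as" "\<forall>w\<in>S. f w = - of_nat n"
      using cond by (auto simp: as_def)
    show ?thesis
      by (rule holomorphic_on_reg_hyp_terminating[where ?f0.0 = f and n = n]) (use f h in auto)
  qed
  then show ?thesis by (simp add: as_def bs_def)
qed

text \<open>Here the excess is 2 Re s + 1.\<close>

lemma holomorphic_on_rhs_series:
  assumes S: "open S" and hol: "s holomorphic_on S" "r holomorphic_on S" "p holomorphic_on S"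
    and cond: "(\<forall>w\<in>S. Re (s w) > - 1/2) \<or> (\<exists>n. (\<forall>w\<in>S. p w = - of_nat n) \<or> (\<forall>w\<in>S. r w = - of_nat n))"
  shows "(\<lambda>w. rhs_series (s w) (r w) (p w)) holomorphic_on S"
proof -
  define as where "as = [\<lambda>w. 2 * s w - 1, p, \<lambda>w. s w - p w, r, \<lambda>w. s w - r w]"
  define bs where "bs = [\<lambda>w. s w + p w, \<lambda>w. 2 * s w - p w, \<lambda>w. s w + r w, \<lambda>w. 2 * s w - r w]"
  have h: "f holomorphic_on S" if "f \<in> set as \<union> set bs" for f
    using that hol by (auto simp: as_def bs_def intro!: holomorphic_intros)
  have "(\<lambda>w. reg_hyp (map (\<lambda>f. f w) as) (map (\<lambda>f. f w) bs)) holomorphic_on S"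
  proof (cases "\<forall>w\<in>S. Re (s w) > - 1/2")
    case True
    then show ?thesis using h by (intro holomorphic_on_reg_hyp[OF S]) (auto simp: as_def bs_def)
  next
    case False
    then obtain n f where f: "f \<in> set as" "\<forall>w\<in>S. f w = - of_nat n"
      using cond by (auto simp: as_def)
    show ?thesis
      by (rule holomorphic_on_reg_hyp_terminating[where ?f0.0 = f and n = n]) (use f h in auto)
  qed
  then show ?thesis by (simp add: as_def bs_def)
qed

text \<open>The image of the interval is connected and not a single point, hence perfect, so its
  midpoint is a limit point of zeros. Convexity of \<open>S\<close> supplies the connectedness for
  the identity theorem.\<close>

lemma analytic_continuation_real_interval:
  assumes f: "f holomorphic_on S" and S: "open S" "convex S"
    and ab: "a < b" "\<And>t. a < t \<Longrightarrow> t < b \<Longrightarrow> complex_of_real t \<in> S \<and> f (of_real t) = 0"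
    and w: "w \<in> S"
  shows "f w = 0"
proof (rule analytic_continuation[OF f S(1) convex_connected[OF S(2)], where U = "of_real ` {a<..<b}" and \<xi> = "of_real ((a + b) / 2)"])
  have "connected (complex_of_real ` {a<..<b})"
    by (intro connected_continuous_image continuous_intros) auto
  moreover have m: "(a + b) / 2 \<in> {a<..<b}" "(2 * a + b) / 3 \<in> {a<..<b}" "(a + b) / 2 \<noteq> (2 * a + b) / 3"
    using ab(1) by (auto simp: field_simps)
  moreover have "complex_of_real ` {a<..<b} \<noteq> {x}" for x
  proof
    assume "complex_of_real ` {a<..<b} = {x}"
    then have "complex_of_real ((a + b) / 2) = x" "complex_of_real ((2 * a + b) / 3) = x"
      using m(1,2) by blast+
    then show False using m(3) of_real_eq_iff by metis
  qed
  ultimately show "complex_of_real ((a + b) / 2) islimpt of_real ` {a<..<b}"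
    by (intro connected_imp_perfect imageI) auto
  show "complex_of_real ((a + b) / 2) \<in> S"
    using ab(2) m(1) unfolding greaterThanLessThan_iff by blast
qed (use ab w in auto)

lemma defect_continuation:
  assumes S: "open S" "convex S" and hol: "s holomorphic_on S" "r holomorphic_on S" "p holomorphic_on S"
    and condL: "(\<forall>w\<in>S. Re (r w) < Re (s w)) \<or>
      (\<exists>n. (\<forall>w\<in>S. 2 * r w = - of_nat n) \<or> (\<forall>w\<in>S. r w + p w = - of_nat n) \<or> (\<forall>w\<in>S. r w + s w - p w = - of_nat n))"
    and condR: "(\<forall>w\<in>S. Re (s w) > - 1/2) \<or> (\<exists>n. (\<forall>w\<in>S. p w = - of_nat n) \<or> (\<forall>w\<in>S. r w = - of_nat n))"
    and ab: "a < b" "\<And>t. a < t \<Longrightarrow> t < b \<Longrightarrow> complex_of_real t \<in> S \<and> defect (s (of_real t)) (r (of_real t)) (p (of_real t)) = 0"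
    and w: "w \<in> S"
  shows "defect (s w) (r w) (p w) = 0"
proof (rule analytic_continuation_real_interval[OF _ S ab w])
  show "(\<lambda>w. defect (s w) (r w) (p w)) holomorphic_on S"
    unfolding defect_def
    by (intro holomorphic_intros holomorphic_on_lhs_series holomorphic_on_rhs_series S hol condL condR)
qed

text \<open>Neither excess involves p, so p is freed on the whole plane for real s and r. For real s
  the variable r then fills a half-plane, and finally s fills Re s > max(Re r, -1/2), whose real
  points beyond 1/2 are already covered.\<close>

lemma defect_zero:
  assumes "Re r < Re s" "Re s > - 1/2"
  shows "defect s r p = 0"
proof -
  have 1: "defect (of_real s) (of_real r) p = 0" if "s > 1/2" "0 < r" "r < s" for s r p
  proof (rule defect_continuation[where S = UNIV and s = "\<lambda>_. of_real s" and r = "\<lambda>_. of_real r" and p = "\<lambda>w. w" and a = 0 and b = s])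
    show "complex_of_real t \<in> UNIV \<and> defect (of_real s) (of_real r) (of_real t) = 0" if "0 < t" "t < s" for t
      using \<open>s > 1/2\<close> \<open>0 < r\<close> \<open>r < s\<close> that by (auto intro: defect_real)
  qed (use that in \<open>auto intro!: holomorphic_intros\<close>)
  have 2: "defect (of_real s) r p = 0" if "s > 1/2" "Re r < s" for s r p
  proof (rule defect_continuation[where S = "{w. Re w < s}" and s = "\<lambda>_. of_real s" and r = "\<lambda>w. w" and p = "\<lambda>_. p" and a = 0 and b = s])
    show "complex_of_real t \<in> {w. Re w < s} \<and> defect (of_real s) (of_real t) p = 0" if "0 < t" "t < s" for t
      using \<open>s > 1/2\<close> that by (auto intro: 1)
  qed (use that in \<open>auto intro!: holomorphic_intros open_halfspace_Re_lt convex_halfspace_Re_lt\<close>)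
  define m where "m = max (Re r) (- 1/2)"
  show ?thesis
  proof (rule defect_continuation[where S = "{w. Re w > m}" and s = "\<lambda>w. w" and r = "\<lambda>_. r" and p = "\<lambda>_. p" and a = "max m (1/2)" and b = "max m (1/2) + 1"])
    show "complex_of_real t \<in> {w. Re w > m} \<and> defect (of_real t) r p = 0" if "max m (1/2) < t" "t < max m (1/2) + 1" for t
      using that by (auto simp: m_def intro: 2)
    show "open {w. m < Re w}" "convex {w. m < Re w}"
      by (rule open_halfspace_Re_gt, rule convex_halfspace_Re_gt)
  qed (use assms in \<open>auto simp: m_def intro!: holomorphic_intros\<close>)
qed

text \<open>Outside the common half-plane of convergence one of the two series terminates; then the identity
  is continued along a line on which the terminating parameters stay fixed.\<close>

lemma defect_zero_r_nonpos: "defect s (- of_nat m) p = 0"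
proof (rule defect_continuation[where S = UNIV and s = "\<lambda>w. w" and r = "\<lambda>_. - of_nat m" and p = "\<lambda>_. p" and a = 0 and b = 1])
  show "(\<forall>w\<in>UNIV. Re (- of_nat m) < Re w) \<or>
      (\<exists>n. (\<forall>w\<in>UNIV. 2 * (- of_nat m :: complex) = - of_nat n) \<or> (\<forall>w\<in>UNIV. - of_nat m + p = - of_nat n) \<or> (\<forall>w\<in>UNIV. - of_nat m + w - p = - of_nat n))"
    by (rule disjI2, rule exI[of _ "2 * m"]) simp
qed (auto intro!: holomorphic_intros defect_zero)

lemma defect_zero_p_nonpos:
  assumes "Re r < Re s \<or> (\<exists>n. 2 * r = - of_nat n \<or> r - of_nat m = - of_nat n \<or> r + s + of_nat m = - of_nat n)"
  shows "defect s r (- of_nat m) = 0"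
  using assms
proof (elim disjE exE)
  assume *: "Re r < Re s"
  show ?thesis
    by (rule defect_continuation[where S = "{w. Re w > Re r}" and s = "\<lambda>w. w" and r = "\<lambda>_. r" and p = "\<lambda>_. - of_nat m" and a = "max (Re r) 0" and b = "max (Re r) 0 + 1"])
      (use * in \<open>auto intro!: holomorphic_intros defect_zero open_halfspace_Re_gt convex_halfspace_Re_gt\<close>)
next
  fix n assume *: "2 * r = - of_nat n"
  show ?thesis
    by (rule defect_continuation[where S = UNIV and s = "\<lambda>w. w" and r = "\<lambda>_. r" and p = "\<lambda>_. - of_nat m" and a = "max (Re r) 0" and b = "max (Re r) 0 + 1"])
      (use * in \<open>auto intro!: holomorphic_intros defect_zero\<close>)
next
  fix n assume *: "r - of_nat m = - of_nat n"
  show ?thesis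
    by (rule defect_continuation[where S = UNIV and s = "\<lambda>w. w" and r = "\<lambda>_. r" and p = "\<lambda>_. - of_nat m" and a = "max (Re r) 0" and b = "max (Re r) 0 + 1"])
      (use * in \<open>auto intro!: holomorphic_intros defect_zero\<close>)
next
  fix n assume *: "r + s + of_nat m = - of_nat n"
  \<comment> \<open>The line r + s = -n-m keeps the third upper parameter at -n. On the interval
    chosen r < -n-m-1, hence s > 1 > r.\<close>
  define f where "f = (\<lambda>w. - of_nat n - of_nat m - w :: complex)"
  have "defect (f r) r (- of_nat m) = 0"
  proof (rule defect_continuation[where S = UNIV and s = f and r = "\<lambda>w. w" and p = "\<lambda>_. - of_nat m" and a = "- real n - real m - 2" and b = "- real n - real m - 1"])
    show "(\<forall>w\<in>UNIV. Re w < Re (f w)) \<or>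
      (\<exists>n. (\<forall>w\<in>UNIV. 2 * w = - of_nat n) \<or> (\<forall>w\<in>UNIV. w + - of_nat m = - of_nat n) \<or> (\<forall>w\<in>UNIV. w + f w - - of_nat m = - of_nat n))"
      by (rule disjI2, rule exI[of _ n]) (simp add: f_def)
  qed (auto simp: f_def intro!: holomorphic_intros defect_zero)
  moreover have "f r = s" using * by (simp add: f_def algebra_simps add_eq_0_iff)
  ultimately show ?thesis by simp
qed

text \<open>Each reason for convergence on the left meets each reason on the right, and the
  reflection in p halves the work. If 2r = -n with -1/2 < Re s <= Re r, then n = 0, so r itself is a
  nonpositive integer.\<close>

lemma defect_zero_general:
  assumes L: "Re r < Re s \<or> (\<exists>n. 2 * r = - of_nat n \<or> r + p = - of_nat n \<or> r + s - p = - of_nat n)"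
    and R: "Re s > - 1/2 \<or> (\<exists>m. p = - of_nat m \<or> s - p = - of_nat m \<or> r = - of_nat m)"
  shows "defect s r p = 0"
  using R
proof (elim disjE exE)
  fix m assume "r = - of_nat m"
  then show ?thesis by (simp add: defect_zero_r_nonpos)
next
  fix m assume "p = - of_nat m"
  then show ?thesis using L by (auto intro!: defect_zero_p_nonpos)
next
  fix m assume m: "s - p = - of_nat m"
  have "defect s r (- of_nat m) = 0"
  proof (rule defect_zero_p_nonpos)
    have "p = s + of_nat m" using m by (simp add: algebra_simps)
    then show "Re r < Re s \<or> (\<exists>n. 2 * r = - of_nat n \<or> r - of_nat m = - of_nat n \<or> r + s + of_nat m = - of_nat n)"
      using L by (auto simp: algebra_simps)
  qed
  then show ?thesis using defect_symmetric[of s r p] m by simp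
next
  assume s: "Re s > - 1/2"
  \<comment> \<open>Along p = -n-r with s fixed the left series keeps terminating, so r may leave
    the half-plane Re r < Re s.\<close>
  have *: "defect s r p = 0" if n: "r + p = - of_nat n" for p n
  proof -
    have "defect s r (- of_nat n - r) = 0"
      by (rule defect_continuation[where S = UNIV and s = "\<lambda>_. s" and r = "\<lambda>w. w" and p = "\<lambda>w. - of_nat n - w" and a = "Re s - 2" and b = "Re s - 1"])
        (use s in \<open>auto intro!: holomorphic_intros defect_zero\<close>)
    moreover have "- of_nat n - r = p" using n by (simp add: algebra_simps add_eq_0_iff)
    ultimately show ?thesis by simp
  qed
  show ?thesis
  proof (cases "Re r < Re s")
    case True
    then show ?thesis using s by (rule defect_zero)
  next
    case False
    from L False obtain n where "2 * r = - of_nat n \<or> r + p = - of_nat n \<or> r + s - p = - of_nat n" by blast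
    then show ?thesis
    proof (elim disjE)
      assume n: "2 * r = - of_nat n"
      then have "2 * Re r = - real n" by (metis Re_complex_of_real complex_Re_of_nat mult_2 plus_complex.sel(1) uminus_complex.sel(1))
      then have "n = 0" using False s by simp
      then have "r = - of_nat 0" using n by simp
      then show ?thesis using defect_zero_r_nonpos by blast
    next
      assume "r + p = - of_nat n"
      then show ?thesis by (rule *)
    next
      assume "r + s - p = - of_nat n"
      then have "defect s r (s - p) = 0" by (intro *) (simp add: algebra_simps)
      then show ?thesis by (simp add: defect_symmetric)
    qed
  qed
qed

section \<open>Convergence of hypergeometric series at 1\<close>

text \<open>A rearranged definition of \<open>rGamma_series\<close>: Euler's limit for 1/Gamma then
  yields the growth of the numerator.\<close>

lemma prod_list_pochhammer_asymptotic:
  "prod_list (map (\<lambda>a. pochhammer a (Suc n)) as) =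
     prod_list (map (\<lambda>a. rGamma_series a n) as) * fact n ^ length as * exp (sum_list as * of_real (ln (of_nat n)))"
  for as :: "complex list"
proof (induction as)
  case (Cons a as)
  have "pochhammer a (Suc n) = rGamma_series a n * (fact n * exp (a * of_real (ln (of_nat n))))"
    by (simp add: rGamma_series_def)
  then show ?case unfolding list.map prod_list.Cons Cons
    by (simp add: exp_add algebra_simps)
qed simp

lemma prod_list_rGamma_asymptotic:
  fixes bs :: "complex list"
  assumes "\<And>b. b \<in> set bs \<Longrightarrow> b \<notin> \<int>\<^sub>\<le>\<^sub>0"
  shows "prod_list (map (\<lambda>b. rGamma (b + of_nat (Suc n))) bs) * (fact n ^ length bs * exp (sum_list bs * of_real (ln (of_nat n)))) =
     prod_list (map (\<lambda>b. rGamma b / rGamma_series b n) bs)"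
  using assms
proof (induction bs)
  case (Cons b bs)
  have nz: "pochhammer b (Suc n) \<noteq> 0" using Cons.prems[of b] pochhammer_eq_0_imp_nonpos_Int by auto
  have "rGamma b = pochhammer b (Suc n) * rGamma (b + of_nat (Suc n))" by (rule pochhammer_rGamma)
  then have *: "rGamma (b + of_nat (Suc n)) * (fact n * exp (b * of_real (ln (of_nat n)))) = rGamma b / rGamma_series b n"
    using nz by (simp add: rGamma_series_def)
  have "prod_list (map (\<lambda>b. rGamma (b + of_nat (Suc n))) (b # bs)) * (fact n ^ length (b # bs) * exp (sum_list (b # bs) * of_real (ln (of_nat n))))
     = (rGamma (b + of_nat (Suc n)) * (fact n * exp (b * of_real (ln (of_nat n))))) *
       (prod_list (map (\<lambda>b. rGamma (b + of_nat (Suc n))) bs) * (fact n ^ length bs * exp (sum_list bs * of_real (ln (of_nat n)))))"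
    by (simp add: exp_add distrib_right mult_ac del: of_nat_Suc)
  also have "\<dots> = rGamma b / rGamma_series b n * prod_list (map (\<lambda>b. rGamma b / rGamma_series b n) bs)"
    unfolding * by (subst Cons.IH) (use Cons.prems in auto)
  finally show ?case by simp
qed simp

lemma Re_sum_list: "Re (sum_list xs) = (\<Sum>x\<leftarrow>xs. Re x)"
  by (induction xs) auto

text \<open>By Euler's limit the modulus, scaled by n^excess, tends to the product of the
  1/|Gamma(a)|, which is positive since no upper parameter is a nonpositive integer. The upper bound
  on the terms is thus of the exact order.\<close>

lemma reg_term_asymptotic:
  assumes len: "length as = Suc (length bs)" and a: "\<And>a. a \<in> set as \<Longrightarrow> a \<notin> \<int>\<^sub>\<le>\<^sub>0" and b: "\<And>b. b \<in> set bs \<Longrightarrow> b \<notin> \<int>\<^sub>\<le>\<^sub>0"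
  shows "\<exists>C>0. (\<lambda>n. norm (of_nat (Suc n) * reg_term as bs (Suc n)) * exp (excess as bs * ln (real n))) \<longlonglongrightarrow> C"
proof -
  define A where "A = (\<lambda>n. prod_list (map (\<lambda>a. rGamma_series a n) as))"
  define B where "B = (\<lambda>n. prod_list (map (\<lambda>b. rGamma b / rGamma_series b n) bs))"
  have A: "A \<longlonglongrightarrow> prod_list (map rGamma as)"
    unfolding A_def by (induction as) (auto intro!: tendsto_intros)
  have B: "B \<longlonglongrightarrow> 1"
    unfolding B_def using b
  proof (induction bs)
    case (Cons b bs)
    then have nz: "rGamma b \<noteq> 0" by (simp add: rGamma_eq_zero_iff)
    have "(\<lambda>n. rGamma b / rGamma_series b n) \<longlonglongrightarrow> rGamma b / rGamma b"
      by (intro tendsto_intros nz)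
    then have "(\<lambda>n. rGamma b / rGamma_series b n) \<longlonglongrightarrow> 1" using nz by simp
    from tendsto_mult[OF this Cons.IH] show ?case using Cons.prems by simp
  qed simp
  have "(\<lambda>n. norm (A n * B n)) \<longlonglongrightarrow> norm (prod_list (map rGamma as) * 1)"
    by (intro tendsto_intros A B)
  also have "(\<lambda>n. norm (A n * B n)) = (\<lambda>n. norm (of_nat (Suc n) * reg_term as bs (Suc n)) * exp (excess as bs * ln (real n)))"
  proof
    fix n
    define ea where "ea = exp (sum_list as * of_real (ln (of_nat n)))"
    define eb where "eb = exp (sum_list bs * of_real (ln (of_nat n)))"
    have nz: "ea \<noteq> 0" "eb \<noteq> 0" "of_nat (Suc n) \<noteq> (0::complex)" by (simp_all add: ea_def eb_def del: of_nat_Suc)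
    have R: "prod_list (map (\<lambda>b. rGamma (b + of_nat (Suc n))) bs) = B n / (fact n ^ length bs * eb)"
      using prod_list_rGamma_asymptotic[OF b, of bs n] nz by (simp add: B_def eb_def field_simps del: of_nat_Suc)
    have "of_nat (Suc n) * reg_term as bs (Suc n) = A n * B n * (ea / eb)"
      unfolding reg_term_def R prod_list_pochhammer_asymptotic ea_def [symmetric] fact_Suc
      using nz by (simp add: len A_def del: of_nat_Suc)
    moreover have "norm (ea / eb) * exp (excess as bs * ln (real n)) = 1"
    proof -
      have "ea / eb = exp ((sum_list as - sum_list bs) * of_real (ln (of_nat n)))"
        by (simp add: ea_def eb_def exp_diff left_diff_distrib)
      then show ?thesis by (simp add: excess_def Re_sum_list exp_add [symmetric] left_diff_distrib)
    qed
    ultimately show "norm (A n * B n) = norm (of_nat (Suc n) * reg_term as bs (Suc n)) * exp (excess as bs * ln (real n))"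
      by (simp only: norm_mult [of "A n * B n"] mult.assoc [of "norm (A n * B n)"] mult_1_right)
  qed
  finally show ?thesis
    using a by (intro exI[of _ "norm (prod_list (map rGamma as) * 1)"]) (auto simp: prod_list_zero_iff rGamma_eq_zero_iff)
qed

lemma Bseq_plus:
  fixes f g :: "nat \<Rightarrow> complex"
  assumes "Bseq f" "Bseq g"
  shows "Bseq (\<lambda>n. f n + g n)"
proof -
  obtain K L where "\<And>n. norm (f n) \<le> K" "\<And>n. norm (g n) \<le> L"
    using assms by (auto simp: Bseq_def)
  then show ?thesis by (intro BseqI'[of _ "K + L"]) (meson add_mono norm_triangle_le)
qed

text \<open>Multiplying the expansion 1 + S/n + O(1/n^2) by 1 + a/n adds a/n and only terms of order
  1/n^2. Numerator and denominator of the ratio of consecutive terms are both products of this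
  kind.\<close>

lemma prod_list_one_plus_expansion:
  fixes as :: "complex list"
  shows "Bseq (\<lambda>n. of_nat n ^ 2 * (prod_list (map (\<lambda>a. 1 + a / of_nat n) as) - 1 - sum_list as / of_nat n))"
proof (induction as)
  case (Cons a as)
  define P where "P = (\<lambda>n. prod_list (map (\<lambda>a. 1 + a / of_nat n) as))"
  define S where "S = sum_list as"
  have "(\<lambda>n. a / of_nat n) \<longlonglongrightarrow> 0" by (rule lim_const_over_n)
  then have "(\<lambda>n. 1 + a / of_nat n) \<longlonglongrightarrow> 1 + 0" by (intro tendsto_add tendsto_const)
  then have "Bseq (\<lambda>n. 1 + a / of_nat n)" by (intro convergent_imp_Bseq convergentI)
  with Cons have "Bseq (\<lambda>n. of_nat n ^ 2 * (P n - 1 - S / of_nat n) * (1 + a / of_nat n))"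
    unfolding P_def S_def by (rule Bseq_mult)
  \<comment> \<open>For n > 0 the cross term n^2 (a/n)(S/n) is \<open>a * S\<close>; at n = 0 the
    factor n^2 annihilates everything.\<close>
  moreover have "Bseq (\<lambda>n. if n = 0 then 0 else a * S)"
    by (rule BseqI'[of _ "norm (a * S)"]) simp
  ultimately have "Bseq (\<lambda>n. of_nat n ^ 2 * (P n - 1 - S / of_nat n) * (1 + a / of_nat n) + (if n = 0 then 0 else a * S))"
    by (rule Bseq_plus)
  also have "(\<lambda>n. of_nat n ^ 2 * (P n - 1 - S / of_nat n) * (1 + a / of_nat n) + (if n = 0 then 0 else a * S))
     = (\<lambda>n. of_nat n ^ 2 * (prod_list (map (\<lambda>a. 1 + a / of_nat n) (a # as)) - 1 - sum_list (a # as) / of_nat n))"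
  proof
    fix n
    have "N ^ 2 * (Q - 1 - S / N) * (1 + a / N) + a * S = N ^ 2 * ((1 + a / N) * Q - 1 - (a + S) / N)"
      if "N \<noteq> 0" for N Q
      using that by (simp add: field_simps power2_eq_square)
    then show "of_nat n ^ 2 * (P n - 1 - S / of_nat n) * (1 + a / of_nat n) + (if n = 0 then 0 else a * S) =
       of_nat n ^ 2 * (prod_list (map (\<lambda>a. 1 + a / of_nat n) (a # as)) - 1 - sum_list (a # as) / of_nat n)"
      unfolding list.map prod_list.Cons sum_list.Cons P_def S_def [symmetric] by simp
  qed
  finally show ?case .
qed (simp add: Bseq_def exI[of _ 1])

lemma prod_list_add_of_nat:
  fixes as :: "complex list"
  assumes "n > 0"
  shows "prod_list (map (\<lambda>a. a + of_nat n) as) = of_nat n ^ length as * prod_list (map (\<lambda>a. 1 + a / of_nat n) as)"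
  using assms by (induction as) (auto simp: field_simps)

lemma reg_term_Suc:
  assumes b: "\<And>b. b \<in> set bs \<Longrightarrow> b \<notin> \<int>\<^sub>\<le>\<^sub>0"
  shows "of_nat (Suc n) * reg_term as bs (Suc n) * prod_list (map (\<lambda>b. b + of_nat n) bs)
     = prod_list (map (\<lambda>a. a + of_nat n) as) * (reg_term as bs n :: complex)"
proof -
  have 1: "prod_list (map (\<lambda>a. pochhammer a (Suc n)) as) = prod_list (map (\<lambda>a. a + of_nat n) as) * prod_list (map (\<lambda>a. pochhammer a n) as)"
    by (induction as) (simp_all add: pochhammer_Suc mult_ac)
  have 2: "prod_list (map (\<lambda>b. rGamma (b + of_nat (Suc n))) bs) * prod_list (map (\<lambda>b. b + of_nat n) bs) = prod_list (map (\<lambda>b. rGamma (b + of_nat n)) bs)"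
  proof (induction bs)
    case (Cons b bs)
    have *: "rGamma (b + of_nat (Suc n)) * (b + of_nat n) = rGamma (b + of_nat n)"
      using rGamma_plus1[of "b + of_nat n"] by (simp add: mult.commute add_ac)
    have "prod_list (map (\<lambda>b. rGamma (b + of_nat (Suc n))) (b # bs)) * prod_list (map (\<lambda>b. b + of_nat n) (b # bs))
      = (rGamma (b + of_nat (Suc n)) * (b + of_nat n)) * (prod_list (map (\<lambda>b. rGamma (b + of_nat (Suc n))) bs) * prod_list (map (\<lambda>b. b + of_nat n) bs))"
      unfolding list.map prod_list.Cons by (simp only: mult_ac)
    then show ?case unfolding Cons * by simp
  qed simp
  have "of_nat (Suc n) \<noteq> (0::complex)" by (rule of_nat_neq_0)
  then have "of_nat (Suc n) * reg_term as bs (Suc n) * prod_list (map (\<lambda>b. b + of_nat n) bs)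
     = prod_list (map (\<lambda>a. pochhammer a (Suc n)) as) * (prod_list (map (\<lambda>b. rGamma (b + of_nat (Suc n))) bs) * prod_list (map (\<lambda>b. b + of_nat n) bs)) / fact n"
    unfolding reg_term_def fact_Suc by (simp add: field_simps del: of_nat_Suc)
  also have "\<dots> = prod_list (map (\<lambda>a. a + of_nat n) as) * reg_term as bs n"
    unfolding 1 2 reg_term_def by simp
  finally show ?thesis .
qed

text \<open>If \<open>t\<close> is summable then so are the differences of \<open>n * t n\<close>, because
  \<open>t (n + 1) / t n = 1 - (1 + s) / n + O(1 / n\<^sup>2)\<close>, where \<open>s\<close> has real part \<open>excess as bs\<close>; hence \<open>n * t n\<close> converges.
  A nonzero limit makes \<open>t\<close> comparable with the harmonic series, and for \<open>Re s \<le> 0\<close> the limit is not zero.\<close>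

lemma summable_reg_term_imp_excess_pos:
  assumes len: "length as = Suc (length bs)" and a: "\<And>a. a \<in> set as \<Longrightarrow> a \<notin> \<int>\<^sub>\<le>\<^sub>0" and b: "\<And>b. b \<in> set bs \<Longrightarrow> b \<notin> \<int>\<^sub>\<le>\<^sub>0"
    and summ: "summable (reg_term as bs)"
  shows "excess as bs > 0"
proof (rule ccontr)
  assume neg: "\<not> excess as bs > 0"
  define t where "t = reg_term as bs"
  define x where "x = - excess as bs"
  have x0: "x \<ge> 0" using neg by (simp add: x_def)
  define s where "s = sum_list bs - sum_list as"
  obtain C where C: "C > 0" "(\<lambda>n. norm (of_nat (Suc n) * t (Suc n)) * exp (excess as bs * ln (real n))) \<longlonglongrightarrow> C"
    using reg_term_asymptotic[OF len a b] unfolding t_def by blast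
  have ev: "\<forall>\<^sub>F n in sequentially. n > 0 \<and> norm (of_nat (Suc n) * t (Suc n)) \<ge> C / 2 * real n powr x
       \<and> norm (of_nat (Suc n) * t (Suc n)) \<le> 2 * C * real n powr x"
  proof -
    have C2: "C / 2 < C" "C < 2 * C" using C(1) by auto
    show ?thesis using order_tendstoD(1)[OF C(2) C2(1)] order_tendstoD(2)[OF C(2) C2(2)] eventually_gt_at_top[of 0]
    proof eventually_elim
      case (elim n)
      have "exp (excess as bs * ln (real n)) * real n powr x = 1"
        using elim by (simp add: powr_def x_def exp_add [symmetric])
      then have *: "norm (of_nat (Suc n) * t (Suc n)) = (norm (of_nat (Suc n) * t (Suc n)) * exp (excess as bs * ln (real n))) * real n powr x"
        by (simp add: mult.assoc del: of_nat_Suc)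
      have "C / 2 * real n powr x \<le> norm (of_nat (Suc n) * t (Suc n)) * exp (excess as bs * ln (real n)) * real n powr x"
        "norm (of_nat (Suc n) * t (Suc n)) * exp (excess as bs * ln (real n)) * real n powr x \<le> 2 * C * real n powr x"
        using elim by (intro mult_right_mono less_imp_le; simp)+
      then show ?case using elim(3) unfolding * [symmetric] by blast
    qed
  qed
  have t0: "t \<longlonglongrightarrow> 0" using summ unfolding t_def by (rule summable_LIMSEQ_zero)
  \<comment> \<open>The modulus of t (n+1) is of order n^(x-1), so t -> 0 excludes x >= 1.\<close>
  have x1: "x < 1"
  proof (rule ccontr)
    assume "\<not> x < 1"
    then have x1: "x \<ge> 1" by simp
    have "(\<lambda>n. norm (t (Suc n))) \<longlonglongrightarrow> 0" using t0 LIMSEQ_Suc tendsto_norm_zero by blast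
    then have "\<forall>\<^sub>F n in sequentially. norm (t (Suc n)) < C / 4" using C(1) by (intro order_tendstoD(2)) auto
    then have "\<forall>\<^sub>F n in sequentially. False" using ev
    proof eventually_elim
      case (elim n)
      have "real n \<ge> 1" using elim by simp
      then have "real n powr 1 \<le> real n powr x" using x1 by (intro powr_mono) auto
      then have "C / 2 * real n \<le> C / 2 * real n powr x" using C(1) elim by simp
      also have "\<dots> \<le> real (Suc n) * norm (t (Suc n))" using elim by (simp add: norm_mult del: of_nat_Suc)
      also have "\<dots> < real (Suc n) * (C / 4)" using elim by (intro mult_strict_left_mono) auto
      finally have "2 * real n < real (Suc n)" using C(1) by (simp add: field_simps)
      then show False using elim by simp
    qed
    then show False by simp
  qed
  define u where "u = (\<lambda>n. of_nat n * t n)"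
  \<comment> \<open>Its terms are of order n^(x-2), summable because x < 1; this majorises the error
    term \<open>d n * t n\<close> below although t need not converge absolutely.\<close>
  have tn: "summable (\<lambda>n. norm (t n) / real n)"
  proof -
    have "summable (\<lambda>n. 2 * C * real n powr (x - 2))"
      using x1 by (intro summable_mult) (simp add: summable_real_powr_iff)
    moreover have "\<forall>\<^sub>F n in sequentially. norm (norm (t (Suc n)) / real (Suc n)) \<le> 2 * C * real n powr (x - 2)"
      using ev
    proof eventually_elim
      case (elim n)
      have n: "real n > 0" using elim by simp
      have "norm (t (Suc n)) / real (Suc n) = norm (of_nat (Suc n) * t (Suc n)) / real (Suc n) ^ 2"
        by (simp add: norm_mult power2_eq_square del: of_nat_Suc)
      also have "\<dots> \<le> 2 * C * real n powr x / real n ^ 2"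
        using elim n C(1) by (intro frac_le power_mono) auto
      also have "\<dots> = 2 * C * real n powr (x - 2)" using n by (simp add: powr_diff)
      finally show ?case by simp
    qed
    ultimately have "summable (\<lambda>n. norm (t (Suc n)) / real (Suc n))"
      by (rule summable_comparison_test_ev[rotated])
    then show ?thesis by (subst (asm) summable_Suc_iff)
  qed
  define A where "A = (\<lambda>n. prod_list (map (\<lambda>a. 1 + a / of_nat n) as))"
  define B where "B = (\<lambda>n. prod_list (map (\<lambda>a. 1 + a / of_nat n) bs))"
  \<comment> \<open>The deviation of n (A/B - 1) from its limit -s; by the product expansions it is
    O(1/n).\<close>
  define d where "d = (\<lambda>n. of_nat n * (A n / B n) - of_nat n + s)"
  have Bnz: "B n \<noteq> 0" for n
  proof -
    have "1 + b / of_nat n \<noteq> 0" if "b \<in> set bs" for b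
    proof
      assume "1 + b / of_nat n = 0"
      then have "b = - of_nat n" by (cases "n = 0") (auto simp: field_simps add_eq_0_iff)
      then show False using b[OF that] by simp
    qed
    then show ?thesis by (auto simp: B_def prod_list_zero_iff)
  qed
  have "B \<longlonglongrightarrow> prod_list (map (\<lambda>a. 1 + 0) bs)"
    unfolding B_def by (induction bs) (auto intro!: tendsto_intros lim_const_over_n simp del: add_0_right)
  also have "prod_list (map (\<lambda>a. 1 + 0 :: complex) bs) = 1" by (induction bs) auto
  finally have B1: "B \<longlonglongrightarrow> 1" .
  have "Bseq (\<lambda>n. of_nat n * d n)"
  proof -
    define sb where "sb = sum_list bs"
    define sa where "sa = sum_list as"
    have "Bseq (\<lambda>n. 1 - s / of_nat n)"
      by (intro convergent_imp_Bseq convergentI[of _ "1 - 0"] tendsto_diff tendsto_const lim_const_over_n)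
    with prod_list_one_plus_expansion[of bs]
    have "Bseq (\<lambda>n. of_nat n ^ 2 * (B n - 1 - sb / of_nat n) * (1 - s / of_nat n))"
      unfolding B_def sb_def by (rule Bseq_mult)
    then have "Bseq (\<lambda>n. - (of_nat n ^ 2 * (B n - 1 - sb / of_nat n) * (1 - s / of_nat n)))"
      by (simp add: Bseq_minus_iff)
    moreover have "Bseq (\<lambda>n. of_nat n ^ 2 * (A n - 1 - sa / of_nat n))"
      using prod_list_one_plus_expansion[of as] unfolding A_def sa_def .
    moreover have "Bseq (\<lambda>n. if n = 0 then 0 else sb * s)" by (rule BseqI'[of _ "norm (sb * s)"]) simp
    ultimately have "Bseq (\<lambda>n. of_nat n ^ 2 * (A n - 1 - sa / of_nat n) + (if n = 0 then 0 else sb * s)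
       + - (of_nat n ^ 2 * (B n - 1 - sb / of_nat n) * (1 - s / of_nat n)))"
      by (intro Bseq_plus)
    moreover have "Bseq (\<lambda>n. inverse (B n))"
      by (intro convergent_imp_Bseq convergentI[of _ "inverse 1"] tendsto_inverse B1) auto
    ultimately have "Bseq (\<lambda>n. (of_nat n ^ 2 * (A n - 1 - sa / of_nat n) + (if n = 0 then 0 else sb * s)
       + - (of_nat n ^ 2 * (B n - 1 - sb / of_nat n) * (1 - s / of_nat n))) * inverse (B n))"
      by (rule Bseq_mult)
    also have "(\<lambda>n. (of_nat n ^ 2 * (A n - 1 - sa / of_nat n) + (if n = 0 then 0 else sb * s)
       + - (of_nat n ^ 2 * (B n - 1 - sb / of_nat n) * (1 - s / of_nat n))) * inverse (B n)) = (\<lambda>n. of_nat n * d n)"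
    proof
      fix n
      have sa: "sa = sb - s" by (simp add: s_def sa_def sb_def)
      show "(of_nat n ^ 2 * (A n - 1 - sa / of_nat n) + (if n = 0 then 0 else sb * s)
       + - (of_nat n ^ 2 * (B n - 1 - sb / of_nat n) * (1 - s / of_nat n))) * inverse (B n) = of_nat n * d n"
        using Bnz[of n] unfolding d_def sa
        by (cases "n = 0") (simp_all add: field_simps power2_eq_square)
    qed
    finally show ?thesis .
  qed
  then obtain K where K: "\<And>n. norm (of_nat n * d n) \<le> K" by (auto simp: Bseq_def)
  have diff: "u (Suc n) - u n = (d n - s) * t n" if n: "n > 0" for n
  proof -
    have "u (Suc n) * (of_nat n ^ length bs * B n) = of_nat n * of_nat n ^ length bs * A n * t n"
      using reg_term_Suc[OF b, of bs n as] unfolding prod_list_add_of_nat[OF n] len u_def t_def A_def B_def by simp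
    then have "u (Suc n) = of_nat n * (A n / B n) * t n"
      using Bnz[of n] n by (simp add: field_simps)
    then show ?thesis by (simp add: d_def u_def algebra_simps)
  qed
  have "summable (\<lambda>n. u (Suc n) - u n)"
  proof -
    have "summable (\<lambda>n. d n * t n)"
    proof (rule summable_norm_cancel, rule summable_comparison_test_ev)
      show "summable (\<lambda>n. K * (norm (t n) / real n))" by (intro summable_mult tn)
      show "\<forall>\<^sub>F n in sequentially. norm (norm (d n * t n)) \<le> K * (norm (t n) / real n)"
        using eventually_gt_at_top[of 0]
      proof eventually_elim
        case (elim n)
        have "norm (d n) \<le> K / real n" using K[of n] elim by (simp add: norm_mult field_simps)
        then have "norm (d n) * norm (t n) \<le> K / real n * norm (t n)" by (rule mult_right_mono) simp
        then show ?case by (simp add: norm_mult)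
      qed
    qed
    then have "summable (\<lambda>n. d n * t n - s * t n)"
      using summ unfolding t_def by (intro summable_diff summable_mult)
    moreover have "\<forall>\<^sub>F n in sequentially. u (Suc n) - u n = d n * t n - s * t n"
      using eventually_gt_at_top[of 0] by eventually_elim (simp add: diff algebra_simps)
    ultimately show ?thesis using summable_cong by fastforce
  qed
  then obtain l where l: "(\<lambda>n. \<Sum>k<n. u (Suc k) - u k) \<longlonglongrightarrow> l" by (auto simp: summable_def sums_def)
  define L where "L = l + u 0"
  have uL: "u \<longlonglongrightarrow> L"
    using tendsto_add[OF l tendsto_const[of "u 0"]] by (simp add: sum_lessThan_telescope L_def)
  have "norm L \<ge> C / 2"
  proof (rule tendsto_lowerbound)
    show "(\<lambda>n. norm (u (Suc n))) \<longlonglongrightarrow> norm L" by (intro tendsto_norm LIMSEQ_Suc uL)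
    show "\<forall>\<^sub>F n in sequentially. C / 2 \<le> norm (u (Suc n))"
      using ev
    proof eventually_elim
      case (elim n)
      have "1 \<le> real n powr x" using elim x0 by (intro ge_one_powr_ge_zero) auto
      then have "C / 2 * 1 \<le> C / 2 * real n powr x" using C(1) by (intro mult_left_mono) auto
      then show ?case using elim unfolding u_def by linarith
    qed
  qed simp
  then have L0: "L \<noteq> 0" using C(1) by auto
  \<comment> \<open>Division by \<open>L\<close> turns the terms towards the positive axis: their
    real parts eventually exceed 1/(2n), so convergence would bound the harmonic series.\<close>
  have "(\<lambda>n. Re (u n / L)) \<longlonglongrightarrow> Re (L / L)" using L0 by (intro tendsto_intros uL) auto
  then have "\<forall>\<^sub>F n in sequentially. Re (u n / L) > 1 / 2"
    using L0 by (intro order_tendstoD(1)) auto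
  then have "\<forall>\<^sub>F n in sequentially. norm (inverse (real n)) \<le> 2 * Re (t n / L)"
    using eventually_gt_at_top[of 0]
  proof eventually_elim
    case (elim n)
    have "Re (u n / L) = real n * Re (t n / L)"
      by (simp add: u_def times_divide_eq_right [symmetric] del: times_divide_eq_right)
    then show ?case using elim by (simp add: field_simps)
  qed
  moreover have "summable (\<lambda>n. 2 * Re (t n / L))"
    using summ unfolding t_def by (intro summable_mult summable_Re summable_divide)
  ultimately have "summable (\<lambda>n. inverse (real n))"
    by (rule summable_comparison_test_ev)
  then show False using not_summable_harmonic[where 'a = real] by simp
qed

lemma hypergeo_nth_eq_reg_term:
  assumes "\<And>b. b \<in> set bs \<Longrightarrow> b \<notin> \<int>\<^sub>\<le>\<^sub>0"
  shows "fps_hypergeo as bs 1 $ k = reg_term as bs k * prod_list (map Gamma bs)"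
proof -
  have "prod_list (map (\<lambda>b. rGamma (b + of_nat k)) bs) * prod_list (map Gamma bs) * prod_list (map (\<lambda>b. pochhammer b k) bs) = 1"
    using assms
  proof (induction bs)
    case (Cons b bs)
    have "rGamma (b + of_nat k) * Gamma b * pochhammer b k = (pochhammer b k * rGamma (b + of_nat k)) * inverse (rGamma b)"
      by (simp add: Gamma_def mult_ac)
    also have "\<dots> = 1"
      unfolding pochhammer_rGamma[symmetric] using Cons.prems[of b] by (simp add: rGamma_eq_zero_iff)
    finally have b: "rGamma (b + of_nat k) * Gamma b * pochhammer b k = 1" .
    have "prod_list (map (\<lambda>b. rGamma (b + of_nat k)) (b # bs)) * prod_list (map Gamma (b # bs)) * prod_list (map (\<lambda>b. pochhammer b k) (b # bs))
      = (rGamma (b + of_nat k) * Gamma b * pochhammer b k) *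
        (prod_list (map (\<lambda>b. rGamma (b + of_nat k)) bs) * prod_list (map Gamma bs) * prod_list (map (\<lambda>b. pochhammer b k) bs))"
      unfolding list.map prod_list.Cons by (simp only: mult_ac)
    then show ?case unfolding b using Cons by simp
  qed simp
  then have "prod_list (map (\<lambda>b. rGamma (b + of_nat k)) bs) * prod_list (map Gamma bs) = 1 / prod_list (map (\<lambda>b. pochhammer b k) bs)"
    by (metis eq_divide_eq mult_zero_right zero_neq_one)
  then show ?thesis unfolding hypergeo_nth reg_term_def by (simp add: mult.assoc)
qed

text \<open>Translates plain convergence of the partial sums into the dichotomy on which the
  continuation is built: positive excess or termination.\<close>

lemma hypergeo_converges_reg:
  assumes conv: "hypergeo_converges as bs 1" and len: "length as = Suc (length bs)"
  shows "hypergeo as bs 1 = reg_hyp as bs * prod_list (map Gamma bs)"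
    and "excess as bs > 0 \<or> (\<exists>n. - of_nat n \<in> set as)"
proof -
  have b: "b \<notin> \<int>\<^sub>\<le>\<^sub>0" if "b \<in> set bs" for b using conv that by (auto simp: hypergeo_converges_def)
  have G: "prod_list (map Gamma bs) \<noteq> 0" using b by (auto simp: prod_list_zero_iff Gamma_eq_zero_iff)
  have nth: "fps_hypergeo as bs 1 $ k = reg_term as bs k * prod_list (map Gamma bs)" for k
    by (rule hypergeo_nth_eq_reg_term) (rule b)
  have "summable (\<lambda>k. reg_term as bs k * prod_list (map Gamma bs))"
    unfolding nth [symmetric] using conv by (simp only: hypergeo_converges_def)
  then have "summable (\<lambda>k. reg_term as bs k * prod_list (map Gamma bs) * inverse (prod_list (map Gamma bs)))"
    by (rule summable_mult2)
  then have s: "summable (reg_term as bs)" using G by (simp add: mult.assoc)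
  show "hypergeo as bs 1 = reg_hyp as bs * prod_list (map Gamma bs)"
    unfolding hypergeo_def reg_hyp_def nth by (rule suminf_mult2[OF s, symmetric])
  show "excess as bs > 0 \<or> (\<exists>n. - of_nat n \<in> set as)"
  proof (cases "\<exists>a\<in>set as. a \<in> \<int>\<^sub>\<le>\<^sub>0")
    case True
    then show ?thesis by (auto elim!: nonpos_Ints_cases')
  next
    case False
    then show ?thesis using summable_reg_term_imp_excess_pos[OF len _ b s] by blast
  qed
qed

section \<open>Gamma duplication and return to the original parameters\<close>

lemma Gamma_duplication_ratio:
  fixes z :: complex
  assumes "2 * z \<notin> \<int>\<^sub>\<le>\<^sub>0"
  shows "z \<notin> \<int>\<^sub>\<le>\<^sub>0" "Gamma (2 * z) * (exp ((1 - 2 * z) * of_real (ln 2)) * of_real (sqrt pi)) = Gamma z * Gamma (z + 1/2)"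
    "Gamma (2 * z) \<noteq> 0" "Gamma z \<noteq> 0" "Gamma (z + 1/2) \<noteq> 0"
proof -
  show z: "z \<notin> \<int>\<^sub>\<le>\<^sub>0"
  proof
    assume "z \<in> \<int>\<^sub>\<le>\<^sub>0"
    then obtain n where "z = - of_nat n" by (rule nonpos_Ints_cases')
    then have "2 * z = - of_nat (2 * n)" by simp
    then show False using assms by (metis minus_of_nat_in_nonpos_Ints)
  qed
  have z2: "z + 1/2 \<notin> \<int>\<^sub>\<le>\<^sub>0"
  proof
    assume "z + 1/2 \<in> \<int>\<^sub>\<le>\<^sub>0"
    then obtain n where "z + 1/2 = - of_nat n" by (rule nonpos_Ints_cases')
    then have "2 * (z + 1/2) - 1 = - of_nat (2 * n + 1)" by (simp only:) simp
    then have "2 * z = - of_nat (2 * n + 1)" by (simp add: algebra_simps)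
    then show False using assms by (metis minus_of_nat_in_nonpos_Ints)
  qed
  show "Gamma (2 * z) * (exp ((1 - 2 * z) * of_real (ln 2)) * of_real (sqrt pi)) = Gamma z * Gamma (z + 1/2)"
    using Gamma_legendre_duplication[OF z z2] by (simp add: mult_ac)
  show "Gamma (2 * z) \<noteq> 0" "Gamma z \<noteq> 0" "Gamma (z + 1/2) \<noteq> 0"
    using assms z z2 by (simp_all add: Gamma_eq_zero_iff)
qed

text \<open>Duplication replaces Gamma(z+1/2) by Gamma(2z)/Gamma(z) for z = s, s+r, 2s-p, 2s-p+r.
  The factors 2^(1-2z) sqrt(pi) cancel because (s+r) + (2s-p) = s + (2s-p+r).\<close>

lemma Gamma_prefactor:
  fixes s r p :: complex
  assumes "2 * s \<notin> \<int>\<^sub>\<le>\<^sub>0" "2 * (s + r) \<notin> \<int>\<^sub>\<le>\<^sub>0" "2 * (2 * s - p) \<notin> \<int>\<^sub>\<le>\<^sub>0" "2 * (2 * s - p + r) \<notin> \<int>\<^sub>\<le>\<^sub>0"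
  shows "Gamma (s + r + 1/2) * Gamma (2 * s - p + 1/2) / (Gamma (s + 1/2) * Gamma (2 * s - p + r + 1/2))
      * (Gamma (2 * s) * Gamma (2 * (2 * s - p + r)) / (Gamma (2 * (s + r)) * Gamma (2 * (2 * s - p))))
    = Gamma s * Gamma (2 * s - p + r) / (Gamma (s + r) * Gamma (2 * s - p))"
proof -
  define e where "e = (\<lambda>z. exp ((1 - 2 * z) * of_real (ln 2)) * of_real (sqrt pi) :: complex)"
  have e: "e (s + r) * e (2 * s - p) = e s * e (2 * s - p + r)"
    by (simp add: e_def exp_add [symmetric] algebra_simps)
  have ne: "e z \<noteq> 0" for z by (simp add: e_def)
  have D: "Gamma (z + 1/2) = Gamma (2 * z) * e z / Gamma z" if "2 * z \<notin> \<int>\<^sub>\<le>\<^sub>0" for z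
    using Gamma_duplication_ratio[OF that] by (simp add: e_def field_simps)
  have gen: "a2 * ea / a1 * (b2 * eb / b1) / (c2 * ec / c1 * (d2 * ed / d1)) * (c2 * d2 / (a2 * b2)) = c1 * d1 / (a1 * b1)"
    if "ea * eb = ec * ed" "a1 \<noteq> 0" "b1 \<noteq> 0" "c1 \<noteq> 0" "d1 \<noteq> 0" "a2 \<noteq> 0" "b2 \<noteq> 0" "c2 \<noteq> 0" "d2 \<noteq> 0" "ec \<noteq> 0" "ed \<noteq> 0"
    for a1 a2 b1 b2 c1 c2 d1 d2 ea eb ec ed :: complex
  proof -
    have "a2 * ea / a1 * (b2 * eb / b1) / (c2 * ec / c1 * (d2 * ed / d1)) * (c2 * d2 / (a2 * b2))
       = (ea * eb) / (ec * ed) * (c1 * d1 / (a1 * b1))"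
      using that(2-) by (simp add: divide_simps)
    then show ?thesis using that by simp
  qed
  show ?thesis unfolding D[OF assms(1)] D[OF assms(2)] D[OF assms(3)] D[OF assms(4)]
    by (rule gen[OF e]; intro ne Gamma_duplication_ratio(3,4)[OF assms(1)] Gamma_duplication_ratio(3,4)[OF assms(2)]
      Gamma_duplication_ratio(3,4)[OF assms(3)] Gamma_duplication_ratio(3,4)[OF assms(4)])
qed

theorem theorem4:
  fixes a b c :: complex
  assumes "hypergeo_converges [a, b, c] [- a + 2*b + c, - a + b + 2*c] 1"
    and "hypergeo_converges
           [- 2*a + 2*b + 2*c - 1, c - a/2, - 3*a/2 + b + c, a/2, b - a/2]
           [- 3*a/2 + 2*b + c, - a/2 + b + c, - 5*a/2 + 2*b + 2*c, - 3*a/2 + b + 2*c] 1"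
    and "- a/2 + b + c + 1/2 \<notin> \<int>\<^sub>\<le>\<^sub>0" "- 3*a/2 + 2*b + c + 1/2 \<notin> \<int>\<^sub>\<le>\<^sub>0"
    and "- a + b + c + 1/2 \<notin> \<int>\<^sub>\<le>\<^sub>0" "- a + 2*b + c + 1/2 \<notin> \<int>\<^sub>\<le>\<^sub>0"
    and "- a + b + 2*c \<notin> \<int>\<^sub>\<le>\<^sub>0" "- 3*a + 2*b + 2*c \<notin> \<int>\<^sub>\<le>\<^sub>0"
        "- 2*a + 2*b + 2*c \<notin> \<int>\<^sub>\<le>\<^sub>0" "- 2*a + 4*b + 2*c \<notin> \<int>\<^sub>\<le>\<^sub>0"
    and "- 3*a/2 + b + 2*c \<notin> \<int>\<^sub>\<le>\<^sub>0" "- 5*a/2 + 2*b + 2*c \<notin> \<int>\<^sub>\<le>\<^sub>0"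
        "- a + 2*b + 2*c \<notin> \<int>\<^sub>\<le>\<^sub>0" "- 3*a + 4*b + 2*c \<notin> \<int>\<^sub>\<le>\<^sub>0"
  shows "hypergeo [a, b, c] [- a + 2*b + c, - a + b + 2*c] 1 =
    (Gamma (- a/2 + b + c + 1/2) * Gamma (- 3*a/2 + 2*b + c + 1/2))
      / (Gamma (- a + b + c + 1/2) * Gamma (- a + 2*b + c + 1/2))
    * ((Gamma (- a + b + 2*c) * Gamma (- 3*a + 2*b + 2*c)
          * Gamma (- 2*a + 2*b + 2*c) * Gamma (- 2*a + 4*b + 2*c))
      / (Gamma (- 3*a/2 + b + 2*c) * Gamma (- 5*a/2 + 2*b + 2*c)
          * Gamma (- a + 2*b + 2*c) * Gamma (- 3*a + 4*b + 2*c)))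
    * hypergeo
        [- 2*a + 2*b + 2*c - 1, c - a/2, - 3*a/2 + b + c, a/2, b - a/2]
        [- 3*a/2 + 2*b + c, - a/2 + b + c, - 5*a/2 + 2*b + 2*c, - 3*a/2 + b + 2*c] 1"
proof -
  define s where "s = b + c - a"
  define r where "r = a / 2"
  define p where "p = c - a / 2"
  have a: "a = 2 * r" and c: "c = r + p" and b: "b = r + s - p"
    by (simp_all add: s_def r_def p_def field_simps)
  have eqs: "- a + 2*b + c = 2 * s - p + r" "- a + b + 2*c = s + r + p"
    "- 2*a + 2*b + 2*c - 1 = 2 * s - 1" "c - a/2 = p" "- 3*a/2 + b + c = s - r" "b - a/2 = s - p"
    "- 3*a/2 + 2*b + c = 2 * s - p" "- a/2 + b + c = s + r" "- 5*a/2 + 2*b + 2*c = 2 * s - r" "- 3*a/2 + b + 2*c = s + p"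
    "- a + b + c = s" "- 3*a + 2*b + 2*c = 2 * (s - r)" "- 2*a + 2*b + 2*c = 2 * s" "- 2*a + 4*b + 2*c = 2 * (2 * s - p + r)"
    "- a + 2*b + 2*c = 2 * (s + r)" "- 3*a + 4*b + 2*c = 2 * (2 * s - p)"
    by (simp_all add: s_def r_def p_def field_simps)
  have ar: "a / 2 = r" by (simp add: r_def)
  note A = assms[unfolded eqs, unfolded ar]
  have A1: "hypergeo_converges [a, b, c] [2 * s - p + r, s + r + p] 1"
    and A2: "hypergeo_converges [2 * s - 1, p, s - r, r, s - p] [2 * s - p, s + r, 2 * s - r, s + p] 1"
    using A(1,2) .
  have L: "hypergeo [a, b, c] [2 * s - p + r, s + r + p] 1 = lhs_series s r p * (Gamma (2 * s - p + r) * Gamma (s + r + p))"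
  proof -
    have "[a, c, b] = [2 * r, r + p, r + s - p]" "2 * s - p + r = 2 * s + r - p"
      by (simp_all only: a b c) simp_all
    moreover have "reg_term [a, b, c] [2 * s - p + r, s + r + p] = reg_term [a, c, b] [s + r + p, 2 * s - p + r]"
      by (simp add: fun_eq_iff reg_term_def mult_ac)
    ultimately have "reg_term [a, b, c] [2 * s - p + r, s + r + p] = reg_term [2 * r, r + p, r + s - p] [s + r + p, 2 * s + r - p]"
      by (simp only:)
    then show ?thesis using hypergeo_converges_reg(1)[OF A1] by (simp add: reg_hyp_def)
  qed
  have R: "hypergeo [2 * s - 1, p, s - r, r, s - p] [2 * s - p, s + r, 2 * s - r, s + p] 1
     = rhs_series s r p * (Gamma (2 * s - p) * Gamma (s + r) * Gamma (2 * s - r) * Gamma (s + p))"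
  proof -
    have "reg_term [2 * s - 1, p, s - r, r, s - p] [2 * s - p, s + r, 2 * s - r, s + p]
        = reg_term [2 * s - 1, p, s - p, r, s - r] [s + p, 2 * s - p, s + r, 2 * s - r]"
      by (simp add: fun_eq_iff reg_term_def mult_ac)
    then show ?thesis using hypergeo_converges_reg(1)[OF A2] by (simp add: reg_hyp_def mult_ac)
  qed
  have "defect s r p = 0"
  proof (rule defect_zero_general)
    have "excess [a, b, c] [2 * s - p + r, s + r + p] = 2 * (Re s - Re r)"
      by (simp add: a b c)
    then show "Re r < Re s \<or> (\<exists>n. 2 * r = - of_nat n \<or> r + p = - of_nat n \<or> r + s - p = - of_nat n)"
      using hypergeo_converges_reg(2)[OF A1] unfolding a [symmetric] b [symmetric] c [symmetric] by auto
    have "excess [2 * s - 1, p, s - r, r, s - p] [2 * s - p, s + r, 2 * s - r, s + p] = 2 * Re s + 1"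
      by simp
    moreover have "excess [2 * s - 1, p, s - r, r, s - p] [2 * s - p, s + r, 2 * s - r, s + p] > 0 \<or>
        (\<exists>n. - of_nat n \<in> set [2 * s - 1, p, s - r, r, s - p])"
      by (rule hypergeo_converges_reg(2)[OF A2]) simp
    ultimately consider "Re s > - 1/2" | n where "- of_nat n \<in> set [2 * s - 1, p, s - r, r, s - p]"
      by (elim disjE exE) auto
    then show "Re s > - 1/2 \<or> (\<exists>m. p = - of_nat m \<or> s - p = - of_nat m \<or> r = - of_nat m)"
    proof cases
      case (2 n)
      \<comment> \<open>Termination through s-r would put a pole at Gamma(2(s-r)). Termination
        through 2s-1 would put one at Gamma(2s), except for s = 1/2, where the excess is
        positive.\<close>
      have "s - r \<noteq> - of_nat n"
      proof
        assume "s - r = - of_nat n"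
        then have "2 * (s - r) = - of_nat (2 * n)" by simp
        then show False using A(8) by (metis minus_of_nat_in_nonpos_Ints)
      qed
      moreover have "Re s > - 1/2" if n: "2 * s - 1 = - of_nat n"
      proof (cases n)
        case 0
        then have "2 * s = 1" using n by simp
        then have "2 * Re s = 1" by (metis mult_2 one_complex.sel(1) plus_complex.sel(1))
        then show ?thesis by simp
      next
        case (Suc m)
        then have "2 * s = - of_nat m" using n by (simp add: eq_neg_iff_add_eq_0 algebra_simps)
        then show ?thesis using A(9) by (metis minus_of_nat_in_nonpos_Ints)
      qed
      moreover have "2 * s - 1 = - of_nat n \<or> p = - of_nat n \<or> s - r = - of_nat n \<or> r = - of_nat n \<or> s - p = - of_nat n"
        using 2 unfolding list.set insert_iff empty_iff by metis
      ultimately show ?thesis by blast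
    qed simp
  qed
  then have id: "rGamma s * rGamma (2 * (s - r)) * lhs_series s r p = rhs_series s r p"
    by (simp add: defect_def)
  have nz: "Gamma s \<noteq> 0" "Gamma (2 * (s - r)) \<noteq> 0" "Gamma (s + p) \<noteq> 0" "Gamma (2 * s - p) \<noteq> 0" "Gamma (s + r) \<noteq> 0" "Gamma (2 * s - r) \<noteq> 0"
    using A(8,11,12) Gamma_duplication_ratio(4)[OF A(9)] Gamma_duplication_ratio(4)[OF A(13)] Gamma_duplication_ratio(4)[OF A(14)]
    by (simp_all add: Gamma_eq_zero_iff)
  have lhs: "lhs_series s r p = Gamma s * Gamma (2 * (s - r)) * rhs_series s r p"
    unfolding id [symmetric] using nz by (simp add: rGamma_inverse_Gamma field_simps)
  have regroup: "(A * B) / (C * D) * ((E * F * G * H) / (I * J * K * L)) = E * F / (I * J) * (A * B / (C * D) * (G * H / (K * L)))"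
    for A B C D E F G H I J K L :: complex
    by (simp add: mult_ac)
  have "(Gamma (s + r + 1/2) * Gamma (2 * s - p + 1/2)) / (Gamma (s + 1/2) * Gamma (2 * s - p + r + 1/2))
    * ((Gamma (s + r + p) * Gamma (2 * (s - r)) * Gamma (2 * s) * Gamma (2 * (2 * s - p + r)))
      / (Gamma (s + p) * Gamma (2 * s - r) * Gamma (2 * (s + r)) * Gamma (2 * (2 * s - p))))
    = Gamma (s + r + p) * Gamma (2 * (s - r)) / (Gamma (s + p) * Gamma (2 * s - r)) *
     (Gamma (s + r + 1/2) * Gamma (2 * s - p + 1/2) / (Gamma (s + 1/2) * Gamma (2 * s - p + r + 1/2))
      * (Gamma (2 * s) * Gamma (2 * (2 * s - p + r)) / (Gamma (2 * (s + r)) * Gamma (2 * (2 * s - p)))))"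
    by (rule regroup)
  also have "\<dots> = Gamma (s + r + p) * Gamma (2 * (s - r)) / (Gamma (s + p) * Gamma (2 * s - r)) *
      (Gamma s * Gamma (2 * s - p + r) / (Gamma (s + r) * Gamma (2 * s - p)))"
    unfolding Gamma_prefactor[OF A(9) A(13) A(14) A(10)] ..
  finally have pre: "(Gamma (s + r + 1/2) * Gamma (2 * s - p + 1/2)) / (Gamma (s + 1/2) * Gamma (2 * s - p + r + 1/2))
    * ((Gamma (s + r + p) * Gamma (2 * (s - r)) * Gamma (2 * s) * Gamma (2 * (2 * s - p + r)))
      / (Gamma (s + p) * Gamma (2 * s - r) * Gamma (2 * (s + r)) * Gamma (2 * (2 * s - p)))) = \<dots>" .
  have final: "W * X * Q * (U * V) = V * X / (P * Z) * (W * U / (T * Y)) * (Q * (Y * T * Z * P))"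
    if "P \<noteq> 0" "Z \<noteq> 0" "T \<noteq> 0" "Y \<noteq> 0" for W X Q U V P Z T Y :: complex
    using that by (simp add: field_simps)
  show ?thesis unfolding eqs unfolding ar L R pre lhs
    by (rule final) (use nz in simp_all)
qed

end
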